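(* Let $\gamma\ge0$, let $K$ be the square $(-L,L)^2$ with homogeneous Neumann boundary conditions or the corresponding square with periodic boundary conditions, and let $u_0\in H^1(K)$. Let $u$ be the (gradient flow) solution, with initial datum $u_0$, of $$\frac{\partial u}{\partial t}=\gamma\Delta u+\mathrm{div}\left(\frac{u_{x_1}}{|u_{x_1}|},\frac{u_{x_2}}{|u_{x_2}|}\right)\quad\text{in }K.$$ Then for all $0<\delta<T$, $$\|u_t\|_{L^2((0,T)\times K)}+\sup_{t\in[\delta,T]}\left(\|u_t(\cdot,t)\|_{L^2(K)}+\|\gamma\nabla^2u(\cdot,t)\|_{L^2(K)}\right)\le DATA(\delta),$$ where $DATA(\delta)$ is a finite constant depending only on $\delta$ and the data of the problem (that is, $\|u_0\|_{H^1(K)}$, $\gamma$, $K$, $T$). For $\gamma=0$ the term with $\gamma\nabla^2 u$ is absent.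
   Context: The equation is understood as the gradient flow in $L^2(K)$ of the convex lower semicontinuous functional $\Phi$ defined as follows. For $\gamma>0$: $\Phi(u)=\int_K\frac\gamma2|\nabla u|^2+|u_{x_1}|+|u_{x_2}|\,dx$ if $u\in H^1(K)$, and $+\infty$ otherwise. For $\gamma=0$: $\Phi(u)=\sup\{\int_K u\,\mathrm{div}\,z\,dx: z\in C^1_c(K;\mathbb{R}^2),\ \max(|z_1|,|z_2|)\le1\}\in[0,\infty]$. In the periodic case $K$ is identified with the torus $\mathbb{R}^2/(2L\mathbb{Z})^2$ and the spaces $H^1(K)$ and $C^1_c(K)$ are those of the torus. The solution is the unique $u\in C([0,\infty);L^2(K))$, Lipschitz on $[\delta,\infty)$ for each $\delta>0$, with $u(0)=u_0$ and $-\frac{d^+u}{dt}(t)\in\partial\Phi(u(t))$ for all $t>0$ ($\partial\Phi$ the $L^2$-subdifferential, $d^+/dt$ the right derivative). For each $t>0$, $u_t(\cdot,t)$ denotes this right derivative. *)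

theory Defs
  imports "HOL-Analysis.Analysis"
begin

section \<open>Square-integrable functions\<close>

text \<open>Elements of $L^2(S)$ are represented by functions on the whole space, of which only the
  values on \<open>S\<close>, up to null sets, matter. All definitions below respect this identification.\<close>

definition L2_space :: "'a::euclidean_space set \<Rightarrow> ('a \<Rightarrow> 'b::euclidean_space) set" where
  "L2_space S = {f \<in> borel_measurable (lebesgue_on S).
                   integrable (lebesgue_on S) (\<lambda>x. (norm (f x))\<^sup>2)}"

definition L2_norm :: "'a::euclidean_space set \<Rightarrow> ('a \<Rightarrow> 'b::euclidean_space) \<Rightarrow> real" where
  "L2_norm S f = sqrt (LINT x|lebesgue_on S. (norm (f x))\<^sup>2)"

text \<open>Unlike \<^const>\<open>L2_norm\<close>, whose value is meaningless outside \<^const>\<open>L2_space\<close>, the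
  extended norm makes a bound assert square-integrability.\<close>

definition L2_enorm :: "'a::euclidean_space set \<Rightarrow> ('a \<Rightarrow> 'b::euclidean_space) \<Rightarrow> ennreal" where
  "L2_enorm S f = (if f \<in> L2_space S then ennreal (L2_norm S f) else \<infinity>)"

definition L2_inner :: "'a::euclidean_space set \<Rightarrow> ('a \<Rightarrow> real) \<Rightarrow> ('a \<Rightarrow> real) \<Rightarrow> real" where
  "L2_inner S f g = (LINT x|lebesgue_on S. f x * g x)"

section \<open>The square, its test functions, and Sobolev spaces\<close>

datatype boundary_cond = Neumann | Periodic

definition square :: "real \<Rightarrow> (real^2) set" where
  "square L = {x. \<forall>i. - L < x $ i \<and> x $ i < L}"

definition partial_deriv :: "2 \<Rightarrow> (real^2 \<Rightarrow> real) \<Rightarrow> real^2 \<Rightarrow> real" where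
  "partial_deriv i \<phi> x = frechet_derivative \<phi> (at x) (axis i 1)"

definition C1_fun :: "(real^2 \<Rightarrow> real) \<Rightarrow> bool" where
  "C1_fun \<phi> \<longleftrightarrow> (\<forall>x. \<phi> differentiable (at x)) \<and> (\<forall>i. continuous_on UNIV (partial_deriv i \<phi>))"

text \<open>The space $C^1_c(K)$. In the Neumann case \<open>K\<close> is the open square, and a test function is
  extended by zero to the plane. In the periodic case \<open>K\<close> is the (compact) torus
  $\mathbb{R}^2/(2L\mathbb{Z})^2$, whose $C^1$ functions are the \<open>2L\<close>-periodic $C^1$ functions on
  the plane; integrals over the torus are integrals over the fundamental domain \<^term>\<open>square L\<close>.\<close>

definition test_functions :: "boundary_cond \<Rightarrow> real \<Rightarrow> (real^2 \<Rightarrow> real) set" where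
  "test_functions bc L = {\<phi>. C1_fun \<phi> \<and>
     (case bc of
        Neumann \<Rightarrow> compact (closure {x. \<phi> x \<noteq> 0}) \<and> closure {x. \<phi> x \<noteq> 0} \<subseteq> square L
      | Periodic \<Rightarrow> (\<forall>x i. \<phi> (x + axis i (2 * L)) = \<phi> x))}"

definition is_weak_grad ::
    "boundary_cond \<Rightarrow> real \<Rightarrow> (real^2 \<Rightarrow> real) \<Rightarrow> (real^2 \<Rightarrow> real^2) \<Rightarrow> bool" where
  "is_weak_grad bc L u G \<longleftrightarrow> G \<in> L2_space (square L) \<and>
     (\<forall>\<phi> \<in> test_functions bc L. \<forall>i.
        (LINT x|lebesgue_on (square L). u x * partial_deriv i \<phi> x) =
        - (LINT x|lebesgue_on (square L). G x $ i * \<phi> x))"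

definition H1_space :: "boundary_cond \<Rightarrow> real \<Rightarrow> (real^2 \<Rightarrow> real) set" where
  "H1_space bc L = {u \<in> L2_space (square L). \<exists>G. is_weak_grad bc L u G}"

text \<open>For \<open>u\<close> in \<^const>\<open>H1_space\<close> the weak gradient is determined up to a null set.\<close>

definition weak_grad :: "boundary_cond \<Rightarrow> real \<Rightarrow> (real^2 \<Rightarrow> real) \<Rightarrow> real^2 \<Rightarrow> real^2" where
  "weak_grad bc L u = (SOME G. is_weak_grad bc L u G)"

definition H1_norm :: "boundary_cond \<Rightarrow> real \<Rightarrow> (real^2 \<Rightarrow> real) \<Rightarrow> real" where
  "H1_norm bc L u =
     sqrt ((L2_norm (square L) u)\<^sup>2 + (L2_norm (square L) (weak_grad bc L u))\<^sup>2)"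

definition H2_space :: "boundary_cond \<Rightarrow> real \<Rightarrow> (real^2 \<Rightarrow> real) set" where
  "H2_space bc L = {u \<in> H1_space bc L. \<forall>i. (\<lambda>x. weak_grad bc L u x $ i) \<in> H1_space bc L}"

text \<open>The norm of \<^typ>\<open>real^2^2\<close> is the Frobenius norm.\<close>

definition weak_hessian :: "boundary_cond \<Rightarrow> real \<Rightarrow> (real^2 \<Rightarrow> real) \<Rightarrow> real^2 \<Rightarrow> real^2^2" where
  "weak_hessian bc L u x = (\<chi> i. weak_grad bc L (\<lambda>y. weak_grad bc L u y $ i) x)"

section \<open>The energy functional and its gradient flow\<close>

definition divergence :: "(real^2 \<Rightarrow> real^2) \<Rightarrow> real^2 \<Rightarrow> real" where
  "divergence z x = (\<Sum>i\<in>UNIV. partial_deriv i (\<lambda>y. z y $ i) x)"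

definition energy :: "real \<Rightarrow> boundary_cond \<Rightarrow> real \<Rightarrow> (real^2 \<Rightarrow> real) \<Rightarrow> ereal" where
  "energy \<gamma> bc L u =
     (if \<gamma> > 0 then
        (if u \<in> H1_space bc L
         then ereal (LINT x|lebesgue_on (square L).
                \<gamma> / 2 * (norm (weak_grad bc L u x))\<^sup>2
                + \<bar>weak_grad bc L u x $ 1\<bar> + \<bar>weak_grad bc L u x $ 2\<bar>)
         else \<infinity>)
      else
        (SUP z \<in> {z. (\<forall>i. (\<lambda>x. z x $ i) \<in> test_functions bc L) \<and>
                      (\<forall>x. max \<bar>z x $ 1\<bar> \<bar>z x $ 2\<bar> \<le> 1)}.
           ereal (LINT x|lebesgue_on (square L). u x * divergence z x)))"

definition subdifferential ::
    "'a::euclidean_space set \<Rightarrow> (('a \<Rightarrow> real) \<Rightarrow> ereal) \<Rightarrow> ('a \<Rightarrow> real) \<Rightarrow> ('a \<Rightarrow> real) set" where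
  "subdifferential S \<Phi> u = {f \<in> L2_space S. u \<in> L2_space S \<and> \<Phi> u < \<infinity> \<and>
     (\<forall>v \<in> L2_space S. \<Phi> u + ereal (L2_inner S f (\<lambda>x. v x - u x)) \<le> \<Phi> v)}"

definition has_right_L2_deriv ::
    "'a::euclidean_space set \<Rightarrow> (real \<Rightarrow> 'a \<Rightarrow> real) \<Rightarrow> ('a \<Rightarrow> real) \<Rightarrow> real \<Rightarrow> bool" where
  "has_right_L2_deriv S u v t \<longleftrightarrow> v \<in> L2_space S \<and>
     ((\<lambda>h. L2_norm S (\<lambda>x. (u (t + h) x - u t x) / h - v x)) \<longlongrightarrow> 0) (at_right 0)"

definition gradient_flow_solution ::
    "real \<Rightarrow> boundary_cond \<Rightarrow> real \<Rightarrow> (real^2 \<Rightarrow> real) \<Rightarrow> (real \<Rightarrow> real^2 \<Rightarrow> real) \<Rightarrow> bool" where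
  "gradient_flow_solution \<gamma> bc L u0 u \<longleftrightarrow>
     (\<forall>t\<ge>0. u t \<in> L2_space (square L)) \<and>
     (\<forall>t\<ge>0. ((\<lambda>s. L2_norm (square L) (\<lambda>x. u s x - u t x)) \<longlongrightarrow> 0) (at t within {0..})) \<and>
     (\<forall>\<delta>>0. \<exists>C. \<forall>s\<ge>\<delta>. \<forall>t\<ge>\<delta>. L2_norm (square L) (\<lambda>x. u s x - u t x) \<le> C * \<bar>s - t\<bar>) \<and>
     (AE x in lebesgue_on (square L). u 0 x = u0 x) \<and>
     (\<forall>t>0. \<exists>v. has_right_L2_deriv (square L) u v t \<and>
        (\<lambda>x. - v x) \<in> subdifferential (square L) (energy \<gamma> bc L) (u t))"

end

theory Submission
  imports Defs
begin

text \<open>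
  The bounds rest on two independent facts about the subgradient \<open>- u\<^sub>t(t)\<close> of the energy \<open>\<Phi>\<close>.

  \<^emph>\<open>The flow.\<close> Monotonicity of the subdifferential makes the increments \<open>|u(t + h) - u(t)|\<close>, and hence
  the speed \<open>|u\<^sub>t(t)|\<close>, decrease in time (\<open>speed_decreasing\<close>). The right derivative \<open>u\<^sub>t\<close> is continuous from
  the right (\<open>V_right_continuous\<close>), so the energy along the solution has right derivative \<open>- |u\<^sub>t|\<^sup>2\<close>.
  Consequently \<open>\<integral> |u\<^sub>t|\<^sup>2 dt \<le> \<Phi>(u0)\<close> (\<open>speed_integral\<close>) and, since the speed decreases,
  \<open>t |u\<^sub>t(t)|\<^sup>2 \<le> \<Phi>(u0)\<close> (\<open>speed_bound\<close>). All this happens in an inner product space and uses only the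
  subgradient inequality along the curve. Finally \<open>\<Phi>(u0)\<close> is bounded by the \<open>H\<^sup>1\<close> norm of \<open>u0\<close>
  (\<open>energy_le_H1\<close>).

  \<^emph>\<open>Regularity in space.\<close> Let \<open>\<gamma> > 0\<close> and let \<open>f\<close> be a subgradient of \<open>\<Phi>\<close> at \<open>u\<close>. Formally, testing
  the equation \<open>f = - \<gamma> \<Delta>u - div(\<dots>)\<close> with \<open>- \<Delta>u\<close> gives \<open>\<gamma> |\<nabla>\<^sup>2u| \<le> |f|\<close>, as the nonsmooth term has a sign.
  The rigorous form is variational: compare \<open>u\<close> with the mean of \<open>u\<close> and its translates by \<open>h\<close> and \<open>- h\<close>
  along an axis, continued periodically or by even reflection across the faces of the square. Such
  translates respect the boundary condition and together carry twice the energy of \<open>u\<close>, while the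
  quadratic part of \<open>\<Phi>\<close> is strongly convex. So the squared first differences of \<open>\<nabla>u\<close> are bounded by
  \<open>|f|\<close> times the second difference of \<open>u\<close> (\<open>subdifferential_gap\<close>), which is itself of order \<open>h\<close> times the
  first differences of \<open>\<nabla>u\<close>. Hence these are of order \<open>h |f| / \<gamma>\<close> (\<open>gradient_translation_estimate\<close>), and the
  Riesz representation produces the second derivatives (\<open>H2_regularity\<close>).

  The space-time norm also requires representatives of \<open>u\<^sub>t(t)\<close> that are jointly measurable in time and
  space; they arise as a limit of step functions (\<open>joint_representative\<close>).
\<close>

section \<open>Gradient flows in inner product spaces\<close>

definition has_right_deriv :: "(real \<Rightarrow> 'a::real_normed_vector) \<Rightarrow> 'a \<Rightarrow> real \<Rightarrow> bool" where
  "has_right_deriv f D t \<longleftrightarrow> ((\<lambda>h. (f (t + h) - f t) /\<^sub>R h) \<longlongrightarrow> D) (at_right 0)"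

lemma has_right_deriv_imp_continuous:
  assumes "has_right_deriv f D t"
  shows "((\<lambda>h. f (t + h)) \<longlongrightarrow> f t) (at_right 0)"
proof -
  have "((\<lambda>h::real. h) \<longlongrightarrow> 0) (at_right 0)"
    by simp
  from tendsto_add[OF tendsto_scaleR[OF this assms[unfolded has_right_deriv_def]] tendsto_const[of "f t"]]
  have "((\<lambda>h. h *\<^sub>R ((f (t + h) - f t) /\<^sub>R h) + f t) \<longlongrightarrow> f t) (at_right 0)"
    by simp
  moreover have "\<forall>\<^sub>F h in at_right (0::real). h *\<^sub>R ((f (t + h) - f t) /\<^sub>R h) + f t = f (t + h)"
    by (auto simp: eventually_at_filter)
  ultimately show ?thesis
    by (rule Lim_transform_eventually)
qed

lemma has_right_deriv_diff:
  assumes "has_right_deriv f D t" "has_right_deriv g E t"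
  shows "has_right_deriv (\<lambda>s. f s - g s) (D - E) t"
  using tendsto_diff[OF assms[unfolded has_right_deriv_def]]
  by (simp add: has_right_deriv_def algebra_simps)

lemma has_right_deriv_const: "has_right_deriv (\<lambda>s. c) 0 t"
  by (simp add: has_right_deriv_def)

lemma has_right_deriv_norm_sq:
  fixes f :: "real \<Rightarrow> 'a::real_inner"
  assumes "has_right_deriv f D t"
  shows "has_right_deriv (\<lambda>s. (norm (f s))\<^sup>2) (2 * inner D (f t)) t"
proof -
  have "((\<lambda>h. inner ((f (t + h) - f t) /\<^sub>R h) (f (t + h) + f t)) \<longlongrightarrow> inner D (f t + f t)) (at_right 0)"
    by (intro tendsto_intros has_right_deriv_imp_continuous[OF assms] assms[unfolded has_right_deriv_def])
  moreover have "inner ((f (t + h) - f t) /\<^sub>R h) (f (t + h) + f t) = ((norm (f (t + h)))\<^sup>2 - (norm (f t))\<^sup>2) /\<^sub>R h" for h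
    by (simp add: power2_norm_eq_inner inner_diff_left inner_diff_right inner_add_right inner_commute)
  ultimately show ?thesis
    by (simp add: has_right_deriv_def inner_add_right)
qed

text \<open>At the last time at which \<open>f\<close> lies below the line of slope \<open>c + e\<close> through an earlier point of its
  graph, its right derivative would be at least \<open>c + e\<close>. The derivative is required at interior times
  only, since a gradient flow need not be differentiable at its initial time; continuity of \<open>f\<close> gives
  the estimate up to \<open>a\<close>.\<close>

lemma right_deriv_upper_bound:
  fixes f :: "real \<Rightarrow> real"
  assumes ab: "a \<le> b" and cont: "continuous_on {a..b} f"
    and der: "\<And>t. a < t \<Longrightarrow> t < b \<Longrightarrow> \<exists>D\<le>c. has_right_deriv f D t"
  shows "f b - f a \<le> c * (b - a)"
proof (cases "a = b")
  case False
  with ab have ab: "a < b" by simp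
  have inner: "f b - f a' \<le> (c + e) * (b - a')" if a': "a < a'" "a' < b" and e: "e > 0" for a' e
  proof (rule ccontr)
    assume neg: "\<not> ?thesis"
    define g where "g s = f s - (c + e) * s" for s
    have gb: "g b > g a'"
      using neg by (simp add: g_def algebra_simps)
    define A where "A = {s \<in> {a'..b}. g s \<le> g a'}"
    have cg: "continuous_on {a'..b} g"
      unfolding g_def using a' by (intro continuous_intros continuous_on_subset[OF cont]) auto
    have "closed A"
      unfolding A_def by (intro continuous_on_closed_Collect_le cg continuous_on_const closed_atLeastAtMost)
    moreover have "a' \<in> A" "bdd_above A"
      using a' by (auto simp: A_def bdd_above_def)
    ultimately have tA: "Sup A \<in> A"
      by (intro closed_contains_Sup) auto
    define t where "t = Sup A"
    have t: "t < b" "a' \<le> t" "g t \<le> g a'"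
      using tA gb by (auto simp: A_def t_def intro: order.not_eq_order_implies_strict)
    have up: "g s > g t" if "t < s" "s \<le> b" for s
    proof -
      have "s \<notin> A"
        using cSup_upper[OF _ \<open>bdd_above A\<close>, of s] that by (auto simp: t_def)
      then show ?thesis
        using that t by (auto simp: A_def)
    qed
    from der[of t] t a' obtain D where D: "D \<le> c" "has_right_deriv f D t"
      by auto
    have "((\<lambda>h. (f (t + h) - f t) /\<^sub>R h - (c + e)) \<longlongrightarrow> D - (c + e)) (at_right 0)"
      using D(2) unfolding has_right_deriv_def by (intro tendsto_intros)
    moreover have "\<forall>\<^sub>F h in at_right 0. (f (t + h) - f t) /\<^sub>R h - (c + e) \<ge> 0"
    proof -
      have "\<forall>\<^sub>F h in at_right 0. h \<in> {0<..<b - t}"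
        using t by (intro eventually_at_right_real) simp
      then show ?thesis
      proof eventually_elim
        case (elim h)
        then have "f (t + h) - f t \<ge> (c + e) * h"
          using up[of "t + h"] by (auto simp: g_def algebra_simps)
        then show ?case
          using elim by (simp add: field_simps)
      qed
    qed
    ultimately have "D - (c + e) \<ge> 0"
      by (rule tendsto_lowerbound) simp
    with D e show False by simp
  qed
  have inner2: "f b - f a' \<le> c * (b - a')" if a': "a < a'" "a' < b" for a'
  proof (rule field_le_epsilon)
    fix e :: real assume "e > 0"
    then show "f b - f a' \<le> c * (b - a') + e"
      using inner[OF a', of "e / (b - a')"] a' by (simp add: distrib_right)
  qed
  have "(f \<longlongrightarrow> f a) (at_right a)"
    using cont ab by (rule continuous_on_Icc_at_rightD)
  then have "((\<lambda>x. f b - f x) \<longlongrightarrow> f b - f a) (at_right a)"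
    by (intro tendsto_intros)
  moreover have "((\<lambda>x. c * (b - x)) \<longlongrightarrow> c * (b - a)) (at_right a)"
    by (intro tendsto_intros)
  moreover have "\<forall>\<^sub>F x in at_right a. f b - f x \<le> c * (b - x)"
    using eventually_at_right_real[OF ab] by eventually_elim (use inner2 in auto)
  ultimately show ?thesis
    by (intro tendsto_le[of "at_right a"]) auto
qed simp

text \<open>A curve \<open>U\<close> with right derivative \<open>V\<close> such that \<open>- V t\<close> is a subgradient of the energy at \<open>U t\<close>,
  where \<open>\<phi>\<close> is the energy along the curve. The subgradient inequality is stated between points of
  the curve, including the initial one.\<close>

locale subgradient_flow =
  fixes U V :: "real \<Rightarrow> 'a::real_inner" and \<phi> :: "real \<Rightarrow> real"
  assumes continuous_U: "continuous_on {0..} U"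
    and right_deriv_U: "t > 0 \<Longrightarrow> has_right_deriv U (V t) t"
    and subgradient: "t > 0 \<Longrightarrow> s \<ge> 0 \<Longrightarrow> \<phi> s \<ge> \<phi> t - inner (V t) (U s - U t)"
begin

lemma monotone:
  assumes "s > 0" "t > 0"
  shows "inner (V s - V t) (U s - U t) \<le> 0"
  using subgradient[of s t] subgradient[of t s] assms
  by (simp add: inner_diff_left inner_diff_right)

text \<open>A time shift of the curve is again a solution, and two solutions do not move apart because the
  subdifferential is monotone.\<close>

lemma increment_decreasing:
  assumes "0 < s" "s \<le> t" "0 \<le> h"
  shows "norm (U (t + h) - U t) \<le> norm (U (s + h) - U s)"
proof -
  define f where "f \<tau> = (norm (U (\<tau> + h) - U \<tau>))\<^sup>2" for \<tau>
  have "f t - f s \<le> 0 * (t - s)"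
  proof (rule right_deriv_upper_bound)
    show "continuous_on {s..t} f"
      unfolding f_def using assms
      by (intro continuous_intros continuous_on_compose2[OF continuous_U]) auto
    fix \<tau> assume \<tau>: "s < \<tau>" "\<tau> < t"
    have "has_right_deriv (\<lambda>\<tau>. U (\<tau> + h)) (V (\<tau> + h)) \<tau>"
      using right_deriv_U[of "\<tau> + h"] \<tau> assms by (simp add: has_right_deriv_def algebra_simps)
    from has_right_deriv_norm_sq[OF has_right_deriv_diff[OF this right_deriv_U]]
    have "has_right_deriv f (2 * inner (V (\<tau> + h) - V \<tau>) (U (\<tau> + h) - U \<tau>)) \<tau>"
      using \<tau> assms by (simp add: f_def[abs_def])
    then show "\<exists>D\<le>0. has_right_deriv f D \<tau>"
      using monotone[of "\<tau> + h" \<tau>] \<tau> assms by (intro exI conjI) auto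
  qed (use assms in auto)
  then show ?thesis
    by (simp add: f_def)
qed

lemma speed_decreasing:
  assumes "0 < s" "s \<le> t"
  shows "norm (V t) \<le> norm (V s)"
proof (rule tendsto_le)
  show "((\<lambda>h. norm ((U (s + h) - U s) /\<^sub>R h)) \<longlongrightarrow> norm (V s)) (at_right 0)"
    using right_deriv_U[of s] assms unfolding has_right_deriv_def by (intro tendsto_intros) auto
  show "((\<lambda>h. norm ((U (t + h) - U t) /\<^sub>R h)) \<longlongrightarrow> norm (V t)) (at_right 0)"
    using right_deriv_U[of t] assms unfolding has_right_deriv_def by (intro tendsto_intros) auto
  show "\<forall>\<^sub>F h in at_right 0. norm ((U (t + h) - U t) /\<^sub>R h) \<le> norm ((U (s + h) - U s) /\<^sub>R h)"
    using eventually_at_right_less[of "0::real"]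
    by eventually_elim (use increment_decreasing[OF assms] in \<open>auto intro!: mult_left_mono\<close>)
qed simp

lemma continuous_U_right:
  assumes "t > 0"
  shows "((\<lambda>h. U (t + h)) \<longlongrightarrow> U t) (at_right 0)"
  using has_right_deriv_imp_continuous[OF right_deriv_U[OF assms]] .

text \<open>The function \<open>|U (t + s) - U t|\<^sup>2\<close> of \<open>s\<close> has right derivative
  \<open>2 inner (V (t + s)) (U (t + s) - U t)\<close> and behaves like \<open>s\<^sup>2 |V t|\<^sup>2\<close> near \<open>0\<close>. Hence the inner
  product below cannot stay under \<open>|V t|\<^sup>2 - e\<close>.\<close>

lemma exists_good_slope:
  assumes "t > 0" "e > 0" "d > 0"
  shows "\<exists>s. 0 < s \<and> s < d \<and> inner (V (t + s)) ((U (t + s) - U t) /\<^sub>R s) \<ge> (norm (V t))\<^sup>2 - e"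
proof (rule ccontr)
  assume "\<not> ?thesis"
  then have neg: "inner (V (t + s)) ((U (t + s) - U t) /\<^sub>R s) < (norm (V t))\<^sup>2 - e" if "0 < s" "s < d" for s
    using that by force
  define c where "c = (norm (V t))\<^sup>2 - e"
  define f where "f s = (norm (U (t + s) - U t))\<^sup>2 - c * s\<^sup>2" for s
  have le: "f b \<le> 0" if b: "0 < b" "b < d" for b
  proof -
    have "f b - f 0 \<le> 0 * (b - 0)"
    proof (rule right_deriv_upper_bound)
      show "continuous_on {0..b} f"
        unfolding f_def using assms
        by (intro continuous_intros continuous_on_compose2[OF continuous_U]) auto
      fix \<tau> assume \<tau>: "0 < \<tau>" "\<tau> < b"
      have "has_right_deriv (\<lambda>\<tau>. U (t + \<tau>)) (V (t + \<tau>)) \<tau>"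
        using right_deriv_U[of "t + \<tau>"] \<tau> assms by (simp add: has_right_deriv_def algebra_simps)
      from has_right_deriv_norm_sq[OF has_right_deriv_diff[OF this has_right_deriv_const]]
      have 1: "has_right_deriv (\<lambda>\<tau>. (norm (U (t + \<tau>) - U t))\<^sup>2) (2 * inner (V (t + \<tau>)) (U (t + \<tau>) - U t)) \<tau>"
        by simp
      have 2: "has_right_deriv (\<lambda>\<tau>. c * \<tau>\<^sup>2) (c * (2 * \<tau>)) \<tau>"
      proof -
        have "((\<lambda>h. c * (2 * \<tau> + h)) \<longlongrightarrow> c * (2 * \<tau> + 0)) (at_right 0)"
          by (intro tendsto_intros)
        moreover have "\<forall>\<^sub>F h in at_right (0::real). c * (2 * \<tau> + h) = (c * (\<tau> + h)\<^sup>2 - c * \<tau>\<^sup>2) /\<^sub>R h"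
          by (auto simp: eventually_at_filter field_simps power2_eq_square)
        ultimately show ?thesis
          unfolding has_right_deriv_def by (auto intro: Lim_transform_eventually)
      qed
      have "inner (V (t + \<tau>)) (U (t + \<tau>) - U t) / \<tau> \<le> c"
        using neg[of \<tau>] \<tau> b unfolding inner_scaleR_right by (simp add: c_def divide_inverse_commute)
      then have "inner (V (t + \<tau>)) (U (t + \<tau>) - U t) \<le> c * \<tau>"
        using \<tau> by (simp add: pos_divide_le_eq)
      then show "\<exists>D\<le>0. has_right_deriv f D \<tau>"
        using has_right_deriv_diff[OF 1 2] by (intro exI conjI) (auto simp: f_def[abs_def])
    qed (use b in auto)
    then show ?thesis by (simp add: f_def)
  qed
  have "((\<lambda>h. (norm ((U (t + h) - U t) /\<^sub>R h))\<^sup>2) \<longlongrightarrow> (norm (V t))\<^sup>2) (at_right 0)"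
    using right_deriv_U[of t] assms unfolding has_right_deriv_def by (intro tendsto_intros) auto
  moreover have "\<forall>\<^sub>F h in at_right 0. (norm ((U (t + h) - U t) /\<^sub>R h))\<^sup>2 \<le> c"
    using eventually_at_right_real[OF assms(3)]
  proof eventually_elim
    case (elim h)
    then show ?case
      using le[of h] by (simp add: f_def power_mult_distrib power_inverse divide_inverse_commute[symmetric] power_divide pos_divide_le_eq)
  qed
  ultimately have "(norm (V t))\<^sup>2 \<le> c"
    by (rule tendsto_upperbound) simp
  with assms show False by (simp add: c_def)
qed

text \<open>The norm of \<open>V\<close> decreases, so it suffices that \<open>inner (V (t + h)) (V t)\<close> is asymptotically at least
  \<open>|V t|\<^sup>2\<close>. Monotonicity between the times \<open>t + h\<close> and \<open>t + s\<close> bounds this product from below, as \<open>h\<close>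
  tends to \<open>0\<close>, by the slope at the fixed time \<open>s\<close> of \<open>exists_good_slope\<close>.\<close>

lemma V_right_continuous:
  assumes t: "t > 0"
  shows "((\<lambda>h. V (t + h)) \<longlongrightarrow> V t) (at_right 0)"
proof -
  let ?n = "norm (V t)"
  have ev_inner: "\<forall>\<^sub>F h in at_right 0. inner (V (t + h)) (V t) \<ge> ?n\<^sup>2 - e" if e: "e > 0" for e
  proof -
    \<comment> \<open>Three error terms of size at most \<open>?n * e'\<close> arise below; the added \<open>1\<close> covers \<open>V t = 0\<close>.\<close>
    define w where "w s = (U (t + s) - U t) /\<^sub>R s" for s
    define e' where "e' = e / (4 * (?n + 1))"
    have e': "e' > 0" using e by (simp add: e'_def add_nonneg_pos)
    have "?n * e' \<le> (?n + 1) * e'"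
      using e' by (simp add: mult_right_mono)
    also have "\<dots> = e / 4"
      using norm_ge_zero[of "V t"] unfolding e'_def by (simp add: divide_simps add_nonneg_eq_0_iff)
    finally have e'n: "?n * e' \<le> e / 4" .
    have "\<forall>\<^sub>F s in at_right 0. dist (w s) (V t) < e'"
      using right_deriv_U[OF t] e' unfolding has_right_deriv_def w_def by (rule tendstoD)
    then obtain d where d: "d > 0" "\<And>s. 0 < s \<Longrightarrow> s < d \<Longrightarrow> dist (w s) (V t) < e'"
      unfolding eventually_at_right_field by auto
    obtain s where s: "0 < s" "s < d" "inner (V (t + s)) (w s) \<ge> ?n\<^sup>2 - e / 4"
      using exists_good_slope[OF t, of "e / 4" d] e d by (auto simp: w_def)
    have cont: "((\<lambda>h. norm (U (t + h) - U t)) \<longlongrightarrow> 0) (at_right 0)"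
      using tendsto_norm_zero[OF LIM_zero[OF continuous_U_right[OF t]]] .
    have "\<forall>\<^sub>F h in at_right 0. norm (U (t + h) - U t) < s * e'"
      using order_tendstoD(2)[OF cont, of "s * e'"] s e' by simp
    moreover have "\<forall>\<^sub>F h in at_right 0. h \<in> {0<..<s}"
      using s by (intro eventually_at_right_real)
    ultimately show ?thesis
    proof eventually_elim
      case (elim h)
      then have h: "0 < h" "h < s" by auto
      have nV: "norm (V (t + h)) \<le> ?n" "norm (V (t + s)) \<le> ?n"
        using speed_decreasing[of t "t + h"] speed_decreasing[of t "t + s"] h s t by auto
      \<comment> \<open>\<open>z\<close> is the error of replacing \<open>U (t + h)\<close> by \<open>U t\<close> in the slope over \<open>[t + h, t + s]\<close>.\<close>
      define z where "z = (U (t + h) - U t) /\<^sub>R s"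
      have z: "norm z \<le> e'"
        using elim s by (simp add: z_def divide_inverse_commute[symmetric] pos_divide_le_eq mult.commute)
      have "inner (V (t + s) - V (t + h)) (U (t + s) - U (t + h)) \<le> 0"
        using monotone[of "t + s" "t + h"] h s t by simp
      moreover have "U (t + s) - U (t + h) = s *\<^sub>R (w s - z)"
        using s by (simp add: w_def z_def scaleR_right_diff_distrib)
      ultimately have "inner (V (t + s) - V (t + h)) (w s - z) \<le> 0"
        using s by (simp add: mult_le_0_iff)
      then have 1: "inner (V (t + h)) (w s - z) \<ge> inner (V (t + s)) (w s - z)"
        by (simp add: inner_diff_left)
      have cs: "\<bar>inner a b\<bar> \<le> ?n * e'" if "norm a \<le> ?n" "norm b \<le> e'" for a b :: 'a
        by (rule order_trans[OF Cauchy_Schwarz_ineq2 mult_mono[OF that]]) auto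
      have "\<bar>inner (V (t + h)) z\<bar> \<le> ?n * e'" "\<bar>inner (V (t + s)) z\<bar> \<le> ?n * e'"
        "\<bar>inner (V (t + h)) (w s - V t)\<bar> \<le> ?n * e'"
        using nV z d(2)[of s] s by (auto intro!: cs simp: dist_norm)
      with 1 s e'n show ?case
        by (simp add: inner_diff_right)
    qed
  qed
  show ?thesis
  proof (rule tendstoI)
    fix e :: real assume e: "e > 0"
    have "\<forall>\<^sub>F h in at_right 0. inner (V (t + h)) (V t) \<ge> ?n\<^sup>2 - e\<^sup>2 / 4"
      using e by (intro ev_inner) simp
    then show "\<forall>\<^sub>F h in at_right 0. dist (V (t + h)) (V t) < e"
      using eventually_at_right_less[of "0::real"]
    proof eventually_elim
      case (elim h)
      have "(norm (V (t + h)))\<^sup>2 \<le> ?n\<^sup>2"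
        using speed_decreasing[of t "t + h"] elim t by (intro power_mono) auto
      then have "(norm (V (t + h) - V t))\<^sup>2 \<le> e\<^sup>2 / 2"
        using elim by (simp add: power2_norm_eq_inner inner_diff_left inner_diff_right inner_commute)
      also have "\<dots> < e\<^sup>2" using e by simp
      finally show ?case
        using e by (simp add: dist_norm power2_less_imp_less)
    qed
  qed
qed

text \<open>The subgradient inequalities at \<open>t\<close> and at \<open>t + h\<close> enclose the difference quotient of the energy;
  right continuity of \<open>V\<close> makes both bounds converge to the same limit.\<close>

lemma energy_right_deriv:
  assumes t: "t > 0"
  shows "has_right_deriv \<phi> (- (norm (V t))\<^sup>2) t"
  unfolding has_right_deriv_def
proof (rule tendsto_sandwich)
  let ?w = "\<lambda>h. (U (t + h) - U t) /\<^sub>R h"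
  show "((\<lambda>h. - inner (V t) (?w h)) \<longlongrightarrow> - (norm (V t))\<^sup>2) (at_right 0)"
    unfolding power2_norm_eq_inner
    using right_deriv_U[OF t] unfolding has_right_deriv_def by (intro tendsto_intros)
  show "((\<lambda>h. - inner (V (t + h)) (?w h)) \<longlongrightarrow> - (norm (V t))\<^sup>2) (at_right 0)"
    unfolding power2_norm_eq_inner
    using right_deriv_U[OF t] unfolding has_right_deriv_def
    by (intro tendsto_intros V_right_continuous[OF t])
  show "\<forall>\<^sub>F h in at_right 0. - inner (V t) (?w h) \<le> (\<phi> (t + h) - \<phi> t) /\<^sub>R h"
    using eventually_at_right_less[of "0::real"]
  proof eventually_elim
    case (elim h)
    have "- inner (V t) (U (t + h) - U t) \<le> \<phi> (t + h) - \<phi> t"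
      using subgradient[OF t, of "t + h"] elim t by simp
    from mult_left_mono[OF this, of "inverse h"] show ?case
      using elim by simp
  qed
  show "\<forall>\<^sub>F h in at_right 0. (\<phi> (t + h) - \<phi> t) /\<^sub>R h \<le> - inner (V (t + h)) (?w h)"
    using eventually_at_right_less[of "0::real"]
  proof eventually_elim
    case (elim h)
    have "\<phi> (t + h) - \<phi> t \<le> inner (V (t + h)) (U t - U (t + h))"
      using subgradient[of "t + h" t] elim t by simp
    from mult_left_mono[OF this, of "inverse h"] show ?case
      using elim by (simp add: inner_diff_right right_diff_distrib)
  qed
qed

lemma energy_continuous:
  assumes "0 < a"
  shows "continuous_on {a..b} \<phi>"
proof -
  have lip: "\<bar>\<phi> s - \<phi> t\<bar> \<le> norm (V a) * norm (U s - U t)" if "a \<le> s" "a \<le> t" for s t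
  proof -
    have *: "\<phi> t - \<phi> s \<le> norm (V a) * norm (U s - U t)" if "a \<le> s" "a \<le> t" for s t
    proof -
      have "\<phi> t - \<phi> s \<le> inner (V t) (U s - U t)"
        using subgradient[of t s] that assms by simp
      also have "\<dots> \<le> norm (V t) * norm (U s - U t)"
        by (rule norm_cauchy_schwarz)
      also have "\<dots> \<le> norm (V a) * norm (U s - U t)"
        using speed_decreasing[OF assms that(2)] by (intro mult_right_mono) auto
      finally show ?thesis .
    qed
    from *[OF that] *[OF that(2,1)] show ?thesis
      by (simp add: norm_minus_commute abs_le_iff)
  qed
  show ?thesis
    unfolding continuous_on_def
  proof safe
    fix t assume t: "t \<in> {a..b}"
    have "continuous_on {a..b} U"
      using assms by (intro continuous_on_subset[OF continuous_U]) auto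
    then have "(U \<longlongrightarrow> U t) (at t within {a..b})"
      using t by (simp add: continuous_on_def)
    then have "((\<lambda>s. norm (V a) * norm (U s - U t)) \<longlongrightarrow> norm (V a) * norm (U t - U t)) (at t within {a..b})"
      by (intro tendsto_intros)
    then have "((\<lambda>s. norm (V a) * norm (U s - U t)) \<longlongrightarrow> 0) (at t within {a..b})"
      by simp
    then have "((\<lambda>s. \<phi> s - \<phi> t) \<longlongrightarrow> 0) (at t within {a..b})"
      by (rule Lim_null_comparison[rotated]) (use lip t in \<open>auto simp: eventually_at_filter\<close>)
    then show "(\<phi> \<longlongrightarrow> \<phi> t) (at t within {a..b})"
      by (rule LIM_zero_cancel)
  qed
qed

lemma energy_drop:
  assumes "0 < s" "s \<le> t"
  shows "(t - s) * (norm (V t))\<^sup>2 \<le> \<phi> s - \<phi> t"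
proof -
  have "\<phi> t - \<phi> s \<le> (- (norm (V t))\<^sup>2) * (t - s)"
  proof (rule right_deriv_upper_bound[OF assms(2) energy_continuous[OF assms(1)]])
    fix \<tau> assume "s < \<tau>" "\<tau> < t"
    then show "\<exists>D\<le>- (norm (V t))\<^sup>2. has_right_deriv \<phi> D \<tau>"
      using energy_right_deriv[of \<tau>] speed_decreasing[of \<tau> t] assms
      by (intro exI[of _ "- (norm (V \<tau>))\<^sup>2"]) auto
  qed
  then show ?thesis by (simp add: algebra_simps)
qed

text \<open>Otherwise the energy would exceed its initial value by some \<open>c > 0\<close> on all of \<open>(0, t]\<close>, and the
  subgradient inequality tested with the initial point would make \<open>|U - U 0|\<^sup>2\<close> decrease from \<open>0\<close> at
  rate \<open>2 c\<close>.\<close>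

lemma energy_le_initial:
  assumes t: "t > 0"
  shows "\<phi> t \<le> \<phi> 0"
proof (rule ccontr)
  assume "\<not> ?thesis"
  then have c: "\<phi> t - \<phi> 0 > 0" by simp
  define f where "f s = (norm (U s - U 0))\<^sup>2" for s
  have "f t - f 0 \<le> (- 2 * (\<phi> t - \<phi> 0)) * (t - 0)"
  proof (rule right_deriv_upper_bound)
    show "continuous_on {0..t} f"
      unfolding f_def by (intro continuous_intros continuous_on_subset[OF continuous_U]) auto
    fix \<tau> assume \<tau>: "0 < \<tau>" "\<tau> < t"
    have "has_right_deriv f (2 * inner (V \<tau>) (U \<tau> - U 0)) \<tau>"
      using has_right_deriv_norm_sq[OF has_right_deriv_diff[OF right_deriv_U[OF \<tau>(1)] has_right_deriv_const[of "U 0"]]]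
      by (simp add: f_def[abs_def])
    moreover have "\<phi> t \<le> \<phi> \<tau>"
    proof -
      have "0 \<le> (t - \<tau>) * (norm (V t))\<^sup>2"
        using \<tau> by simp
      also have "\<dots> \<le> \<phi> \<tau> - \<phi> t"
        using \<tau> by (intro energy_drop) auto
      finally show ?thesis by simp
    qed
    moreover have "inner (V \<tau>) (U \<tau> - U 0) \<le> \<phi> 0 - \<phi> \<tau>"
      using subgradient[of \<tau> 0] \<tau> by (simp add: inner_diff_right)
    ultimately show "\<exists>D\<le>- 2 * (\<phi> t - \<phi> 0). has_right_deriv f D \<tau>"
      by (intro exI[of _ "2 * inner (V \<tau>) (U \<tau> - U 0)"]) auto
  qed (use t in auto)
  moreover have "2 * (\<phi> t - \<phi> 0) * t > 0" "f t \<ge> 0" "f 0 = 0"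
    using c t by (auto simp: f_def)
  ultimately show False by (simp add: algebra_simps)
qed

lemma energy_drop_initial:
  assumes "0 \<le> s" "s \<le> t" "0 < t"
  shows "(t - s) * (norm (V t))\<^sup>2 \<le> \<phi> s - \<phi> t"
proof (cases "s = 0")
  case True
  have "((\<lambda>s. (t - s) * (norm (V t))\<^sup>2) \<longlongrightarrow> (t - 0) * (norm (V t))\<^sup>2) (at_right 0)"
    by (intro tendsto_intros)
  moreover have "\<forall>\<^sub>F s in at_right 0. (t - s) * (norm (V t))\<^sup>2 \<le> \<phi> 0 - \<phi> t"
    using eventually_at_right_real[OF assms(3)]
  proof eventually_elim
    case (elim s)
    then show ?case using energy_drop[of s t] energy_le_initial[of s] by auto
  qed
  ultimately show ?thesis
    using True by (auto intro: tendsto_upperbound)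
qed (use energy_drop assms in auto)

end

section \<open>The inner product space of square-integrable functions\<close>

abbreviation "sq_int \<equiv> L2_space (UNIV :: 'a::euclidean_space set) :: ('a \<Rightarrow> real) set"

lemma L2_spaceI:
  assumes "f \<in> borel_measurable (lebesgue_on S)" "integrable (lebesgue_on S) (\<lambda>x. (norm (f x))\<^sup>2)"
  shows "f \<in> L2_space S"
  using assms by (simp add: L2_space_def)

lemma L2_space_measurable: "f \<in> L2_space S \<Longrightarrow> f \<in> borel_measurable (lebesgue_on S)"
  by (simp add: L2_space_def)

lemma L2_space_integrable_sq:
  fixes f :: "'a::euclidean_space \<Rightarrow> real"
  shows "f \<in> L2_space S \<Longrightarrow> integrable (lebesgue_on S) (\<lambda>x. (f x)\<^sup>2)"
  by (simp add: L2_space_def)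

lemma L2_space_integrable_mult:
  fixes f g :: "'a::euclidean_space \<Rightarrow> real"
  assumes "f \<in> L2_space S" "g \<in> L2_space S"
  shows "integrable (lebesgue_on S) (\<lambda>x. f x * g x)"
proof (rule Bochner_Integration.integrable_bound)
  show "integrable (lebesgue_on S) (\<lambda>x. (f x)\<^sup>2 + (g x)\<^sup>2)"
    using assms by (intro Bochner_Integration.integrable_add L2_space_integrable_sq)
  show "(\<lambda>x. f x * g x) \<in> borel_measurable (lebesgue_on S)"
    using assms by (intro borel_measurable_times L2_space_measurable)
  have "\<bar>a * b\<bar> \<le> a\<^sup>2 + b\<^sup>2" for a b :: real
  proof -
    have "2 * \<bar>a * b\<bar> \<le> a\<^sup>2 + b\<^sup>2"
      using sum_squares_bound[of "\<bar>a\<bar>" "\<bar>b\<bar>"] by (simp add: abs_mult)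
    then show ?thesis
      using abs_ge_zero[of "a * b"] by linarith
  qed
  then show "AE x in lebesgue_on S. norm (f x * g x) \<le> norm ((f x)\<^sup>2 + (g x)\<^sup>2)"
    by simp
qed

lemma L2_space_add:
  fixes f g :: "'a::euclidean_space \<Rightarrow> real"
  assumes "f \<in> L2_space S" "g \<in> L2_space S"
  shows "(\<lambda>x. f x + g x) \<in> L2_space S"
proof (rule L2_spaceI)
  show "(\<lambda>x. f x + g x) \<in> borel_measurable (lebesgue_on S)"
    using assms by (intro borel_measurable_add L2_space_measurable)
  have "integrable (lebesgue_on S) (\<lambda>x. (f x)\<^sup>2 + 2 * (f x * g x) + (g x)\<^sup>2)"
    using assms by (intro Bochner_Integration.integrable_add integrable_mult_right L2_space_integrable_sq L2_space_integrable_mult)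
  then show "integrable (lebesgue_on S) (\<lambda>x. (norm (f x + g x))\<^sup>2)"
    by (simp add: power2_sum algebra_simps)
qed

lemma L2_space_scale:
  fixes f :: "'a::euclidean_space \<Rightarrow> real"
  assumes "f \<in> L2_space S"
  shows "(\<lambda>x. c * f x) \<in> L2_space S"
proof (rule L2_spaceI)
  show "(\<lambda>x. c * f x) \<in> borel_measurable (lebesgue_on S)"
    using assms by (intro borel_measurable_times borel_measurable_const L2_space_measurable)
  show "integrable (lebesgue_on S) (\<lambda>x. (norm (c * f x))\<^sup>2)"
    using integrable_mult_right[OF L2_space_integrable_sq[OF assms], of "c\<^sup>2"] by (simp add: power_mult_distrib)
qed

lemma L2_space_zero: "(\<lambda>x. 0::real) \<in> L2_space S"
  by (rule L2_spaceI) auto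

lemma L2_space_diff:
  fixes f g :: "'a::euclidean_space \<Rightarrow> real"
  assumes "f \<in> L2_space S" "g \<in> L2_space S"
  shows "(\<lambda>x. f x - g x) \<in> L2_space S"
  using L2_space_add[OF assms(1) L2_space_scale[OF assms(2), of "-1"]] by simp

lemma L2_space_uminus:
  fixes f :: "'a::euclidean_space \<Rightarrow> real"
  shows "f \<in> L2_space S \<Longrightarrow> (\<lambda>x. - f x) \<in> L2_space S"
  using L2_space_scale[of f S "-1"] by simp

text \<open>Square-integrable functions on the whole space up to equality almost everywhere, as a real inner
  product space. The type does not mention a domain: functions on a set enter through extension by
  zero, so that one type serves for squares of every size.\<close>

quotient_type (overloaded) 'a l2 = "'a::euclidean_space \<Rightarrow> real" / partial:
  "\<lambda>f g. f \<in> sq_int \<and> g \<in> sq_int \<and> (AE x in lebesgue. f x = g x)"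
proof (rule part_equivpI)
  show "\<exists>f::'a \<Rightarrow> real. f \<in> sq_int \<and> f \<in> sq_int \<and> (AE x in lebesgue. f x = f x)"
    by (intro exI[of _ "\<lambda>x. 0"]) (simp add: L2_space_zero)
  show "symp (\<lambda>f g :: 'a \<Rightarrow> real. f \<in> sq_int \<and> g \<in> sq_int \<and> (AE x in lebesgue. f x = g x))"
  proof (rule sympI, elim conjE, intro conjI)
    fix f g :: "'a \<Rightarrow> real"
    assume "AE x in lebesgue. f x = g x"
    then show "AE x in lebesgue. g x = f x"
      by eventually_elim simp
  qed
  show "transp (\<lambda>f g :: 'a \<Rightarrow> real. f \<in> sq_int \<and> g \<in> sq_int \<and> (AE x in lebesgue. f x = g x))"
  proof (rule transpI, elim conjE, intro conjI)
    fix f g h :: "'a \<Rightarrow> real"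
    assume "AE x in lebesgue. f x = g x" "AE x in lebesgue. g x = h x"
    then show "AE x in lebesgue. f x = h x"
      by eventually_elim simp
  qed
qed

instantiation l2 :: (euclidean_space) real_vector
begin

lift_definition zero_l2 :: "'a l2" is "\<lambda>x. 0"
  by (simp add: L2_space_zero)

lift_definition plus_l2 :: "'a l2 \<Rightarrow> 'a l2 \<Rightarrow> 'a l2" is "\<lambda>f g x. f x + g x"
proof -
  fix f f' g g' :: "'a \<Rightarrow> real"
  assume *: "f \<in> sq_int \<and> f' \<in> sq_int \<and> (AE x in lebesgue. f x = f' x)"
    "g \<in> sq_int \<and> g' \<in> sq_int \<and> (AE x in lebesgue. g x = g' x)"
  then have "AE x in lebesgue. f x = f' x" "AE x in lebesgue. g x = g' x"
    by simp_all
  then have "AE x in lebesgue. f x + g x = f' x + g' x"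
    by eventually_elim simp
  with * show "(\<lambda>x. f x + g x) \<in> sq_int \<and> (\<lambda>x. f' x + g' x) \<in> sq_int \<and> (AE x in lebesgue. f x + g x = f' x + g' x)"
    by (simp add: L2_space_add)
qed

lift_definition uminus_l2 :: "'a l2 \<Rightarrow> 'a l2" is "\<lambda>f x. - f x"
  by (simp add: L2_space_uminus)

lift_definition minus_l2 :: "'a l2 \<Rightarrow> 'a l2 \<Rightarrow> 'a l2" is "\<lambda>f g x. f x - g x"
proof -
  fix f f' g g' :: "'a \<Rightarrow> real"
  assume *: "f \<in> sq_int \<and> f' \<in> sq_int \<and> (AE x in lebesgue. f x = f' x)"
    "g \<in> sq_int \<and> g' \<in> sq_int \<and> (AE x in lebesgue. g x = g' x)"
  then have "AE x in lebesgue. f x = f' x" "AE x in lebesgue. g x = g' x"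
    by simp_all
  then have "AE x in lebesgue. f x - g x = f' x - g' x"
    by eventually_elim simp
  with * show "(\<lambda>x. f x - g x) \<in> sq_int \<and> (\<lambda>x. f' x - g' x) \<in> sq_int \<and> (AE x in lebesgue. f x - g x = f' x - g' x)"
    by (simp add: L2_space_diff)
qed

lift_definition scaleR_l2 :: "real \<Rightarrow> 'a l2 \<Rightarrow> 'a l2" is "\<lambda>c f x. c * f x"
  by (auto simp: L2_space_scale)

instance
proof
  fix x y z :: "'a l2" and a b :: real
  show "x + y + z = x + (y + z)" "x + y = y + x"
    by (transfer; simp add: L2_space_add algebra_simps; fail)+
  show "0 + x = x" "- x + x = 0" "x - y = x + - y"
    by (transfer; simp add: L2_space_diff L2_space_zero; fail)+
  show "a *\<^sub>R (x + y) = a *\<^sub>R x + a *\<^sub>R y" "(a + b) *\<^sub>R x = a *\<^sub>R x + b *\<^sub>R x"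
    by (transfer; simp add: L2_space_add L2_space_scale distrib_left distrib_right; fail)+
  show "a *\<^sub>R b *\<^sub>R x = (a * b) *\<^sub>R x" "1 *\<^sub>R x = x"
    by (transfer; simp add: L2_space_scale mult.assoc; fail)+
qed

end

instantiation l2 :: (euclidean_space) real_inner
begin

lift_definition inner_l2 :: "'a l2 \<Rightarrow> 'a l2 \<Rightarrow> real" is "\<lambda>f g. LINT x|lebesgue. f x * g x"
proof -
  fix f f' g g' :: "'a \<Rightarrow> real"
  assume *: "f \<in> sq_int \<and> f' \<in> sq_int \<and> (AE x in lebesgue. f x = f' x)"
    "g \<in> sq_int \<and> g' \<in> sq_int \<and> (AE x in lebesgue. g x = g' x)"
  from * have m: "f \<in> borel_measurable lebesgue" "f' \<in> borel_measurable lebesgue"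
    "g \<in> borel_measurable lebesgue" "g' \<in> borel_measurable lebesgue"
    by (auto simp: L2_space_def lebesgue_on_UNIV_eq)
  show "(LINT x|lebesgue. f x * g x) = (LINT x|lebesgue. f' x * g' x)"
  proof (rule integral_cong_AE)
    from * have "AE x in lebesgue. f x = f' x" "AE x in lebesgue. g x = g' x"
      by simp_all
    then show "AE x in lebesgue. f x * g x = f' x * g' x"
      by eventually_elim simp
  qed (use m in simp_all)
qed

definition norm_l2 :: "'a l2 \<Rightarrow> real" where "norm_l2 x = sqrt (inner x x)"
definition dist_l2 :: "'a l2 \<Rightarrow> 'a l2 \<Rightarrow> real" where "dist_l2 x y = norm (x - y)"
definition sgn_l2 :: "'a l2 \<Rightarrow> 'a l2" where "sgn_l2 x = x /\<^sub>R norm x"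
definition uniformity_l2 :: "('a l2 \<times> 'a l2) filter" where
  "uniformity_l2 = (INF e\<in>{0<..}. principal {(x, y). dist x y < e})"
definition open_l2 :: "'a l2 set \<Rightarrow> bool" where
  "open_l2 S \<longleftrightarrow> (\<forall>x\<in>S. \<forall>\<^sub>F (x', y) in uniformity. x' = x \<longrightarrow> y \<in> S)"

instance
proof
  fix x y z :: "'a l2" and a b :: real
  show "dist x y = norm (x - y)" "sgn x = x /\<^sub>R norm x" "norm x = sqrt (inner x x)"
    by (simp_all add: dist_l2_def sgn_l2_def norm_l2_def)
  show "uniformity = (INF e\<in>{0<..}. principal {(x :: 'a l2, y). dist x y < e})"
    by (rule uniformity_l2_def)
  show "open S \<longleftrightarrow> (\<forall>x\<in>S. \<forall>\<^sub>F (x', y) in uniformity. x' = x \<longrightarrow> y \<in> S)" for S :: "'a l2 set"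
    by (rule open_l2_def)
  show "inner x y = inner y x"
    by transfer (simp add: mult.commute)
  show "inner (x + y) z = inner x z + inner y z"
  proof transfer
    fix f g h :: "'a \<Rightarrow> real"
    assume "f \<in> sq_int \<and> f \<in> sq_int \<and> (AE x in lebesgue. f x = f x)"
      "g \<in> sq_int \<and> g \<in> sq_int \<and> (AE x in lebesgue. g x = g x)"
      "h \<in> sq_int \<and> h \<in> sq_int \<and> (AE x in lebesgue. h x = h x)"
    then have "integrable lebesgue (\<lambda>x. f x * h x)" "integrable lebesgue (\<lambda>x. g x * h x)"
      using L2_space_integrable_mult[of f UNIV h] L2_space_integrable_mult[of g UNIV h]
      by (simp_all add: lebesgue_on_UNIV_eq)
    then show "(LINT x|lebesgue. (f x + g x) * h x) = (LINT x|lebesgue. f x * h x) + (LINT x|lebesgue. g x * h x)"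
      by (simp add: distrib_right)
  qed
  show "inner (a *\<^sub>R x) y = a * inner x y"
    by transfer (simp add: algebra_simps)
  show "0 \<le> inner x x"
    by transfer simp
  show "inner x x = 0 \<longleftrightarrow> x = 0"
  proof transfer
    fix f :: "'a \<Rightarrow> real"
    assume f: "f \<in> sq_int \<and> f \<in> sq_int \<and> (AE x in lebesgue. f x = f x)"
    then have "integrable lebesgue (\<lambda>x. f x * f x)"
      using L2_space_integrable_mult[of f UNIV f] by (simp add: lebesgue_on_UNIV_eq)
    from integral_nonneg_eq_0_iff_AE[OF this]
    show "(LINT x|lebesgue. f x * f x) = 0 \<longleftrightarrow> (f \<in> sq_int \<and> (\<lambda>x. 0) \<in> sq_int \<and> (AE x in lebesgue. f x = 0))"
      using f by (simp add: L2_space_zero)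
  qed
qed

end

text \<open>The isometric embedding of the square-integrable functions on \<open>S\<close>.\<close>

definition emb :: "'a::euclidean_space set \<Rightarrow> ('a \<Rightarrow> real) \<Rightarrow> 'a l2" where
  "emb S f = abs_l2 (\<lambda>x. indicator S x * f x)"

context
  fixes S :: "'a::euclidean_space set"
  assumes S: "S \<in> sets lebesgue"
begin

lemma cut_sq_int_iff:
  "(\<lambda>x. indicator S x * f x) \<in> sq_int \<longleftrightarrow> f \<in> L2_space S"
proof -
  have "f \<in> borel_measurable (lebesgue_on S) \<longleftrightarrow> (\<lambda>x. indicator S x * f x) \<in> borel_measurable lebesgue"
    using borel_measurable_restrict_space_iff[of S lebesgue f] S by simp
  moreover have "integrable (lebesgue_on S) (\<lambda>x. (f x)\<^sup>2) \<longleftrightarrow> integrable lebesgue (\<lambda>x. (indicator S x * f x)\<^sup>2)"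
  proof -
    have "(\<lambda>x. (indicator S x * f x)\<^sup>2) = (\<lambda>x. indicator S x *\<^sub>R (f x)\<^sup>2)"
      by (auto simp: indicator_def)
    then show ?thesis
      using integrable_restrict_space[of S lebesgue "\<lambda>x. (f x)\<^sup>2"] S by simp
  qed
  ultimately show ?thesis
    by (simp add: L2_space_def lebesgue_on_UNIV_eq)
qed

lemma inner_emb:
  assumes "f \<in> L2_space S" "g \<in> L2_space S"
  shows "inner (emb S f) (emb S g) = (LINT x|lebesgue_on S. f x * g x)"
proof -
  have "inner (emb S f) (emb S g) = (LINT x|lebesgue. indicator S x * f x * (indicator S x * g x))"
    using assms unfolding emb_def by (subst inner_l2.abs_eq) (auto simp: cut_sq_int_iff)
  also have "\<dots> = (LINT x|lebesgue. indicator S x *\<^sub>R (f x * g x))"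
    by (intro Bochner_Integration.integral_cong) (auto simp: indicator_def)
  also have "\<dots> = (LINT x|lebesgue_on S. f x * g x)"
    using S by (subst integral_restrict_space) auto
  finally show ?thesis .
qed

lemma norm_emb: "f \<in> L2_space S \<Longrightarrow> norm (emb S f) = L2_norm S f"
  by (simp add: norm_eq_sqrt_inner inner_emb L2_norm_def power2_eq_square)

lemma emb_eqI:
  assumes "f \<in> L2_space S" "g \<in> L2_space S" "AE x in lebesgue_on S. f x = g x"
  shows "emb S f = emb S g"
  unfolding emb_def
proof (rule Quotient_rel_abs[OF Quotient_l2], intro conjI)
  show "AE x in lebesgue. indicator S x * f x = indicator S x * g x"
  proof -
    have "AE x in lebesgue. x \<in> S \<longrightarrow> f x = g x"
      using assms(3) S by (simp add: AE_restrict_space_iff)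
    then show ?thesis
      by eventually_elim (simp add: indicator_def)
  qed
qed (use assms in \<open>simp_all add: cut_sq_int_iff\<close>)

lemma emb_add:
  assumes "f \<in> L2_space S" "g \<in> L2_space S"
  shows "emb S (\<lambda>x. f x + g x) = emb S f + emb S g"
  using assms unfolding emb_def by (subst plus_l2.abs_eq) (simp_all add: cut_sq_int_iff distrib_left)

lemma emb_diff:
  assumes "f \<in> L2_space S" "g \<in> L2_space S"
  shows "emb S (\<lambda>x. f x - g x) = emb S f - emb S g"
  using assms unfolding emb_def by (subst minus_l2.abs_eq) (simp_all add: cut_sq_int_iff right_diff_distrib)

lemma emb_scale:
  assumes "f \<in> L2_space S"
  shows "emb S (\<lambda>x. c * f x) = c *\<^sub>R emb S f"
  using assms unfolding emb_def by (subst scaleR_l2.abs_eq) (simp_all add: cut_sq_int_iff mult.left_commute)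

end

section \<open>Completeness and the Riesz representation\<close>

lemma sq_integrable_finite_integral:
  fixes f :: "'a::euclidean_space \<Rightarrow> real"
  assumes "f \<in> borel_measurable (lebesgue_on S)" "(\<integral>\<^sup>+x. ennreal ((f x)\<^sup>2) \<partial>lebesgue_on S) \<le> ennreal (c\<^sup>2)" "c \<ge> 0"
  shows "f \<in> L2_space S" "L2_norm S f \<le> c"
proof -
  have int: "integrable (lebesgue_on S) (\<lambda>x. (f x)\<^sup>2)"
    using assms by (intro integrableI_bounded) (auto simp: top_unique less_top intro: le_less_trans)
  then show "f \<in> L2_space S"
    using assms(1) by (simp add: L2_space_def)
  have "ennreal (LINT x|lebesgue_on S. (f x)\<^sup>2) \<le> ennreal (c\<^sup>2)"
    using assms(2) nn_integral_eq_integral[OF int] by simp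
  then show "L2_norm S f \<le> c"
    using assms(3) by (simp add: L2_norm_def real_le_lsqrt)
qed

lemma nn_integral_sq_eq_L2_norm:
  fixes f :: "'a::euclidean_space \<Rightarrow> real"
  assumes "f \<in> L2_space S"
  shows "(\<integral>\<^sup>+x. ennreal ((f x)\<^sup>2) \<partial>lebesgue_on S) = ennreal ((L2_norm S f)\<^sup>2)"
  using nn_integral_eq_integral[OF L2_space_integrable_sq[OF assms]] by (simp add: L2_norm_def)

text \<open>Fatou's lemma for squares.\<close>

lemma nn_integral_sq_limit_le:
  fixes f :: "nat \<Rightarrow> 'a \<Rightarrow> real"
  assumes m: "\<And>n. f n \<in> borel_measurable M"
    and lim: "AE x in M. (\<lambda>n. f n x) \<longlonglongrightarrow> g x"
    and le: "\<forall>\<^sub>F n in sequentially. (\<integral>\<^sup>+x. ennreal ((f n x)\<^sup>2) \<partial>M) \<le> C"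
  shows "(\<integral>\<^sup>+x. ennreal ((g x)\<^sup>2) \<partial>M) \<le> C"
proof -
  have "(\<integral>\<^sup>+x. ennreal ((g x)\<^sup>2) \<partial>M) = (\<integral>\<^sup>+x. liminf (\<lambda>n. ennreal ((f n x)\<^sup>2)) \<partial>M)"
  proof (rule nn_integral_cong_AE)
    show "AE x in M. ennreal ((g x)\<^sup>2) = liminf (\<lambda>n. ennreal ((f n x)\<^sup>2))"
      using lim
    proof eventually_elim
      case (elim x)
      then have "(\<lambda>n. ennreal ((f n x)\<^sup>2)) \<longlonglongrightarrow> ennreal ((g x)\<^sup>2)"
        by (intro tendsto_intros)
      from lim_imp_Liminf[OF sequentially_bot this] show ?case
        by (rule sym)
    qed
  qed
  also have "\<dots> \<le> liminf (\<lambda>n. \<integral>\<^sup>+x. ennreal ((f n x)\<^sup>2) \<partial>M)"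
    using m by (intro nn_integral_liminf) simp
  also have "\<dots> \<le> C"
    using Liminf_le_Limsup[of sequentially] Limsup_bounded[OF le] order_trans by fastforce
  finally show ?thesis .
qed

lemma L2_norm_nonneg [simp]: "0 \<le> L2_norm S f"
  by (simp add: L2_norm_def)

lemma finite_measure_lebesgue_on_lmeasurable:
  "S \<in> lmeasurable \<Longrightarrow> finite_measure (lebesgue_on S)"
  by (rule finite_measureI) (auto simp: fmeasurable_def emeasure_restrict_space)

lemma L2_space_const:
  assumes "S \<in> lmeasurable"
  shows "(\<lambda>x. c :: real) \<in> L2_space S"
proof -
  interpret finite_measure "lebesgue_on S"
    by (rule finite_measure_lebesgue_on_lmeasurable[OF assms])
  show ?thesis
    by (rule L2_spaceI) auto
qed

lemma L2_space_abs: "f \<in> L2_space S \<Longrightarrow> (\<lambda>x. \<bar>f x\<bar> :: real) \<in> L2_space S"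
  by (auto simp: L2_space_def)

lemma L2_norm_abs: "L2_norm S (\<lambda>x. \<bar>f x\<bar> :: real) = L2_norm S f"
  by (simp add: L2_norm_def)

lemma L1_le_L2:
  assumes S: "S \<in> lmeasurable" and f: "f \<in> L2_space S"
  shows "integrable (lebesgue_on S) f"
    and "(LINT x|lebesgue_on S. \<bar>f x :: real\<bar>) \<le> sqrt (measure lebesgue S) * L2_norm S f"
proof -
  note S' = fmeasurableD[OF S]
  show "integrable (lebesgue_on S) f"
    using L2_space_integrable_mult[OF f L2_space_const[OF S, of 1]] by simp
  have "(LINT x|lebesgue_on S. \<bar>f x\<bar>) = inner (emb S (\<lambda>x. 1)) (emb S (\<lambda>x. \<bar>f x\<bar>))"
    using inner_emb[OF S' L2_space_const[OF S, of 1] L2_space_abs[OF f]] by simp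
  also have "\<dots> \<le> norm (emb S (\<lambda>x. 1)) * norm (emb S (\<lambda>x. \<bar>f x\<bar>))"
    by (rule norm_cauchy_schwarz)
  also have "norm (emb S (\<lambda>x. 1)) = sqrt (measure lebesgue S)"
    using norm_emb[OF S' L2_space_const[OF S, of 1]] S'
    by (simp add: L2_norm_def measure_restrict_space)
  finally show "(LINT x|lebesgue_on S. \<bar>f x :: real\<bar>) \<le> sqrt (measure lebesgue S) * L2_norm S f"
    by (simp add: norm_emb[OF S' L2_space_abs[OF f]] L2_norm_abs)
qed

lemma L2_norm_diff_emb:
  assumes "S \<in> sets lebesgue" "f \<in> L2_space S" "g \<in> L2_space S"
  shows "L2_norm S (\<lambda>x. f x - g x) = dist (emb S f) (emb S g)"
  using assms by (simp add: dist_norm flip: emb_diff norm_emb[OF _ L2_space_diff])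

text \<open>On a set of finite measure a Cauchy sequence in \<open>L\<^sup>2\<close> is Cauchy in \<open>L\<^sup>1\<close>, so a subsequence converges
  almost everywhere; by Fatou's lemma its pointwise limit is the limit in \<open>L\<^sup>2\<close> of the whole sequence.\<close>

lemma L2_complete:
  assumes S: "S \<in> lmeasurable" and f: "\<And>n. f n \<in> L2_space S"
    and Cauchy: "Cauchy (\<lambda>n. emb S (f n))"
  shows "\<exists>g\<in>L2_space S. (\<lambda>n. emb S (f n)) \<longlonglongrightarrow> emb S g"
proof -
  note S' = fmeasurableD[OF S]
  note dist_emb = L2_norm_diff_emb[OF S' f f, symmetric]
  have [measurable]: "f n \<in> borel_measurable (lebesgue_on S)" for n
    using f by (rule L2_space_measurable)
  have "\<exists>N. \<forall>i\<ge>N. \<forall>j\<ge>N. (LINT x|lebesgue_on S. norm (f i x - f j x)) < e" if e: "e > 0" for e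
  proof -
    define d where "d = e / (sqrt (measure lebesgue S) + 1)"
    have d: "d > 0" "sqrt (measure lebesgue S) * d < e"
    proof -
      have pos: "sqrt (measure lebesgue S) + 1 > 0" by (simp add: add_nonneg_pos)
      with e show "d > 0" by (simp add: d_def)
      have "sqrt (measure lebesgue S) * d < (sqrt (measure lebesgue S) + 1) * d"
        using \<open>d > 0\<close> by (simp add: algebra_simps)
      also have "\<dots> = e" using pos by (simp add: d_def)
      finally show "sqrt (measure lebesgue S) * d < e" .
    qed
    obtain N where N: "\<And>i j. i \<ge> N \<Longrightarrow> j \<ge> N \<Longrightarrow> dist (emb S (f i)) (emb S (f j)) < d"
      using metric_CauchyD[OF Cauchy d(1)] by blast
    have "(LINT x|lebesgue_on S. norm (f i x - f j x)) < e" if "i \<ge> N" "j \<ge> N" for i j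
    proof -
      have "(LINT x|lebesgue_on S. norm (f i x - f j x)) \<le> sqrt (measure lebesgue S) * dist (emb S (f i)) (emb S (f j))"
        using L1_le_L2(2)[OF S L2_space_diff[OF f f]] by (simp add: dist_emb)
      also have "\<dots> \<le> sqrt (measure lebesgue S) * d"
        using N[OF that] by (intro mult_left_mono) auto
      finally show ?thesis using d by simp
    qed
    then show ?thesis by blast
  qed
  then obtain r where r: "strict_mono r" "AE x in lebesgue_on S. Cauchy (\<lambda>i. f (r i) x)"
    using cauchy_L1_AE_cauchy_subseq[of "lebesgue_on S" f] L1_le_L2(1)[OF S f] by blast
  define g where "g x = lim (\<lambda>i. f (r i) x)" for x
  have lim: "AE x in lebesgue_on S. (\<lambda>i. f (r i) x) \<longlonglongrightarrow> g x"
    using r(2) by eventually_elim (simp add: g_def Cauchy_convergent_iff convergent_LIMSEQ_iff)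
  have [measurable]: "g \<in> borel_measurable (lebesgue_on S)"
    unfolding g_def by measurable
  have approx: "\<exists>N. \<forall>n\<ge>N. (\<lambda>x. g x - f n x) \<in> L2_space S \<and> L2_norm S (\<lambda>x. g x - f n x) \<le> e"
    if e: "e > 0" for e
  proof -
    obtain N where N: "\<And>i j. i \<ge> N \<Longrightarrow> j \<ge> N \<Longrightarrow> dist (emb S (f i)) (emb S (f j)) < e"
      using metric_CauchyD[OF Cauchy e] by blast
    have "(\<integral>\<^sup>+x. ennreal ((g x - f n x)\<^sup>2) \<partial>lebesgue_on S) \<le> ennreal (e\<^sup>2)" if n: "n \<ge> N" for n
    proof (rule nn_integral_sq_limit_le)
      show "(\<lambda>x. f (r i) x - f n x) \<in> borel_measurable (lebesgue_on S)" for i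
        by measurable
      show "AE x in lebesgue_on S. (\<lambda>i. f (r i) x - f n x) \<longlonglongrightarrow> g x - f n x"
        using lim by eventually_elim (intro tendsto_intros)
      show "\<forall>\<^sub>F i in sequentially. (\<integral>\<^sup>+x. ennreal ((f (r i) x - f n x)\<^sup>2) \<partial>lebesgue_on S) \<le> ennreal (e\<^sup>2)"
      proof (rule eventually_sequentiallyI)
        fix i assume "i \<ge> N"
        then have "r i \<ge> N"
          using seq_suble[OF r(1)] order_trans by blast
        from N[OF this n] show "(\<integral>\<^sup>+x. ennreal ((f (r i) x - f n x)\<^sup>2) \<partial>lebesgue_on S) \<le> ennreal (e\<^sup>2)"
          using nn_integral_sq_eq_L2_norm[OF L2_space_diff[OF f f, of "r i" n]]
          by (simp add: dist_emb power_mono)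
      qed
    qed
    then show ?thesis
      using e sq_integrable_finite_integral[of "\<lambda>x. g x - f _ x" S e] by (intro exI[of _ N]) auto
  qed
  obtain N1 where "(\<lambda>x. g x - f N1 x) \<in> L2_space S"
    using approx[of 1] by auto
  from L2_space_add[OF this f[of N1]] have g: "g \<in> L2_space S" by simp
  have "(\<lambda>n. emb S (f n)) \<longlonglongrightarrow> emb S g"
  proof (rule metric_LIMSEQ_I)
    fix e :: real assume "e > 0"
    then obtain N where "\<forall>n\<ge>N. L2_norm S (\<lambda>x. g x - f n x) \<le> e / 2"
      using approx[of "e / 2"] by auto
    then show "\<exists>N. \<forall>n\<ge>N. dist (emb S (f n)) (emb S g) < e"
      using \<open>e > 0\<close> L2_norm_diff_emb[OF S' g f]
      by (intro exI[of _ N]) (force simp: dist_commute)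
  qed
  with g show ?thesis by blast
qed

text \<open>Minimise \<open>|x|\<^sup>2 - 2 \<Lambda> x\<close> over \<open>W\<close>: by the parallelogram identity a minimising sequence is Cauchy, and
  at its limit the first variation vanishes. The limits of Cauchy sequences in \<open>W\<close> are only required
  to lie in some set \<open>H\<close>, because the ambient space need not be complete.\<close>

lemma riesz_subspace:
  fixes W :: "'a::real_inner set" and \<Lambda> :: "'a \<Rightarrow> real"
  assumes sub: "subspace W"
    and add: "\<And>x y. x \<in> W \<Longrightarrow> y \<in> W \<Longrightarrow> \<Lambda> (x + y) = \<Lambda> x + \<Lambda> y"
    and scale: "\<And>c x. x \<in> W \<Longrightarrow> \<Lambda> (c *\<^sub>R x) = c * \<Lambda> x"
    and bound: "\<And>x. x \<in> W \<Longrightarrow> \<bar>\<Lambda> x\<bar> \<le> C * norm x" and C: "C \<ge> 0"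
    and complete: "\<And>X. (\<And>n. X n \<in> W) \<Longrightarrow> Cauchy X \<Longrightarrow> \<exists>g\<in>H. X \<longlonglongrightarrow> g"
  shows "\<exists>g\<in>H. norm g \<le> C \<and> (\<forall>x\<in>W. inner g x = \<Lambda> x)"
proof -
  define J where "J x = (norm x)\<^sup>2 - 2 * \<Lambda> x" for x
  have low: "- C\<^sup>2 \<le> J x" if "x \<in> W" for x
  proof -
    have "0 \<le> (norm x - C)\<^sup>2" by simp
    then show ?thesis
      using bound[OF that] by (simp add: J_def power2_diff abs_le_iff algebra_simps)
  qed
  define m where "m = Inf (J ` W)"
  have bdd: "bdd_below (J ` W)"
    using low by (intro bdd_belowI[of _ "- C\<^sup>2"]) auto
  have m_le: "m \<le> J x" if "x \<in> W" for x
    unfolding m_def using that bdd by (intro cInf_lower) auto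
  have "\<exists>x\<in>W. J x < m + inverse (real (Suc n))" for n
  proof -
    have "J ` W \<noteq> {}" using subspace_0[OF sub] by auto
    from cInf_lessD[OF this, of "m + inverse (real (Suc n))"] show ?thesis
      by (auto simp: m_def)
  qed
  then obtain X where X: "\<And>n. X n \<in> W" "\<And>n. J (X n) < m + inverse (real (Suc n))"
    by metis
  have dist_X: "(dist x y)\<^sup>2 \<le> 2 * (J x - m) + 2 * (J y - m)" if "x \<in> W" "y \<in> W" for x y
  proof -
    have mid: "(1/2) *\<^sub>R (x + y) \<in> W"
      using that sub by (intro subspace_scale subspace_add)
    have nsum: "(norm (x + y))\<^sup>2 = inner x x + 2 * inner x y + inner y y"
      by (simp add: power2_norm_eq_inner inner_add_left inner_add_right inner_commute)
    have "J ((1/2) *\<^sub>R (x + y)) = (norm (x + y))\<^sup>2 / 4 - (\<Lambda> x + \<Lambda> y)"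
      using that by (simp add: J_def add scale[OF subspace_add[OF sub that]] power_divide add_divide_distrib)
    have "(dist x y)\<^sup>2 = inner x x - 2 * inner x y + inner y y"
      by (simp add: dist_norm power2_norm_eq_inner inner_diff_left inner_diff_right inner_commute)
    have "(dist x y)\<^sup>2 = 2 * J x + 2 * J y - 4 * J ((1/2) *\<^sub>R (x + y))"
    proof -
      have alg: "d = 2 * (a - 2 * l) + 2 * (b - 2 * k) - 4 * j"
        if "j = n / 4 - (l + k)" "d = a - 2 * c + b" "n = a + 2 * c + b" for a b c d j k l n :: real
        using that by (simp add: field_simps)
      show ?thesis
        unfolding J_def[of x] J_def[of y] power2_norm_eq_inner[of x] power2_norm_eq_inner[of y]
        by (rule alg) fact+
    qed
    with m_le[OF mid] show ?thesis by simp
  qed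
  have invSuc: "(\<lambda>n. inverse (real (Suc n))) \<longlonglongrightarrow> 0"
    by (rule LIMSEQ_inverse_real_of_nat)
  have "Cauchy X"
  proof (rule metric_CauchyI)
    fix e :: real assume e: "e > 0"
    have "\<forall>\<^sub>F n in sequentially. inverse (real (Suc n)) < e\<^sup>2 / 4"
      using e by (intro order_tendstoD[OF invSuc]) simp
    then obtain N where N: "\<And>n. n \<ge> N \<Longrightarrow> inverse (real (Suc n)) < e\<^sup>2 / 4"
      by (auto simp: eventually_sequentially)
    have "dist (X i) (X j) < e" if "i \<ge> N" "j \<ge> N" for i j
    proof -
      have alg: "d < q" if "d \<le> 2 * (a - m) + 2 * (b - m)" "a < m + k" "b < m + l" "k < q / 4" "l < q / 4"
        for a b d k l q :: real
        using that by argo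
      have "(dist (X i) (X j))\<^sup>2 < e\<^sup>2"
        using alg[OF dist_X[OF X(1) X(1), of i j] X(2)[of i] X(2)[of j] N[OF that(1)] N[OF that(2)]] .
      then show ?thesis
        using e by (simp add: power2_less_imp_less)
    qed
    then show "\<exists>N. \<forall>i\<ge>N. \<forall>j\<ge>N. dist (X i) (X j) < e" by blast
  qed
  from complete[OF X(1) this] obtain g where g: "g \<in> H" "X \<longlonglongrightarrow> g" by blast
  have eq: "inner g w = \<Lambda> w" if w: "w \<in> W" for w
  proof -
    define a q where "a = inner g w - \<Lambda> w" and "q = (norm w)\<^sup>2"
    have nonneg: "0 \<le> 2 * t * a + t\<^sup>2 * q" for t
    proof (rule tendsto_le)
      show "(\<lambda>n. inverse (real (Suc n)) + (2 * t * (inner (X n) w - \<Lambda> w) + t\<^sup>2 * q)) \<longlonglongrightarrow> 2 * t * a + t\<^sup>2 * q"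
        using tendsto_add[OF invSuc, of "\<lambda>n. 2 * t * (inner (X n) w - \<Lambda> w) + t\<^sup>2 * q" "2 * t * a + t\<^sup>2 * q"]
        unfolding a_def by (simp add: tendsto_intros g(2))
      show "\<forall>\<^sub>F n in sequentially. 0 \<le> inverse (real (Suc n)) + (2 * t * (inner (X n) w - \<Lambda> w) + t\<^sup>2 * q)"
      proof (rule always_eventually, rule allI)
        fix n
        have tw: "t *\<^sub>R w \<in> W"
          using w sub by (intro subspace_scale)
        have "m \<le> J (X n + t *\<^sub>R w)"
          using X(1) tw sub by (intro m_le subspace_add)
        also have "\<dots> = J (X n) + (2 * t * (inner (X n) w - \<Lambda> w) + t\<^sup>2 * q)"
          using X(1)[of n] w tw
        proof -
          have "(norm (X n + t *\<^sub>R w))\<^sup>2 = (norm (X n))\<^sup>2 + 2 * t * inner (X n) w + t\<^sup>2 * q"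
            unfolding q_def power2_norm_eq_inner
            by (simp add: inner_add_left inner_add_right inner_commute power2_eq_square)
          then show ?thesis
            using X(1)[of n] w tw by (simp add: J_def add scale algebra_simps)
        qed
        finally show "0 \<le> inverse (real (Suc n)) + (2 * t * (inner (X n) w - \<Lambda> w) + t\<^sup>2 * q)"
          using X(2)[of n] by simp
      qed
    qed auto
    have "a = 0"
    proof (rule ccontr)
      assume "a \<noteq> 0"
      have q: "q \<ge> 0" by (simp add: q_def)
      have "0 \<le> (2 * (- a / (q + 1)) * a + (- a / (q + 1))\<^sup>2 * q) * (q + 1)\<^sup>2"
        by (intro mult_nonneg_nonneg nonneg zero_le_power2)
      also have "\<dots> = - (a\<^sup>2 * (q + 2))"
        using q by (simp add: field_simps power2_eq_square add_nonneg_eq_0_iff)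
      also have "\<dots> < 0"
        using q \<open>a \<noteq> 0\<close> by simp
      finally show False by simp
    qed
    then show ?thesis by (simp add: a_def)
  qed
  have "(norm g)\<^sup>2 \<le> C * norm g"
  proof (rule tendsto_le)
    show "(\<lambda>n. inner g (X n)) \<longlonglongrightarrow> (norm g)\<^sup>2"
      unfolding power2_norm_eq_inner by (intro tendsto_intros g(2))
    show "(\<lambda>n. C * norm (X n)) \<longlonglongrightarrow> C * norm g"
      by (intro tendsto_intros g(2))
    show "\<forall>\<^sub>F n in sequentially. inner g (X n) \<le> C * norm (X n)"
      using eq X(1) bound by (auto intro!: always_eventually simp: abs_le_iff)
  qed simp
  then have "norm g \<le> C"
    using C by (cases "norm g = 0") (auto simp: power2_eq_square)
  with g(1) eq show ?thesis by blast
qed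

text \<open>The functional is given on functions; the bound makes it depend only on their classes.\<close>

lemma riesz_L2:
  fixes \<T> :: "('a::euclidean_space \<Rightarrow> real) set" and \<Lambda> :: "('a \<Rightarrow> real) \<Rightarrow> real"
  assumes S: "S \<in> lmeasurable" and sub: "\<T> \<subseteq> L2_space S"
    and zero_in: "(\<lambda>x. 0) \<in> \<T>"
    and add_in: "\<And>\<phi> \<psi>. \<phi> \<in> \<T> \<Longrightarrow> \<psi> \<in> \<T> \<Longrightarrow> (\<lambda>x. \<phi> x + \<psi> x) \<in> \<T>"
    and scale_in: "\<And>c \<phi>. \<phi> \<in> \<T> \<Longrightarrow> (\<lambda>x. c * \<phi> x) \<in> \<T>"
    and add: "\<And>\<phi> \<psi>. \<phi> \<in> \<T> \<Longrightarrow> \<psi> \<in> \<T> \<Longrightarrow> \<Lambda> (\<lambda>x. \<phi> x + \<psi> x) = \<Lambda> \<phi> + \<Lambda> \<psi>"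
    and scale: "\<And>c \<phi>. \<phi> \<in> \<T> \<Longrightarrow> \<Lambda> (\<lambda>x. c * \<phi> x) = c * \<Lambda> \<phi>"
    and bound: "\<And>\<phi>. \<phi> \<in> \<T> \<Longrightarrow> \<bar>\<Lambda> \<phi>\<bar> \<le> C * L2_norm S \<phi>" and C: "C \<ge> 0"
  shows "\<exists>g\<in>L2_space S. L2_norm S g \<le> C \<and> (\<forall>\<phi>\<in>\<T>. (LINT x|lebesgue_on S. g x * \<phi> x) = \<Lambda> \<phi>)"
proof -
  note S' = fmeasurableD[OF S]
  have L2: "\<phi> \<in> L2_space S" if "\<phi> \<in> \<T>" for \<phi> using that sub by auto
  define \<Lambda>' where "\<Lambda>' x = \<Lambda> (SOME \<phi>. \<phi> \<in> \<T> \<and> emb S \<phi> = x)" for x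
  have \<Lambda>': "\<Lambda>' (emb S \<phi>) = \<Lambda> \<phi>" if \<phi>: "\<phi> \<in> \<T>" for \<phi>
  proof -
    define \<psi> where "\<psi> = (SOME \<psi>. \<psi> \<in> \<T> \<and> emb S \<psi> = emb S \<phi>)"
    have \<psi>: "\<psi> \<in> \<T> \<and> emb S \<psi> = emb S \<phi>"
      unfolding \<psi>_def by (rule someI[of _ \<phi>]) (simp add: \<phi>)
    then have \<psi>1: "\<psi> \<in> \<T>" by simp
    have neg: "(\<lambda>x. (-1) * \<psi> x) \<in> \<T>"
      by (rule scale_in[OF \<psi>1])
    have "\<Lambda> (\<lambda>x. \<phi> x + (-1) * \<psi> x) = \<Lambda> \<phi> + \<Lambda> (\<lambda>x. (-1) * \<psi> x)"
      by (rule add[OF \<phi> neg])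
    moreover have "\<Lambda> (\<lambda>x. (-1) * \<psi> x) = - \<Lambda> \<psi>"
      using scale[OF \<psi>1, of "-1"] by simp
    moreover have "\<bar>\<Lambda> (\<lambda>x. \<phi> x + (-1) * \<psi> x)\<bar> \<le> C * L2_norm S (\<lambda>x. \<phi> x + (-1) * \<psi> x)"
      by (rule bound[OF add_in[OF \<phi> neg]])
    moreover have "L2_norm S (\<lambda>x. \<phi> x + (-1) * \<psi> x) = 0"
      using L2_norm_diff_emb[OF S' L2[OF \<phi>] L2[OF \<psi>1]] \<psi> by simp
    ultimately show ?thesis
      by (simp add: \<Lambda>'_def \<psi>_def)
  qed
  have "\<exists>g\<in>emb S ` L2_space S. norm g \<le> C \<and> (\<forall>x\<in>emb S ` \<T>. inner g x = \<Lambda>' x)"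
  proof (rule riesz_subspace)
    have "0 = emb S (\<lambda>x. 0)"
      using emb_scale[OF S' L2_space_zero, of 0] by simp
    then show "subspace (emb S ` \<T>)"
      unfolding subspace_def
      using zero_in L2 by (auto simp: image_iff S' intro: add_in scale_in
          simp flip: emb_add[OF S'] emb_scale[OF S'])
    show "\<Lambda>' (x + y) = \<Lambda>' x + \<Lambda>' y" if "x \<in> emb S ` \<T>" "y \<in> emb S ` \<T>" for x y
      using that by (auto simp: \<Lambda>' add add_in L2 simp flip: emb_add[OF S'])
    show "\<Lambda>' (c *\<^sub>R x) = c * \<Lambda>' x" if "x \<in> emb S ` \<T>" for c x
      using that by (auto simp: \<Lambda>' scale scale_in L2 simp flip: emb_scale[OF S'])
    show "\<bar>\<Lambda>' x\<bar> \<le> C * norm x" if "x \<in> emb S ` \<T>" for x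
      using that by (auto simp: \<Lambda>' bound L2 norm_emb[OF S'])
    show "\<exists>g\<in>emb S ` L2_space S. X \<longlonglongrightarrow> g" if X: "\<And>n. X n \<in> emb S ` \<T>" "Cauchy X" for X
    proof -
      from X(1) have "\<forall>n. \<exists>\<phi>. \<phi> \<in> \<T> \<and> X n = emb S \<phi>" by blast
      then obtain f where f: "\<And>n. f n \<in> \<T>" "\<And>n. X n = emb S (f n)" by metis
      have "X = (\<lambda>n. emb S (f n))" using f(2) by auto
      then show ?thesis
        using L2_complete[OF S L2[OF f(1)]] X(2) by auto
    qed
  qed (rule C)
  then obtain g where g: "g \<in> L2_space S" "norm (emb S g) \<le> C" "\<And>\<phi>. \<phi> \<in> \<T> \<Longrightarrow> inner (emb S g) (emb S \<phi>) = \<Lambda> \<phi>"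
    by (auto simp: \<Lambda>')
  then show ?thesis
    using L2 by (intro bexI[of _ g]) (auto simp: norm_emb[OF S'] inner_emb[OF S'])
qed

section \<open>Continuously differentiable functions and test functions\<close>

lemma partial_derivI:
  fixes \<phi> :: "real^2 \<Rightarrow> real"
  assumes "(\<phi> has_derivative D) (at x)"
  shows "partial_deriv i \<phi> x = D (axis i 1)"
  using frechet_derivative_at[OF assms] by (simp add: partial_deriv_def)

lemma C1_fun_has_derivative:
  assumes "C1_fun \<phi>"
  shows "(\<phi> has_derivative frechet_derivative \<phi> (at x)) (at x)"
  using assms by (simp add: C1_fun_def frechet_derivative_works)

lemma C1_fun_continuous_partial: "C1_fun \<phi> \<Longrightarrow> continuous_on UNIV (partial_deriv i \<phi>)"
  by (simp add: C1_fun_def)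

lemma C1_fun_continuous: "C1_fun \<phi> \<Longrightarrow> continuous_on UNIV \<phi>"
  by (simp add: C1_fun_def differentiable_imp_continuous_within continuous_at_imp_continuous_on)

lemma C1_funI:
  assumes "\<And>x. (\<phi> has_derivative D x) (at x)" "\<And>i. continuous_on UNIV (\<lambda>x. D x (axis i 1))"
  shows "C1_fun \<phi>"
  unfolding C1_fun_def
proof (intro conjI allI)
  show "\<phi> differentiable at x" for x
    using assms(1) by (auto simp: differentiable_def)
  show "continuous_on UNIV (partial_deriv i \<phi>)" for i
    using assms(2)[of i] partial_derivI[OF assms(1)] by (simp cong: continuous_on_cong)
qed

lemma C1_fun_add:
  assumes "C1_fun \<phi>" "C1_fun \<psi>"
  shows "C1_fun (\<lambda>x. \<phi> x + \<psi> x)"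
    and "partial_deriv i (\<lambda>x. \<phi> x + \<psi> x) = (\<lambda>x. partial_deriv i \<phi> x + partial_deriv i \<psi> x)"
proof -
  note d = has_derivative_add[OF assms[THEN C1_fun_has_derivative]]
  show "C1_fun (\<lambda>x. \<phi> x + \<psi> x)"
    by (rule C1_funI[OF d]) (unfold partial_deriv_def[symmetric], intro continuous_intros assms[THEN C1_fun_continuous_partial])
  show "partial_deriv i (\<lambda>x. \<phi> x + \<psi> x) = (\<lambda>x. partial_deriv i \<phi> x + partial_deriv i \<psi> x)"
    using partial_derivI[OF d] by (auto simp: partial_deriv_def)
qed

lemma C1_fun_mult:
  assumes "C1_fun \<phi>" "C1_fun \<psi>"
  shows "C1_fun (\<lambda>x. \<phi> x * \<psi> x)"
    and "partial_deriv i (\<lambda>x. \<phi> x * \<psi> x) = (\<lambda>x. \<phi> x * partial_deriv i \<psi> x + partial_deriv i \<phi> x * \<psi> x)"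
proof -
  note d = has_derivative_mult[OF assms[THEN C1_fun_has_derivative]]
  show "C1_fun (\<lambda>x. \<phi> x * \<psi> x)"
    by (rule C1_funI[OF d]) (unfold partial_deriv_def[symmetric],
        intro continuous_intros assms[THEN C1_fun_continuous_partial] assms[THEN C1_fun_continuous])
  show "partial_deriv i (\<lambda>x. \<phi> x * \<psi> x) = (\<lambda>x. \<phi> x * partial_deriv i \<psi> x + partial_deriv i \<phi> x * \<psi> x)"
    using partial_derivI[OF d] by (auto simp: partial_deriv_def)
qed

lemma C1_fun_const: "C1_fun (\<lambda>x. c)" "partial_deriv i (\<lambda>x. c) = (\<lambda>x. 0)"
proof -
  have d: "((\<lambda>x. c) has_derivative (\<lambda>h. 0)) (at x)" for x :: "real^2"
    by simp
  show "C1_fun (\<lambda>x. c)"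
    by (rule C1_funI[OF d]) simp
  show "partial_deriv i (\<lambda>x. c) = (\<lambda>x. 0)"
    using partial_derivI[OF d] by auto
qed

lemma C1_fun_scale:
  assumes "C1_fun \<phi>"
  shows "C1_fun (\<lambda>x. c * \<phi> x)" "partial_deriv i (\<lambda>x. c * \<phi> x) = (\<lambda>x. c * partial_deriv i \<phi> x)"
  using C1_fun_mult[OF C1_fun_const(1)[of c] assms] by (simp_all add: C1_fun_const(2))

lemma C1_fun_compose:
  assumes "C1_fun \<phi>" and f: "\<And>t. (f has_real_derivative f' t) (at t)" "continuous_on UNIV f'"
  shows "C1_fun (\<lambda>x. f (\<phi> x))" "partial_deriv i (\<lambda>x. f (\<phi> x)) = (\<lambda>x. f' (\<phi> x) * partial_deriv i \<phi> x)"
proof -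
  have d: "((\<lambda>x. f (\<phi> x)) has_derivative (\<lambda>h. f' (\<phi> x) * frechet_derivative \<phi> (at x) h)) (at x)" for x
    using has_derivative_compose[OF C1_fun_has_derivative[OF assms(1)] f(1)[unfolded has_field_derivative_def]]
    by simp
  show "C1_fun (\<lambda>x. f (\<phi> x))"
    by (rule C1_funI[OF d]) (unfold partial_deriv_def[symmetric],
        intro continuous_intros continuous_on_compose2[OF f(2)] C1_fun_continuous_partial C1_fun_continuous assms(1) subset_UNIV)
  show "partial_deriv i (\<lambda>x. f (\<phi> x)) = (\<lambda>x. f' (\<phi> x) * partial_deriv i \<phi> x)"
    using partial_derivI[OF d] by (auto simp: partial_deriv_def)
qed

lemma C1_fun_coord: "C1_fun (\<lambda>x. x $ k)" "partial_deriv i (\<lambda>x. x $ k) = (\<lambda>x. if i = k then 1 else 0)"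
proof -
  have d: "((\<lambda>x. x $ k) has_derivative (\<lambda>h. h $ k)) (at x)" for x :: "real^2"
    by (intro bounded_linear_imp_has_derivative bounded_linear_vec_nth)
  show "C1_fun (\<lambda>x. x $ k)"
    by (rule C1_funI[OF d]) simp
  show "partial_deriv i (\<lambda>x. x $ k) = (\<lambda>x. if i = k then 1 else 0)"
    using partial_derivI[OF d] by (auto simp: axis_def)
qed

lemmas C1_fun_coord_compose = C1_fun_compose[OF C1_fun_coord(1), unfolded C1_fun_coord(2)]

text \<open>Translations (\<open>\<epsilon> = 1\<close>) and reflections (\<open>\<epsilon> = -1\<close>) along one axis.\<close>

definition coord_affine :: "2 \<Rightarrow> real \<Rightarrow> real \<Rightarrow> real^2 \<Rightarrow> real^2" where
  "coord_affine j \<epsilon> c x = (\<chi> i. if i = j then \<epsilon> * x $ j + c else x $ i)"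

lemma coord_affine_nth: "coord_affine j \<epsilon> c x $ i = (if i = j then \<epsilon> * x $ j + c else x $ i)"
  by (simp add: coord_affine_def)

lemma has_derivative_coord_affine:
  "(coord_affine j \<epsilon> c has_derivative coord_affine j \<epsilon> 0) (at x)"
proof -
  have bl: "bounded_linear (coord_affine j \<epsilon> 0)"
    by (intro linear_conv_bounded_linear[THEN iffD1] linearI)
      (auto simp: vec_eq_iff coord_affine_nth algebra_simps)
  have "(coord_affine j \<epsilon> c) = (\<lambda>x. coord_affine j \<epsilon> 0 x + axis j c)"
    by (auto simp: vec_eq_iff fun_eq_iff coord_affine_nth axis_def)
  then show ?thesis
    using has_derivative_add_const[OF bounded_linear_imp_has_derivative[OF bl]] by simp
qed

lemma C1_fun_coord_affine:
  assumes "C1_fun \<phi>"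
  shows "C1_fun (\<lambda>x. \<phi> (coord_affine j \<epsilon> c x))"
    and "partial_deriv i (\<lambda>x. \<phi> (coord_affine j \<epsilon> c x)) = (\<lambda>x. (if i = j then \<epsilon> else 1) * partial_deriv i \<phi> (coord_affine j \<epsilon> c x))"
proof -
  have d: "((\<lambda>x. \<phi> (coord_affine j \<epsilon> c x)) has_derivative
      (\<lambda>h. frechet_derivative \<phi> (at (coord_affine j \<epsilon> c x)) (coord_affine j \<epsilon> 0 h))) (at x)" for x
    by (rule has_derivative_compose[OF has_derivative_coord_affine C1_fun_has_derivative[OF assms]])
  have ax: "coord_affine j \<epsilon> 0 (axis i 1) = (if i = j then \<epsilon> else 1) *\<^sub>R axis i 1" for i
    by (auto simp: vec_eq_iff coord_affine_nth axis_def)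
  have lin: "linear (frechet_derivative \<phi> (at y))" for y
    using C1_fun_has_derivative[OF assms] by (rule has_derivative_linear)
  have *: "frechet_derivative \<phi> (at (coord_affine j \<epsilon> c x)) (coord_affine j \<epsilon> 0 (axis i 1)) =
      (if i = j then \<epsilon> else 1) * partial_deriv i \<phi> (coord_affine j \<epsilon> c x)" for x i
    by (simp only: ax linear_cmul[OF lin]) (simp add: partial_deriv_def)
  have "continuous_on UNIV (coord_affine j \<epsilon> c)"
    by (intro continuous_at_imp_continuous_on ballI has_derivative_continuous[OF has_derivative_coord_affine])
  then show "C1_fun (\<lambda>x. \<phi> (coord_affine j \<epsilon> c x))"
    by (intro C1_funI[OF d]) (unfold *, intro continuous_intros continuous_on_compose2[OF C1_fun_continuous_partial[OF assms]] subset_UNIV)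
  show "partial_deriv i (\<lambda>x. \<phi> (coord_affine j \<epsilon> c x)) = (\<lambda>x. (if i = j then \<epsilon> else 1) * partial_deriv i \<phi> (coord_affine j \<epsilon> c x))"
    using partial_derivI[OF d] by (auto simp: *)
qed

lemma C1_fun_line_derivative:
  assumes "C1_fun \<phi>"
  shows "((\<lambda>s. \<phi> (coord_affine j 1 s x)) has_real_derivative partial_deriv j \<phi> (coord_affine j 1 s x)) (at s)"
proof -
  have 1: "((\<lambda>s. coord_affine j 1 s x) has_derivative (\<lambda>h. h *\<^sub>R axis j 1)) (at s)"
  proof -
    have "(\<lambda>s. coord_affine j 1 s x) = (\<lambda>s. x + s *\<^sub>R axis j 1)"
      by (auto simp: vec_eq_iff fun_eq_iff coord_affine_nth axis_def)
    then show ?thesis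
      by (auto intro!: derivative_eq_intros)
  qed
  have "linear (frechet_derivative \<phi> (at y))" for y
    using C1_fun_has_derivative[OF assms] by (rule has_derivative_linear)
  from linear_cmul[OF this] show ?thesis
    using has_derivative_compose[OF 1 C1_fun_has_derivative[OF assms]]
    by (simp add: has_field_derivative_def partial_deriv_def mult.commute[of _ "frechet_derivative _ _ _"])
qed

lemma square_eq_box: "square L = box (\<chi> i. - L) (\<chi> i. L)"
  by (auto simp: square_def mem_box_cart)

lemma square_lmeasurable [simp]: "square L \<in> lmeasurable"
  by (simp add: square_eq_box)

lemma square_measurable [simp]: "square L \<in> sets lebesgue"
  by (simp add: square_eq_box)

lemma open_square: "open (square L)"
  by (simp add: square_eq_box open_box)

lemma square_subset_cbox: "square L \<subseteq> cbox (\<chi> i. - L) (\<chi> i. L)"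
  by (simp add: square_eq_box box_subset_cbox)

lemma continuous_L2_square:
  fixes \<phi> :: "real^2 \<Rightarrow> real"
  assumes "continuous_on UNIV \<phi>"
  shows "\<phi> \<in> L2_space (square L)"
proof -
  have m: "\<phi> \<in> borel_measurable (lebesgue_on (square L))"
    using assms by (intro borel_measurable_if_D measurable_restrict_space1 continuous_imp_measurable_on_sets_lebesgue[of UNIV, unfolded lebesgue_on_UNIV_eq]) auto
  have "compact (\<phi> ` cbox (\<chi> i. - L) (\<chi> i. L))"
    by (intro compact_continuous_image continuous_on_subset[OF assms]) auto
  then obtain B where B: "\<And>x. x \<in> square L \<Longrightarrow> \<bar>\<phi> x\<bar> \<le> B"
    using square_subset_cbox[of L] unfolding compact_eq_bounded_closed bounded_real by blast
  interpret finite_measure "lebesgue_on (square L)"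
    by (rule finite_measure_lebesgue_on_lmeasurable) simp
  have "integrable (lebesgue_on (square L)) (\<lambda>x. (norm (\<phi> x))\<^sup>2)"
  proof (rule integrable_const_bound[of _ "B\<^sup>2"])
    show "AE x in lebesgue_on (square L). norm ((norm (\<phi> x))\<^sup>2) \<le> B\<^sup>2"
      using power_mono[OF B, of _ 2] by (auto intro!: AE_I2 simp: space_restrict_space)
  qed (use m in auto)
  with m show ?thesis by (rule L2_spaceI)
qed

lemma test_functions_C1: "\<phi> \<in> test_functions bc L \<Longrightarrow> C1_fun \<phi>"
  by (simp add: test_functions_def)

lemma test_functions_L2: "\<phi> \<in> test_functions bc L \<Longrightarrow> \<phi> \<in> L2_space (square L)"
  by (intro continuous_L2_square C1_fun_continuous test_functions_C1)

lemma partial_deriv_L2: "C1_fun \<phi> \<Longrightarrow> partial_deriv i \<phi> \<in> L2_space (square L)"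
  by (intro continuous_L2_square C1_fun_continuous_partial)

lemma test_functions_zero: "(\<lambda>x. 0) \<in> test_functions bc L"
  by (auto simp: test_functions_def C1_fun_const split: boundary_cond.split)

lemma test_functions_scale:
  assumes "\<phi> \<in> test_functions bc L"
  shows "(\<lambda>x. c * \<phi> x) \<in> test_functions bc L"
proof (cases bc)
  case Neumann
  have "closure {x. c * \<phi> x \<noteq> 0} \<subseteq> closure {x. \<phi> x \<noteq> 0}"
    by (intro closure_mono) auto
  then show ?thesis
    using assms Neumann compact_Int_closed[OF _ closed_closure, of "closure {x. \<phi> x \<noteq> 0}" "{x. c * \<phi> x \<noteq> 0}"]
    by (auto simp: test_functions_def C1_fun_scale Int_absorb1 Int_absorb2)
qed (use assms in \<open>auto simp: test_functions_def C1_fun_scale\<close>)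

lemma test_functions_add:
  assumes "\<phi> \<in> test_functions bc L" "\<psi> \<in> test_functions bc L"
  shows "(\<lambda>x. \<phi> x + \<psi> x) \<in> test_functions bc L"
proof (cases bc)
  case Neumann
  have sub: "closure {x. \<phi> x + \<psi> x \<noteq> 0} \<subseteq> closure {x. \<phi> x \<noteq> 0} \<union> closure {x. \<psi> x \<noteq> 0}"
    unfolding closure_Un[symmetric] by (intro closure_mono) auto
  have "compact (closure {x. \<phi> x \<noteq> 0} \<union> closure {x. \<psi> x \<noteq> 0})"
    using assms Neumann by (auto simp: test_functions_def)
  from compact_Int_closed[OF this closed_closure, of "{x. \<phi> x + \<psi> x \<noteq> 0}"] sub
  have "compact (closure {x. \<phi> x + \<psi> x \<noteq> 0})"
    by (simp add: Int_absorb1)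
  then show ?thesis
    using assms Neumann sub by (auto simp: test_functions_def C1_fun_add)
qed (use assms in \<open>auto simp: test_functions_def C1_fun_add\<close>)

section \<open>The fundamental lemma of the calculus of variations\<close>

text \<open>Boxes generate the Borel sets, so the integral of \<open>f\<close> over every Borel set vanishes, in particular
  over the sets where \<open>f\<close> is positive and where it is negative.\<close>

lemma AE_zero_if_box_integrals_zero:
  fixes f :: "real^2 \<Rightarrow> real"
  assumes f: "integrable (lebesgue_on S) f" and S: "S = box l u"
    and zero: "\<And>a b. box a b \<subseteq> S \<Longrightarrow> (LINT x|lebesgue_on S. f x * indicator (box a b) x) = 0"
  shows "AE x in lebesgue_on S. f x = 0"
proof -
  have Sm: "S \<in> sets lebesgue" "S \<in> sets borel"
    by (simp_all add: S)
  define F where "F x = indicator S x *\<^sub>R f x" for x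
  have F: "integrable lebesgue F"
    using f Sm unfolding F_def by (simp add: integrable_restrict_space)
  obtain g where g: "g \<in> borel_measurable lborel" "AE x in lborel. F x = g x"
    using completion_ex_borel_measurable_real[OF borel_measurable_integrable[OF F]] by blast
  note [measurable] = g(1)
  have AEl: "AE x in lebesgue. F x = g x"
    using g(2) by (rule AE_completion)
  have gi: "integrable lebesgue g"
    using F g(1) AEl by (subst integrable_cong_AE[of g _ F]) (auto intro: measurable_completion)
  then have gi: "integrable lborel g"
    using g(1) by (simp add: integrable_completion)
  have key: "set_lebesgue_integral lborel (box a b) g = 0" for a b
  proof -
    obtain a' b' where ab: "box a b \<inter> S = box a' b'"
      unfolding S box_Int_box by blast
    have "set_lebesgue_integral lborel (box a b) g = (LINT x|lebesgue. indicator (box a b) x *\<^sub>R g x)"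
      unfolding set_lebesgue_integral_def using g(1) by (subst integral_completion) auto
    also have "\<dots> = (LINT x|lebesgue. indicator S x *\<^sub>R (f x * indicator (box a' b') x))"
    proof (rule integral_cong_AE)
      show "AE x in lebesgue. indicator (box a b) x *\<^sub>R g x = indicator S x *\<^sub>R (f x * indicator (box a' b') x)"
        using AEl by eventually_elim (auto simp: F_def indicator_def simp flip: ab split: if_splits)
      show "(\<lambda>x. indicator S x *\<^sub>R (f x * indicator (box a' b') x)) \<in> borel_measurable lebesgue"
      proof -
        have "(\<lambda>x. F x * indicator (box a' b') x) \<in> borel_measurable lebesgue"
          using F by (intro borel_measurable_times borel_measurable_integrable borel_measurable_indicator) auto
        then show ?thesis by (simp add: F_def mult.assoc)
      qed
    qed (use g(1) in \<open>auto intro!: measurable_completion\<close>)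
    also have "\<dots> = (LINT x|lebesgue_on S. f x * indicator (box a' b') x)"
      using Sm by (subst integral_restrict_space) auto
    also have "\<dots> = 0"
      by (rule zero) (use ab in blast)
    finally show ?thesis .
  qed
  have total: "(LINT x|lborel. g x) = 0"
  proof -
    have "(LINT x|lborel. g x) = (LINT x|lborel. indicator S x *\<^sub>R g x)"
    proof (rule integral_cong_AE)
      show "AE x in lborel. g x = indicator S x *\<^sub>R g x"
        using g(2) by eventually_elim (auto simp: F_def indicator_def)
    qed (use Sm in auto)
    also have "\<dots> = 0"
      using key[of l u] by (simp add: set_lebesgue_integral_def S)
    finally show ?thesis .
  qed
  have all: "set_lebesgue_integral lborel A g = 0" if "A \<in> sets borel" for A
  proof -
    have sub: "range (\<lambda>(a, b). box a b :: (real^2) set) \<subseteq> Pow UNIV" by simp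
    have stable: "Int_stable (range (\<lambda>(a, b). box a b :: (real^2) set))"
      by (auto simp: Int_stable_def box_Int_box)
    have "A \<in> sigma_sets UNIV (range (\<lambda>(a, b). box a b))"
      using that unfolding borel_eq_box by simp
    with stable sub show ?thesis
    proof (induction rule: sigma_sets_induct_disjoint)
      case (basic A)
      then show ?case using key by auto
    next
      case empty
      then show ?case by (simp add: set_lebesgue_integral_def)
    next
      case (compl A)
      then have A: "A \<in> sets borel" by (simp add: borel_eq_box)
      have "set_lebesgue_integral lborel (UNIV - A) g = (LINT x|lborel. g x - indicator A x *\<^sub>R g x)"
        unfolding set_lebesgue_integral_def
        by (intro Bochner_Integration.integral_cong) (auto simp: indicator_def)
      also have "\<dots> = (LINT x|lborel. g x) - (LINT x|lborel. indicator A x *\<^sub>R g x)"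
        using gi A by (intro Bochner_Integration.integral_diff integrable_mult_indicator) auto
      also have "\<dots> = 0"
        using total compl by (simp add: set_lebesgue_integral_def)
      finally show ?case .
    next
      case (union A)
      then have A: "A i \<in> sets borel" for i by (auto simp: borel_eq_box)
      have "(LINT x:(\<Union>i. A i)|lborel. g x) = (\<Sum>i. (LINT x:(A i)|lborel. g x))"
      proof (rule lebesgue_integral_countable_add)
        show "A i \<inter> A j = {}" if "i \<noteq> j" for i j
          using union(1) that by (auto simp: disjoint_family_on_def)
        have "(\<Union>i. A i) \<in> sets lborel" using A by auto
        then show "set_integrable lborel (\<Union>i. A i) g"
          unfolding set_integrable_def using gi by (intro integrable_mult_indicator)
      qed (use A in auto)
      then show ?case using union by simp
    qed
  qed
  have pos: "AE x in lborel. s * g x \<le> 0" if s: "s = 1 \<or> s = -1" for s :: real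
  proof -
    define A where "A = {x. s * g x > 0}"
    have A: "A \<in> sets borel"
    proof -
      have "{x \<in> space lborel. s * g x > 0} \<in> sets lborel" by measurable
      then show ?thesis by (simp add: A_def)
    qed
    have int: "integrable lborel (\<lambda>x. s * (indicator A x *\<^sub>R g x))"
      using gi A by (intro integrable_mult_right integrable_mult_indicator) auto
    have "(LINT x|lborel. s * (indicator A x *\<^sub>R g x)) = s * set_lebesgue_integral lborel A g"
      unfolding set_lebesgue_integral_def by (rule integral_mult_right_zero)
    then have "(LINT x|lborel. s * (indicator A x *\<^sub>R g x)) = 0"
      using all[OF A] by simp
    moreover have "AE x in lborel. 0 \<le> s * (indicator A x *\<^sub>R g x)"
      by (auto simp: A_def indicator_def)
    ultimately have "AE x in lborel. s * (indicator A x *\<^sub>R g x) = 0"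
      using integral_nonneg_eq_0_iff_AE[OF int] by blast
    then show ?thesis
      by eventually_elim (auto simp: A_def indicator_def not_less split: if_splits)
  qed
  have "AE x in lborel. F x = 0"
    using pos[of 1, simplified] pos[of "-1", simplified] g(2) by eventually_elim auto
  then have "AE x in lebesgue. F x = 0"
    by (rule AE_completion)
  then have "AE x in lebesgue. x \<in> S \<longrightarrow> f x = 0"
    by eventually_elim (auto simp: F_def)
  then show ?thesis
    using Sm by (simp add: AE_restrict_space_iff)
qed

text \<open>A smooth function with the sign of its argument on \<open>(-2L, 2L)\<close>. In the periodic case it changes sign
  under translation by \<open>2L\<close>, so that the product of two of its values in \<open>bump\<close> is periodic.\<close>

definition odd_sign :: "boundary_cond \<Rightarrow> real \<Rightarrow> real \<Rightarrow> real" where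
  "odd_sign bc L t = (case bc of Neumann \<Rightarrow> t | Periodic \<Rightarrow> sin (pi / (2 * L) * t))"

text \<open>The square of the positive part makes the bump continuously differentiable.\<close>

definition bump :: "boundary_cond \<Rightarrow> real \<Rightarrow> real \<Rightarrow> real \<Rightarrow> real \<Rightarrow> real" where
  "bump bc L a b t = (max 0 (odd_sign bc L (t - a) * odd_sign bc L (b - t)))\<^sup>2"

lemma has_derivative_max_zero_sq:
  "((\<lambda>t. (max 0 t)\<^sup>2) has_real_derivative 2 * max 0 t) (at (t::real))"
proof -
  consider "t > 0" | "t < 0" | "t = 0" by linarith
  then show ?thesis
  proof cases
    case 1
    have "((\<lambda>t. t\<^sup>2) has_real_derivative 2 * max 0 t) (at t)"
      using 1 by (auto intro!: derivative_eq_intros)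
    then show ?thesis
      by (rule has_field_derivative_transform_within_open[of _ _ _ "{0<..}"]) (use 1 in auto)
  next
    case 2
    have "((\<lambda>t. 0) has_real_derivative 2 * max 0 t) (at t)"
      using 2 by simp
    then show ?thesis
      by (rule has_field_derivative_transform_within_open[of _ _ _ "{..<0}"]) (use 2 in auto)
  next
    case 3
    have "((\<lambda>h::real. (max 0 h)\<^sup>2 / h) \<longlongrightarrow> 0) (at 0)"
    proof (rule Lim_null_comparison)
      show "\<forall>\<^sub>F h in at 0. norm ((max 0 h)\<^sup>2 / h) \<le> \<bar>h :: real\<bar>"
        by (auto simp: eventually_at_filter max_def power2_eq_square)
      show "((\<lambda>h. \<bar>h :: real\<bar>) \<longlongrightarrow> 0) (at 0)"
        by (intro tendsto_rabs_zero tendsto_ident_at)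
    qed
    then show ?thesis
      using 3 by (simp add: has_field_derivative_iff)
  qed
qed

lemma odd_sign_derivative:
  "(odd_sign bc L has_real_derivative (case bc of Neumann \<Rightarrow> 1 | Periodic \<Rightarrow> cos (pi / (2 * L) * t) * (pi / (2 * L)))) (at t)"
proof (cases bc)
  case Neumann
  then show ?thesis by (simp add: odd_sign_def[abs_def])
next
  case Periodic
  have "((\<lambda>t. sin (pi / (2 * L) * t)) has_real_derivative cos (pi / (2 * L) * t) * (pi / (2 * L))) (at t)"
    by (rule DERIV_chain2[OF DERIV_sin DERIV_cmult_Id])
  then show ?thesis
    using Periodic by (simp only: odd_sign_def[abs_def] boundary_cond.case)
qed

lemma bump_C1:
  obtains D where "\<And>t. (bump bc L a b has_real_derivative D t) (at t)" "continuous_on UNIV D"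
proof -
  define p where "p t = odd_sign bc L (t - a) * odd_sign bc L (b - t)" for t
  define s' where "s' = (\<lambda>t. case bc of Neumann \<Rightarrow> 1 | Periodic \<Rightarrow> cos (pi / (2 * L) * t) * (pi / (2 * L)))"
  define p' where "p' t = s' (t - a) * odd_sign bc L (b - t) - odd_sign bc L (t - a) * s' (b - t)" for t
  have s: "(odd_sign bc L has_real_derivative s' t) (at t)" for t
    unfolding s'_def by (rule odd_sign_derivative)
  have p: "(p has_real_derivative p' t) (at t)" for t
    unfolding p_def p'_def
    by (rule derivative_eq_intros DERIV_chain2[OF s] refl | simp)+
  have cs: "continuous_on UNIV s'"
  proof (cases bc)
    case Periodic
    have "continuous_on UNIV (\<lambda>t. cos (k * t) * k)" for k :: real
      by (intro continuous_intros)
    from this[of "pi / (2 * L)"] show ?thesis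
      unfolding s'_def Periodic boundary_cond.case .
  qed (simp add: s'_def)
  have co: "continuous_on UNIV (odd_sign bc L)"
    using s by (auto intro!: continuous_at_imp_continuous_on DERIV_isCont)
  have cp: "continuous_on UNIV p"
    using p by (auto intro!: continuous_at_imp_continuous_on DERIV_isCont)
  have cp': "continuous_on UNIV p'"
    unfolding p'_def by (intro continuous_intros continuous_on_compose2[OF cs] continuous_on_compose2[OF co]) auto
  show thesis
  proof
    show "(bump bc L a b has_real_derivative (2 * max 0 (p t) * p' t)) (at t)" for t
      unfolding bump_def using DERIV_chain2[OF has_derivative_max_zero_sq p] by (simp add: p_def)
    show "continuous_on UNIV (\<lambda>t. 2 * max 0 (p t) * p' t)"
      by (intro continuous_intros cp cp')
  qed
qed

lemma odd_sign_pos: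
  assumes "0 < t" "t < 2 * L"
  shows "odd_sign bc L t > 0"
proof (cases bc)
  case Periodic
  have "L > 0" using assms by simp
  then have "pi / (2 * L) * t < pi" "0 < pi / (2 * L) * t"
    using assms by (auto simp: field_simps)
  then show ?thesis
    using Periodic by (simp add: odd_sign_def sin_gt_zero)
qed (use assms in \<open>simp add: odd_sign_def\<close>)

lemma odd_sign_minus: "odd_sign bc L (- t) = - odd_sign bc L t"
  by (cases bc) (simp_all add: odd_sign_def)

lemma odd_sign_nonneg:
  assumes "0 \<le> t" "t < 2 * L"
  shows "odd_sign bc L t \<ge> 0"
  using odd_sign_pos[of t L bc] assms by (cases "t = 0") (auto simp: odd_sign_def split: boundary_cond.split)

lemma bump_pos:
  assumes "- L \<le> a" "b \<le> L" "a < t" "t < b"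
  shows "bump bc L a b t > 0"
  using odd_sign_pos[of "t - a" L bc] odd_sign_pos[of "b - t" L bc] assms
  by (simp add: bump_def)

lemma bump_zero:
  assumes "a \<le> b" "t \<le> a \<or> b \<le> t" "bc = Periodic \<Longrightarrow> - L \<le> t \<and> t \<le> L \<and> - L < a \<and> b < L"
  shows "bump bc L a b t = 0"
proof -
  have "odd_sign bc L (t - a) * odd_sign bc L (b - t) \<le> 0"
  proof (cases bc)
    case Neumann
    then show ?thesis using assms(1,2) by (auto simp: odd_sign_def mult_le_0_iff)
  next
    case Periodic
    have "odd_sign bc L (t - a) \<le> 0 \<and> odd_sign bc L (b - t) \<ge> 0" if "t \<le> a"
      using odd_sign_nonneg[of "a - t" L bc] odd_sign_nonneg[of "b - t" L bc] odd_sign_minus[of bc L "a - t"] assms Periodic that by auto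
    moreover have "odd_sign bc L (t - a) \<ge> 0 \<and> odd_sign bc L (b - t) \<le> 0" if "b \<le> t"
      using odd_sign_nonneg[of "t - a" L bc] odd_sign_nonneg[of "t - b" L bc] odd_sign_minus[of bc L "t - b"] assms Periodic that by auto
    ultimately show ?thesis
      using assms(2) by (auto simp: mult_le_0_iff)
  qed
  then show ?thesis by (simp add: bump_def max_def)
qed

lemma bump_periodic: "L > 0 \<Longrightarrow> bump Periodic L a b (t + 2 * L) = bump Periodic L a b t"
proof -
  assume L: "L > 0"
  have "pi / (2 * L) * (t + 2 * L - a) = pi / (2 * L) * (t - a) + pi"
    "pi / (2 * L) * (b - (t + 2 * L)) = pi / (2 * L) * (b - t) - pi"
    using L by (simp_all add: field_simps)
  then show ?thesis
    by (simp add: bump_def odd_sign_def sin_diff)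
qed

lemma bump_tendsto:
  assumes "a' \<longlonglongrightarrow> a" "b' \<longlonglongrightarrow> b"
  shows "(\<lambda>n. bump bc L (a' n) (b' n) t) \<longlonglongrightarrow> bump bc L a b t"
proof -
  have "isCont (odd_sign bc L) s" for s
    using odd_sign_derivative by (rule DERIV_isCont)
  then show ?thesis
    unfolding bump_def
    by (intro tendsto_intros isCont_tendsto_compose[of _ "odd_sign bc L"] assms)
qed

definition box_bump :: "boundary_cond \<Rightarrow> real \<Rightarrow> real^2 \<Rightarrow> real^2 \<Rightarrow> real^2 \<Rightarrow> real" where
  "box_bump bc L a b x = bump bc L (a $ 1) (b $ 1) (x $ 1) * bump bc L (a $ 2) (b $ 2) (x $ 2)"

text \<open>With growing \<open>n\<close> these functions increase to the indicator of the set where the bump is positive.\<close>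

definition box_cutoff :: "boundary_cond \<Rightarrow> real \<Rightarrow> real^2 \<Rightarrow> real^2 \<Rightarrow> real \<Rightarrow> real^2 \<Rightarrow> real" where
  "box_cutoff bc L a b n x = 1 - 1 / (1 + n * (box_bump bc L a b x)\<^sup>2)"

lemma box_cutoff_bounds:
  assumes "n \<ge> 0"
  shows "0 \<le> box_cutoff bc L a b n x" "box_cutoff bc L a b n x \<le> 1"
  using assms by (auto simp: box_cutoff_def divide_simps add_pos_nonneg add_nonneg_eq_0_iff)

lemma box_cutoff_test_function:
  assumes L: "L > 0" and n: "n \<ge> 0" and ab: "\<And>i. - L < a $ i \<and> a $ i \<le> b $ i \<and> b $ i < L"
  shows "box_cutoff bc L a b n \<in> test_functions bc L"
proof -
  obtain D1 where D1: "\<And>t. (bump bc L (a$1) (b$1) has_real_derivative D1 t) (at t)" "continuous_on UNIV D1"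
    using bump_C1 by blast
  obtain D2 where D2: "\<And>t. (bump bc L (a$2) (b$2) has_real_derivative D2 t) (at t)" "continuous_on UNIV D2"
    using bump_C1 by blast
  have B: "C1_fun (box_bump bc L a b)"
    unfolding box_bump_def
    by (intro C1_fun_mult C1_fun_coord_compose(1)[OF D1] C1_fun_coord_compose(1)[OF D2])
  have pos: "1 + n * y\<^sup>2 > 0" for y
    using n by (intro add_pos_nonneg mult_nonneg_nonneg) auto
  have d: "((\<lambda>y. 1 - 1 / (1 + n * y\<^sup>2)) has_real_derivative 2 * n * y / (1 + n * y\<^sup>2)\<^sup>2) (at y)" for y
    using pos[of y] by (auto intro!: derivative_eq_intros simp: power2_eq_square)
  have C1: "C1_fun (box_cutoff bc L a b n)"
    unfolding box_cutoff_def
    by (rule C1_fun_compose(1)[OF B d]) (use pos in \<open>auto intro!: continuous_intros simp: less_imp_neq[symmetric]\<close>)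
  show ?thesis
  proof (cases bc)
    case Neumann
    have "box_cutoff bc L a b n x = 0" if "x \<notin> cbox a b" for x
    proof -
      have "box_bump bc L a b x = 0"
        using that bump_zero[of "a$1" "b$1" "x$1" bc L] bump_zero[of "a$2" "b$2" "x$2" bc L] ab[of 1] ab[of 2] Neumann
        by (auto simp: box_bump_def mem_box_cart forall_2)
      then show ?thesis by (simp add: box_cutoff_def)
    qed
    then have sub: "closure {x. box_cutoff bc L a b n x \<noteq> 0} \<subseteq> cbox a b"
      by (intro closure_minimal) auto
    then have "compact (closure {x. box_cutoff bc L a b n x \<noteq> 0})"
      using compact_Int_closed[OF compact_cbox closed_closure] by (metis Int_absorb1)
    moreover have "cbox a b \<subseteq> square L"
    proof
      fix x assume x: "x \<in> cbox a b"
      have "- L < x $ i \<and> x $ i < L" for i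
        using x ab[of i] by (auto simp: mem_box_cart intro: less_le_trans le_less_trans)
      then show "x \<in> square L" by (simp add: square_def)
    qed
    ultimately show ?thesis
      using C1 sub Neumann by (auto simp: test_functions_def)
  next
    case Periodic
    have "box_cutoff bc L a b n (x + axis i (2 * L)) = box_cutoff bc L a b n x" for x i
      using exhaust_2[of i] L Periodic bump_periodic[OF L]
      by (auto simp: box_cutoff_def box_bump_def axis_def)
    then show ?thesis
      using C1 Periodic by (auto simp: test_functions_def)
  qed
qed

text \<open>The cutoffs of slightly smaller boxes are test functions and converge boundedly to the indicator of
  a given box. The boxes have to shrink because in the Neumann case the support of a test function
  must stay inside the open square, even if the given box touches the boundary.\<close>

lemma fundamental_lemma:
  assumes L: "L > 0" and f: "f \<in> L2_space (square L)"
    and zero: "\<And>\<phi>. \<phi> \<in> test_functions bc L \<Longrightarrow> (LINT x|lebesgue_on (square L). f x * \<phi> x) = 0"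
  shows "AE x in lebesgue_on (square L). f x = 0"
proof (rule AE_zero_if_box_integrals_zero[OF _ square_eq_box])
  show fi: "integrable (lebesgue_on (square L)) f"
    using f by (intro L1_le_L2) auto
  fix a b :: "real^2"
  assume sub: "box a b \<subseteq> square L"
  show "(LINT x|lebesgue_on (square L). f x * indicator (box a b) x) = 0"
  proof (cases "box a b = {}")
    case False
    then obtain y where "y \<in> box a b" by blast
    then have ab: "a $ i < b $ i" for i
      using less_trans[of "a $ i" "y $ i" "b $ i"] by (simp add: mem_box_cart)
    have abL: "- L \<le> a $ i" "b $ i \<le> L" for i
    proof -
      have "cbox a b = closure (box a b)"
        using False by (simp add: closure_box)
      also have "\<dots> \<subseteq> cbox (\<chi> i. - L) (\<chi> i. L)"
        using sub square_subset_cbox by (intro closure_minimal) auto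
      finally have "a \<in> cbox (\<chi> i. - L) (\<chi> i. L)" "b \<in> cbox (\<chi> i. - L) (\<chi> i. L)"
        using ab by (auto simp: mem_box_cart less_imp_le subset_iff)
      then show "- L \<le> a $ i" "b $ i \<le> L"
        by (auto simp: mem_box_cart)
    qed
    \<comment> \<open>Shrinking by a fraction of at most \<open>1 / 2\<close> keeps the smaller boxes nondegenerate.\<close>
    define e where "e n = inverse (real (Suc (Suc n)))" for n
    have e: "0 < e n" "e n \<le> 1 / 2" for n
      by (auto simp: e_def field_simps)
    have elim: "e \<longlonglongrightarrow> 0"
      unfolding e_def using LIMSEQ_Suc[OF LIMSEQ_inverse_real_of_nat] by simp
    define a' b' where "a' n = a + e n *\<^sub>R (b - a)" and "b' n = b - e n *\<^sub>R (b - a)" for n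
    have a'b': "a $ i < a' n $ i" "a' n $ i \<le> b' n $ i" "b' n $ i < b $ i" for n i
    proof -
      have "e n * (b $ i - a $ i) \<le> (1/2) * (b $ i - a $ i)"
        using e[of n] ab[of i] by (intro mult_right_mono) auto
      then show "a' n $ i \<le> b' n $ i"
        by (simp add: a'_def b'_def)
      show "a $ i < a' n $ i" "b' n $ i < b $ i"
        using mult_pos_pos[of "e n" "b $ i - a $ i"] e[of n] ab[of i] by (simp_all add: a'_def b'_def)
    qed
    have lim_a: "(\<lambda>n. a' n $ i) \<longlonglongrightarrow> a $ i" for i
      unfolding a'_def using tendsto_add[OF tendsto_const tendsto_mult[OF elim tendsto_const], of "a $ i" "b $ i - a $ i"] by simp
    have lim_b: "(\<lambda>n. b' n $ i) \<longlonglongrightarrow> b $ i" for i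
      unfolding b'_def using tendsto_diff[OF tendsto_const tendsto_mult[OF elim tendsto_const], of "b $ i" "b $ i - a $ i"] by simp
    define \<phi> where "\<phi> n = box_cutoff bc L (a' n) (b' n) (real n)" for n
    have \<phi>T: "\<phi> n \<in> test_functions bc L" for n
      unfolding \<phi>_def
    proof (rule box_cutoff_test_function[OF L])
      show "- L < a' n $ i \<and> a' n $ i \<le> b' n $ i \<and> b' n $ i < L" for i
        using a'b'[where n=n and i=i] abL[of i] by linarith
    qed simp
    have lim: "(\<lambda>n. \<phi> n x) \<longlonglongrightarrow> indicator (box a b) x" if x: "x \<in> square L" for x
    proof (cases "x \<in> box a b")
      case True
      define q where "q = (box_bump bc L a b x)\<^sup>2"
      have "bump bc L (a $ i) (b $ i) (x $ i) > 0" for i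
        using True abL[of i] by (intro bump_pos) (auto simp: mem_box_cart)
      then have "box_bump bc L a b x > 0"
        by (auto simp: box_bump_def)
      then have q: "q > 0" by (simp add: q_def)
      have "(\<lambda>n. (box_bump bc L (a' n) (b' n) x)\<^sup>2) \<longlonglongrightarrow> q"
        unfolding q_def box_bump_def by (intro tendsto_intros bump_tendsto lim_a lim_b)
      then have "filterlim (\<lambda>n. (box_bump bc L (a' n) (b' n) x)\<^sup>2 * real n) at_top sequentially"
        by (rule filterlim_tendsto_pos_mult_at_top[OF _ q filterlim_real_sequentially])
      then have "filterlim (\<lambda>n. 1 + real n * (box_bump bc L (a' n) (b' n) x)\<^sup>2) at_top sequentially"
        by (intro filterlim_tendsto_add_at_top[OF tendsto_const]) (simp add: mult.commute)
      from tendsto_diff[OF tendsto_const tendsto_inverse_0_at_top[OF this], of 1]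
      show ?thesis
        using True by (simp add: \<phi>_def box_cutoff_def divide_inverse)
    next
      case False
      have "\<phi> n x = 0" for n
      proof -
        obtain i where i: "x $ i \<le> a $ i \<or> b $ i \<le> x $ i"
          using False by (auto simp: mem_box_cart not_less)
        have "bump bc L (a' n $ i) (b' n $ i) (x $ i) = 0"
          using a'b'[where n=n and i=i] abL[of i] i x
          by (intro bump_zero) (auto simp: square_def less_imp_le intro: order_trans le_less_trans less_le_trans)
        then have "box_bump bc L (a' n) (b' n) x = 0"
          using exhaust_2[of i] by (auto simp: box_bump_def)
        then show ?thesis by (simp add: \<phi>_def box_cutoff_def)
      qed
      then show ?thesis using False by simp
    qed
    have "(\<lambda>n. LINT x|lebesgue_on (square L). f x * \<phi> n x) \<longlonglongrightarrow> (LINT x|lebesgue_on (square L). f x * indicator (box a b) x)"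
    proof (rule integral_dominated_convergence[where w = "\<lambda>x. \<bar>f x\<bar>"])
      show "integrable (lebesgue_on (square L)) (\<lambda>x. \<bar>f x\<bar>)"
        using fi by (rule integrable_abs)
      show "AE x in lebesgue_on (square L). (\<lambda>n. f x * \<phi> n x) \<longlonglongrightarrow> f x * indicator (box a b) x"
        by (intro AE_I2 tendsto_intros lim) (simp add: space_restrict_space)
      show "AE x in lebesgue_on (square L). norm (f x * \<phi> n x) \<le> \<bar>f x\<bar>" for n
        using box_cutoff_bounds[of "real n" bc L "a' n" "b' n"]
        by (auto intro!: AE_I2 mult_left_le simp: \<phi>_def abs_mult)
      show "(\<lambda>x. f x * \<phi> n x) \<in> borel_measurable (lebesgue_on (square L))" for n
        by (intro borel_measurable_times L2_space_measurable f test_functions_L2[OF \<phi>T])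
      show "(\<lambda>x. f x * indicator (box a b) x) \<in> borel_measurable (lebesgue_on (square L))"
        by (intro borel_measurable_times L2_space_measurable f borel_measurable_indicator) (auto simp: sets_restrict_space_iff sub)
    qed
    moreover have "(LINT x|lebesgue_on (square L). f x * \<phi> n x) = 0" for n
      by (rule zero[OF \<phi>T])
    ultimately show ?thesis
      by (simp add: LIMSEQ_const_iff)
  qed simp
qed

section \<open>Weak gradients\<close>

lemma square_iff_abs: "x \<in> square L \<longleftrightarrow> (\<forall>i. \<bar>x $ i\<bar> < L)"
proof -
  have "(- L < a \<and> a < L) = (\<bar>a\<bar> < L)" for a by linarith
  then show ?thesis by (simp add: square_def)
qed

lemma cbox_iff_abs:
  fixes R :: real
  shows "x \<in> cbox (\<chi> i. - R) (\<chi> i. R) \<longleftrightarrow> (\<forall>i. \<bar>x $ i\<bar> \<le> R)"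
proof -
  have "(- R \<le> a \<and> a \<le> R) = (\<bar>a\<bar> \<le> R)" for a by linarith
  then show ?thesis by (simp add: mem_box_cart)
qed

lemma norm_sq_vec: "(norm (x :: 'b::euclidean_space^'n))\<^sup>2 = (\<Sum>i\<in>UNIV. (norm (x $ i))\<^sup>2)"
  by (simp add: power2_norm_eq_inner inner_vec_def)

lemma L2_space_vec_nth:
  fixes G :: "'a::euclidean_space \<Rightarrow> 'b::euclidean_space^'n"
  assumes "G \<in> L2_space S"
  shows "(\<lambda>x. G x $ i) \<in> L2_space S"
proof (rule L2_spaceI)
  have G: "G \<in> borel_measurable (lebesgue_on S)"
    using assms by (rule L2_space_measurable)
  have "(\<lambda>y :: 'b^'n. y $ i) \<in> borel_measurable borel"
    by (intro borel_measurable_continuous_onI continuous_intros)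
  from measurable_compose[OF G this] show m: "(\<lambda>x. G x $ i) \<in> borel_measurable (lebesgue_on S)" .
  show "integrable (lebesgue_on S) (\<lambda>x. (norm (G x $ i))\<^sup>2)"
  proof (rule Bochner_Integration.integrable_bound)
    show "integrable (lebesgue_on S) (\<lambda>x. (norm (G x))\<^sup>2)"
      using assms by (simp add: L2_space_def)
    show "AE x in lebesgue_on S. norm ((norm (G x $ i))\<^sup>2) \<le> norm ((norm (G x))\<^sup>2)"
      by (auto intro!: AE_I2 power_mono Finite_Cartesian_Product.norm_nth_le)
  qed (use m in measurable)
qed

lemma L2_space_vecI:
  fixes G :: "'a::euclidean_space \<Rightarrow> 'b::euclidean_space^'n"
  assumes "\<And>i. (\<lambda>x. G x $ i) \<in> L2_space S"
  shows "G \<in> L2_space S"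
proof (rule L2_spaceI)
  have lin: "bounded_linear (axis i :: 'b \<Rightarrow> 'b^'n)" for i
    by (intro linear_conv_bounded_linear[THEN iffD1] linearI) (auto simp: vec_eq_iff axis_def)
  have ax: "(axis i :: 'b \<Rightarrow> 'b^'n) \<in> borel_measurable borel" for i
    using lin by (intro borel_measurable_continuous_onI linear_continuous_on)
  have "(\<lambda>x. \<Sum>i\<in>UNIV. axis i (G x $ i)) \<in> borel_measurable (lebesgue_on S)"
    by (intro borel_measurable_sum measurable_compose[OF L2_space_measurable[OF assms] ax])
  moreover have "(\<lambda>x. \<Sum>i\<in>UNIV. axis i (G x $ i)) = G"
    by (auto simp: fun_eq_iff vec_eq_iff axis_def if_distrib cong: if_cong)
  ultimately show "G \<in> borel_measurable (lebesgue_on S)" by simp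
  show "integrable (lebesgue_on S) (\<lambda>x. (norm (G x))\<^sup>2)"
    unfolding norm_sq_vec using assms
    by (intro Bochner_Integration.integrable_sum) (simp add: L2_space_def)
qed

lemma L2_norm_vec:
  fixes G :: "'a::euclidean_space \<Rightarrow> 'b::euclidean_space^'n"
  assumes "G \<in> L2_space S"
  shows "(L2_norm S G)\<^sup>2 = (\<Sum>i\<in>UNIV. (L2_norm S (\<lambda>x. G x $ i))\<^sup>2)"
proof -
  have "(LINT x|lebesgue_on S. (norm (G x))\<^sup>2) = (\<Sum>i\<in>UNIV. LINT x|lebesgue_on S. (norm (G x $ i))\<^sup>2)"
    unfolding norm_sq_vec using L2_space_vec_nth[OF assms]
    by (intro Bochner_Integration.integral_sum) (simp add: L2_space_def)
  then show ?thesis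
    by (simp add: L2_norm_def sum_nonneg)
qed

lemma L2_norm_cong_AE:
  assumes "AE x in lebesgue_on S. f x = g x" "f \<in> L2_space S" "g \<in> L2_space S"
  shows "L2_norm S f = L2_norm S g"
proof -
  have [measurable]: "f \<in> borel_measurable (lebesgue_on S)" "g \<in> borel_measurable (lebesgue_on S)"
    using assms(2,3) by (simp_all add: L2_space_def)
  have "(LINT x|lebesgue_on S. (norm (f x))\<^sup>2) = (LINT x|lebesgue_on S. (norm (g x))\<^sup>2)"
  proof (rule integral_cong_AE)
    show "AE x in lebesgue_on S. (norm (f x))\<^sup>2 = (norm (g x))\<^sup>2"
      using assms(1) by eventually_elim simp
  qed measurable
  then show ?thesis by (simp add: L2_norm_def)
qed

lemma L2_integrable_square:
  fixes f :: "real^2 \<Rightarrow> real"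
  shows "f \<in> L2_space (square L) \<Longrightarrow> integrable (lebesgue_on (square L)) f"
  using L1_le_L2(1)[OF square_lmeasurable] by blast

lemma L2_inner_Cauchy_Schwarz:
  assumes "S \<in> sets lebesgue" "f \<in> L2_space S" "g \<in> L2_space S"
  shows "\<bar>LINT x|lebesgue_on S. f x * g x\<bar> \<le> L2_norm S f * L2_norm S g"
  using Cauchy_Schwarz_ineq2[of "emb S f" "emb S g"] assms by (simp add: inner_emb norm_emb)

lemma weak_grad_unique:
  assumes L: "L > 0" and G: "is_weak_grad bc L u G" "is_weak_grad bc L u H"
  shows "AE x in lebesgue_on (square L). G x = H x"
proof -
  have comp: "AE x in lebesgue_on (square L). G x $ i = H x $ i" for i
  proof -
    have L2: "(\<lambda>x. G x $ i) \<in> L2_space (square L)" "(\<lambda>x. H x $ i) \<in> L2_space (square L)"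
      using G by (auto simp: is_weak_grad_def intro: L2_space_vec_nth)
    have "AE x in lebesgue_on (square L). G x $ i - H x $ i = 0"
    proof (rule fundamental_lemma[OF L L2_space_diff[OF L2], of bc])
      fix \<phi> assume \<phi>: "\<phi> \<in> test_functions bc L"
      have "(LINT x|lebesgue_on (square L). (G x $ i - H x $ i) * \<phi> x) =
          (LINT x|lebesgue_on (square L). G x $ i * \<phi> x) - (LINT x|lebesgue_on (square L). H x $ i * \<phi> x)"
        using L2[THEN L2_space_integrable_mult, OF test_functions_L2[OF \<phi>]]
        by (simp add: left_diff_distrib)
      then show "(LINT x|lebesgue_on (square L). (G x $ i - H x $ i) * \<phi> x) = 0"
        using G \<phi> by (simp add: is_weak_grad_def)
    qed
    then show ?thesis by eventually_elim simp
  qed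
  from comp[of 1] comp[of 2] show ?thesis
    by eventually_elim (auto simp: vec_eq_iff forall_2)
qed

lemma weak_grad_works:
  assumes "u \<in> H1_space bc L"
  shows "is_weak_grad bc L u (weak_grad bc L u)"
  using assms someI_ex[of "is_weak_grad bc L u"] by (auto simp: H1_space_def weak_grad_def)

lemma weak_grad_AE_eq:
  assumes "L > 0" "u \<in> L2_space (square L)" "is_weak_grad bc L u G"
  shows "u \<in> H1_space bc L" "AE x in lebesgue_on (square L). weak_grad bc L u x = G x"
proof -
  show u: "u \<in> H1_space bc L"
    using assms by (auto simp: H1_space_def)
  show "AE x in lebesgue_on (square L). weak_grad bc L u x = G x"
    by (rule weak_grad_unique[OF assms(1) weak_grad_works[OF u] assms(3)])
qed

lemma energy_pos_eq:
  assumes "L > 0" "\<gamma> > 0" "u \<in> L2_space (square L)" and G: "is_weak_grad bc L u G"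
  shows "energy \<gamma> bc L u = ereal (LINT x|lebesgue_on (square L). \<gamma> / 2 * (norm (G x))\<^sup>2 + \<bar>G x $ 1\<bar> + \<bar>G x $ 2\<bar>)"
proof -
  note eq = weak_grad_AE_eq[OF assms(1,3,4)]
  have m: "(\<lambda>x. \<gamma> / 2 * (norm (H x))\<^sup>2 + \<bar>H x $ 1\<bar> + \<bar>H x $ 2\<bar>) \<in> borel_measurable (lebesgue_on (square L))"
    if H: "is_weak_grad bc L u H" for H
  proof -
    have H2: "H \<in> L2_space (square L)" using H by (simp add: is_weak_grad_def)
    have [measurable]: "H \<in> borel_measurable (lebesgue_on (square L))" "(\<lambda>x. H x $ i) \<in> borel_measurable (lebesgue_on (square L))" for i
      by (intro L2_space_measurable H2 L2_space_vec_nth[OF H2])+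
    show ?thesis by measurable
  qed
  have "(LINT x|lebesgue_on (square L). \<gamma> / 2 * (norm (weak_grad bc L u x))\<^sup>2 + \<bar>weak_grad bc L u x $ 1\<bar> + \<bar>weak_grad bc L u x $ 2\<bar>)
      = (LINT x|lebesgue_on (square L). \<gamma> / 2 * (norm (G x))\<^sup>2 + \<bar>G x $ 1\<bar> + \<bar>G x $ 2\<bar>)"
  proof (rule integral_cong_AE)
    show "AE x in lebesgue_on (square L). \<gamma> / 2 * (norm (weak_grad bc L u x))\<^sup>2 + \<bar>weak_grad bc L u x $ 1\<bar> + \<bar>weak_grad bc L u x $ 2\<bar> =
        \<gamma> / 2 * (norm (G x))\<^sup>2 + \<bar>G x $ 1\<bar> + \<bar>G x $ 2\<bar>"
      using eq(2) by eventually_elim simp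
  qed (rule m[OF weak_grad_works[OF eq(1)]] m[OF G])+
  with eq(1) assms(2) show ?thesis by (simp add: energy_def)
qed

section \<open>Translating test functions\<close>

lemma C1_partial_bounded:
  assumes "C1_fun \<phi>"
  obtains M where "M \<ge> 0" "\<And>x. (\<And>i. \<bar>x $ i\<bar> \<le> R) \<Longrightarrow> \<bar>partial_deriv j \<phi> x\<bar> \<le> M"
proof -
  have "compact (partial_deriv j \<phi> ` cbox (\<chi> i. - R) (\<chi> i. R))"
    by (intro compact_continuous_image continuous_on_subset[OF C1_fun_continuous_partial[OF assms]]) auto
  then obtain B where B: "\<And>x. x \<in> cbox (\<chi> i. - R) (\<chi> i. R) \<Longrightarrow> \<bar>partial_deriv j \<phi> x\<bar> \<le> B"
    unfolding compact_eq_bounded_closed bounded_real by blast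
  show thesis
  proof (rule that[of "\<bar>B\<bar>"])
    fix x :: "real^2" assume "\<And>i. \<bar>x $ i\<bar> \<le> R"
    then have "x \<in> cbox (\<chi> i. - R) (\<chi> i. R)"
      by (simp add: cbox_iff_abs)
    from B[OF this] show "\<bar>partial_deriv j \<phi> x\<bar> \<le> \<bar>B\<bar>" by simp
  qed simp
qed

lemma C1_line_lipschitz:
  assumes \<phi>: "C1_fun \<phi>" and M: "\<And>\<tau>. \<tau> \<in> {a..b} \<Longrightarrow> \<bar>partial_deriv j \<phi> (coord_affine j 1 \<tau> x)\<bar> \<le> M"
    and st: "s \<in> {a..b}" "t \<in> {a..b}"
  shows "\<bar>\<phi> (coord_affine j 1 s x) - \<phi> (coord_affine j 1 t x)\<bar> \<le> M * \<bar>s - t\<bar>"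
  using field_differentiable_bound[of "{a..b}" "\<lambda>s. \<phi> (coord_affine j 1 s x)" _ M s t,
      OF _ has_field_derivative_at_within[OF C1_fun_line_derivative[OF \<phi>]]] M st
  by simp

text \<open>Only points at bounded distance from the square matter, and there the partial derivative of \<open>\<phi>\<close> is
  bounded; this gives the majorant for dominated convergence.\<close>

lemma translated_integral_derivative:
  assumes L: "L > 0" and g: "g \<in> L2_space (square L)" and \<phi>: "C1_fun \<phi>"
  shows "((\<lambda>s. LINT x|lebesgue_on (square L). g x * \<phi> (coord_affine j 1 s x)) has_real_derivative
    (LINT x|lebesgue_on (square L). g x * partial_deriv j \<phi> (coord_affine j 1 s x))) (at s)"
proof -
  let ?M = "lebesgue_on (square L)"
  define F where "F s = (LINT x|?M. g x * \<phi> (coord_affine j 1 s x))" for s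
  have gi: "integrable ?M (\<lambda>x. g x * \<psi> x)" if "continuous_on UNIV \<psi>" for \<psi>
    by (intro L2_space_integrable_mult g continuous_L2_square that)
  have c\<phi>: "continuous_on UNIV (\<lambda>x. \<phi> (coord_affine j 1 s x))" for s
    by (rule C1_fun_continuous[OF C1_fun_coord_affine(1)[OF \<phi>]])
  have "((\<lambda>h. (F (s + h) - F s) / h) \<longlongrightarrow> (LINT x|?M. g x * partial_deriv j \<phi> (coord_affine j 1 s x))) (at 0)"
    unfolding tendsto_at_iff_sequentially comp_def
  proof (intro allI impI)
    fix X :: "nat \<Rightarrow> real"
    assume X: "\<forall>i. X i \<in> UNIV - {0}" "X \<longlonglongrightarrow> 0"
    obtain R where R: "\<And>n. \<bar>X n\<bar> \<le> R"
      using convergent_imp_Bseq[OF convergentI[OF X(2)]] by (auto simp: Bseq_def)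
    obtain M where M: "M \<ge> 0" "\<And>x. (\<And>i. \<bar>x $ i\<bar> \<le> L + \<bar>s\<bar> + R) \<Longrightarrow> \<bar>partial_deriv j \<phi> x\<bar> \<le> M"
      using C1_partial_bounded[OF \<phi>] by blast
    have lip: "\<bar>\<phi> (coord_affine j 1 (s + X n) x) - \<phi> (coord_affine j 1 s x)\<bar> \<le> M * \<bar>X n\<bar>" if x: "x \<in> square L" for x n
    proof -
      have "\<bar>\<phi> (coord_affine j 1 (s + X n) x) - \<phi> (coord_affine j 1 s x)\<bar> \<le> M * \<bar>s + X n - s\<bar>"
      proof (rule C1_line_lipschitz[OF \<phi>, where a = "s - R" and b = "s + R"])
        fix \<tau> assume \<tau>: "\<tau> \<in> {s - R..s + R}"
        show "\<bar>partial_deriv j \<phi> (coord_affine j 1 \<tau> x)\<bar> \<le> M"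
        proof (rule M(2))
          fix i
          have "\<bar>x $ i\<bar> \<le> L" "\<bar>x $ j\<bar> \<le> L"
            using x by (auto simp: square_iff_abs less_imp_le)
          then show "\<bar>coord_affine j 1 \<tau> x $ i\<bar> \<le> L + \<bar>s\<bar> + R"
            using \<tau> by (auto simp: coord_affine_nth)
        qed
      qed (use R[of n] in auto)
      then show ?thesis by simp
    qed
    have "(\<lambda>n. LINT x|?M. g x * ((\<phi> (coord_affine j 1 (s + X n) x) - \<phi> (coord_affine j 1 s x)) / X n))
      \<longlonglongrightarrow> (LINT x|?M. g x * partial_deriv j \<phi> (coord_affine j 1 s x))"
    proof (rule integral_dominated_convergence[where w = "\<lambda>x. \<bar>g x\<bar> * M"])
      show "(\<lambda>x. g x * partial_deriv j \<phi> (coord_affine j 1 s x)) \<in> borel_measurable ?M"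
        using C1_fun_continuous_partial[OF C1_fun_coord_affine(1)[OF \<phi>, of j 1 s], of j]
        by (intro borel_measurable_integrable gi) (simp add: C1_fun_coord_affine(2)[OF \<phi>])
      show "(\<lambda>x. g x * ((\<phi> (coord_affine j 1 (s + X n) x) - \<phi> (coord_affine j 1 s x)) / X n)) \<in> borel_measurable ?M" for n
        using X(1) by (intro borel_measurable_integrable gi continuous_intros c\<phi>) auto
      show "integrable ?M (\<lambda>x. \<bar>g x\<bar> * M)"
        by (intro integrable_mult_left integrable_abs L2_integrable_square g)
      show "AE x in ?M. (\<lambda>n. g x * ((\<phi> (coord_affine j 1 (s + X n) x) - \<phi> (coord_affine j 1 s x)) / X n))
          \<longlonglongrightarrow> g x * partial_deriv j \<phi> (coord_affine j 1 s x)"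
      proof (intro AE_I2 tendsto_intros)
        fix x
        have "((\<lambda>h. (\<phi> (coord_affine j 1 (s + h) x) - \<phi> (coord_affine j 1 s x)) / h) \<longlongrightarrow> partial_deriv j \<phi> (coord_affine j 1 s x)) (at 0)"
          using C1_fun_line_derivative[OF \<phi>, of j x s] by (simp add: DERIV_def)
        then show "(\<lambda>n. (\<phi> (coord_affine j 1 (s + X n) x) - \<phi> (coord_affine j 1 s x)) / X n) \<longlonglongrightarrow> partial_deriv j \<phi> (coord_affine j 1 s x)"
          using X unfolding tendsto_at_iff_sequentially comp_def by blast
      qed
      show "AE x in ?M. norm (g x * ((\<phi> (coord_affine j 1 (s + X n) x) - \<phi> (coord_affine j 1 s x)) / X n)) \<le> \<bar>g x\<bar> * M" for n
      proof (rule AE_I2)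
        fix x assume "x \<in> space ?M"
        then have "x \<in> square L" by (simp add: space_restrict_space)
        from lip[OF this, of n] have "\<bar>(\<phi> (coord_affine j 1 (s + X n) x) - \<phi> (coord_affine j 1 s x)) / X n\<bar> \<le> M"
          using X(1) by (simp add: abs_divide pos_divide_le_eq)
        then show "norm (g x * ((\<phi> (coord_affine j 1 (s + X n) x) - \<phi> (coord_affine j 1 s x)) / X n)) \<le> \<bar>g x\<bar> * M"
          by (simp only: real_norm_def abs_mult) (intro mult_left_mono, auto)
      qed
    qed
    moreover have "(LINT x|?M. g x * ((\<phi> (coord_affine j 1 (s + X n) x) - \<phi> (coord_affine j 1 s x)) / X n)) = (F (s + X n) - F s) / X n" for n
    proof -
      have "(LINT x|?M. g x * ((\<phi> (coord_affine j 1 (s + X n) x) - \<phi> (coord_affine j 1 s x)) / X n))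
        = (LINT x|?M. (g x * \<phi> (coord_affine j 1 (s + X n) x) - g x * \<phi> (coord_affine j 1 s x)) / X n)"
        by (simp add: right_diff_distrib)
      also have "\<dots> = (F (s + X n) - F s) / X n"
        unfolding F_def using gi[OF c\<phi>] by simp
      finally show ?thesis .
    qed
    ultimately show "(\<lambda>n. (F (s + X n) - F s) / X n) \<longlonglongrightarrow> (LINT x|?M. g x * partial_deriv j \<phi> (coord_affine j 1 s x))"
      by (simp only:)
  qed
  then show ?thesis by (simp add: DERIV_def F_def)
qed

section \<open>Test functions up to the boundary in the Neumann case\<close>

text \<open>A continuously differentiable step from \<open>0\<close> to \<open>1\<close>, constant outside \<open>[1, 2]\<close>.\<close>

definition ramp :: "real \<Rightarrow> real" where
  "ramp y = (max 0 (1 - (max 0 (2 - y))\<^sup>2))\<^sup>2"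

definition ramp' :: "real \<Rightarrow> real" where
  "ramp' y = 4 * max 0 (1 - (max 0 (2 - y))\<^sup>2) * max 0 (2 - y)"

lemma ramp_derivative: "(ramp has_real_derivative ramp' y) (at y)"
proof -
  have "((\<lambda>y. 2 - y) has_real_derivative -1) (at y)"
    by (auto intro!: derivative_eq_intros)
  from DERIV_diff[OF DERIV_const DERIV_chain2[OF has_derivative_max_zero_sq this], of 1]
  have "((\<lambda>y. 1 - (max 0 (2 - y))\<^sup>2) has_real_derivative 2 * max 0 (2 - y)) (at y)"
    by simp
  from DERIV_chain2[OF has_derivative_max_zero_sq this] show ?thesis
    by (simp add: ramp_def[abs_def] ramp'_def mult.assoc)
qed

lemma continuous_ramp': "continuous_on UNIV ramp'"
  unfolding ramp'_def by (intro continuous_intros)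

lemma ramp_eq_1: "y \<ge> 2 \<Longrightarrow> ramp y = 1" and ramp'_eq_0: "y \<ge> 2 \<Longrightarrow> ramp' y = 0"
  by (simp_all add: ramp_def ramp'_def max_def)

lemma ramp_eq_0: "y \<le> 1 \<Longrightarrow> ramp y = 0" and ramp'_eq_0': "y \<le> 1 \<Longrightarrow> ramp' y = 0"
proof -
  assume "y \<le> 1"
  then have "1 \<le> (max 0 (2 - y))\<^sup>2"
    by (intro one_le_power) simp
  then show "ramp y = 0" "ramp' y = 0"
    by (simp_all add: ramp_def ramp'_def max_def)
qed

lemma ramp_bounds: "0 \<le> ramp y" "ramp y \<le> 1"
proof -
  have "max 0 (1 - (max 0 (2 - y))\<^sup>2) \<le> 1" by simp
  then show "ramp y \<le> 1"
    unfolding ramp_def by (intro power_le_one) auto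
qed (simp add: ramp_def)

lemma ramp'_bound: "0 \<le> y * ramp' y \<and> y * ramp' y \<le> 8" if "0 \<le> y"
proof (cases "1 \<le> y \<and> y \<le> 2")
  case True
  have a: "max 0 (1 - (max 0 (2 - y))\<^sup>2) * max 0 (2 - y) \<le> 1 * 1"
    using True by (intro mult_mono) auto
  have "y * (4 * (max 0 (1 - (max 0 (2 - y))\<^sup>2) * max 0 (2 - y))) \<le> 2 * (4 * 1)"
    using True a by (intro mult_mono) auto
  then show ?thesis
    using True by (simp add: ramp'_def mult.assoc)
next
  case False
  then have "ramp' y = 0"
    using ramp'_eq_0[of y] ramp'_eq_0'[of y] by linarith
  then show ?thesis by simp
qed

text \<open>A weak gradient in the Neumann case is tested with functions of compact support in the open square.
  The formula extends to a function \<open>\<psi>\<close> that lives up to the two faces \<open>x\<^sub>j = L\<close> and \<open>x\<^sub>j = - L\<close>, after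
  multiplication by a cutoff in the variable \<open>x\<^sub>j\<close>. The derivative of the cutoff enters only for \<open>i = j\<close>.
  It has the size of the inverse distance to the faces, but then \<open>\<psi>\<close> vanishes on the faces, so the
  product stays bounded and tends to \<open>0\<close> pointwise.\<close>

lemma neumann_test_extension:
  assumes L: "L > 0" and u: "u \<in> L2_space (square L)" and G: "is_weak_grad Neumann L u G"
    and \<psi>: "C1_fun \<psi>" and d: "d > 0" "\<And>x k. \<psi> x \<noteq> 0 \<Longrightarrow> k \<noteq> j \<Longrightarrow> \<bar>x $ k\<bar> \<le> L - d"
    and bdry: "i = j \<Longrightarrow> (\<And>x. \<bar>x $ j\<bar> = L \<Longrightarrow> \<psi> x = 0)"
  shows "(LINT x|lebesgue_on (square L). u x * partial_deriv i \<psi> x) = - (LINT x|lebesgue_on (square L). G x $ i * \<psi> x)"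
proof -
  let ?M = "lebesgue_on (square L)"
  define y where "y n t = real (Suc n) * (L\<^sup>2 - t\<^sup>2)" for n t
  define \<chi>' where "\<chi>' n t = ramp' (y n t) * (real (Suc n) * (- (2 * t)))" for n t
  define \<phi> where "\<phi> n x = ramp (y n (x $ j)) * \<psi> x" for n x
  have d\<chi>: "((\<lambda>t. ramp (y n t)) has_real_derivative \<chi>' n t) (at t)" for n t
  proof -
    have "(y n has_real_derivative real (Suc n) * (- (2 * t))) (at t)"
      unfolding y_def by (rule derivative_eq_intros refl)+ simp
    from DERIV_chain2[OF ramp_derivative this] show ?thesis by (simp add: \<chi>'_def)
  qed
  have c\<chi>': "continuous_on UNIV (\<chi>' n)" for n
    unfolding \<chi>'_def y_def by (intro continuous_intros continuous_on_compose2[OF continuous_ramp'] subset_UNIV)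
  have \<chi>1: "C1_fun (\<lambda>x. ramp (y n (x $ j)))" for n
    by (rule C1_fun_coord_compose(1)[OF d\<chi> c\<chi>'])
  have C1: "C1_fun (\<phi> n)" for n
    unfolding \<phi>_def by (intro C1_fun_mult \<chi>1 \<psi>)
  have pd: "partial_deriv i (\<phi> n) = (\<lambda>x. ramp (y n (x $ j)) * partial_deriv i \<psi> x + (if i = j then \<chi>' n (x $ j) * \<psi> x else 0))" for n
    unfolding \<phi>_def C1_fun_mult(2)[OF \<chi>1 \<psi>] C1_fun_coord_compose(2)[OF d\<chi> c\<chi>'] by auto
  have T: "\<phi> n \<in> test_functions Neumann L" for n
  proof -
    \<comment> \<open>A compact subset of the square on which the truncated function lives.\<close>
    define C where "C = {x :: real^2. (x $ j)\<^sup>2 \<le> L\<^sup>2 - 1 / real (Suc n) \<and> (\<forall>k. k \<noteq> j \<longrightarrow> \<bar>x $ k\<bar> \<le> L - d)}"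
    have Csub: "C \<subseteq> square L"
    proof
      fix x assume x: "x \<in> C"
      have "\<bar>x $ k\<bar> < L" for k
      proof (cases "k = j")
        case True
        have "(x $ j)\<^sup>2 < L\<^sup>2" using x by (auto simp: C_def intro: le_less_trans)
        then show ?thesis using True L power2_less_imp_less[of "\<bar>x $ j\<bar>" L] by simp
      next
        case False
        then show ?thesis using x d(1) by (auto simp: C_def intro: le_less_trans)
      qed
      then show "x \<in> square L" by (simp add: square_iff_abs)
    qed
    have "closed C"
      unfolding C_def by (intro closed_Collect_conj closed_Collect_all closed_Collect_imp open_Collect_const closed_Collect_le continuous_intros)
    moreover have "bounded C"
      by (rule bounded_subset[OF bounded_cbox subset_trans[OF Csub square_subset_cbox]])
    ultimately have C: "compact C" "closed C" by (simp_all add: compact_eq_bounded_closed)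
    have "{x. \<phi> n x \<noteq> 0} \<subseteq> C"
    proof
      fix x assume "x \<in> {x. \<phi> n x \<noteq> 0}"
      then have "\<psi> x \<noteq> 0" "ramp (y n (x $ j)) \<noteq> 0" by (auto simp: \<phi>_def)
      then have "\<not> y n (x $ j) \<le> 1" using ramp_eq_0 by blast
      then have "(x $ j)\<^sup>2 \<le> L\<^sup>2 - 1 / real (Suc n)"
        by (simp add: y_def field_simps del: of_nat_Suc)
      then show "x \<in> C" using d(2)[OF \<open>\<psi> x \<noteq> 0\<close>] by (simp add: C_def)
    qed
    then have sub: "closure {x. \<phi> n x \<noteq> 0} \<subseteq> C"
      using C(2) by (rule closure_minimal)
    then have "compact (closure {x. \<phi> n x \<noteq> 0})"
      using compact_Int_closed[OF C(1) closed_closure] by (metis Int_absorb1)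
    with C1 subset_trans[OF sub Csub] show ?thesis by (simp add: test_functions_def)
  qed
  have ev: "\<forall>\<^sub>F n in sequentially. y n (x $ j) \<ge> 2" if x: "x \<in> square L" for x
  proof -
    have "(x $ j)\<^sup>2 < L\<^sup>2"
      using x L by (intro power_strict_mono[of "\<bar>x $ j\<bar>" L 2, simplified]) (simp add: square_iff_abs)
    then have pos: "L\<^sup>2 - (x $ j)\<^sup>2 > 0" by simp
    obtain N where "2 / (L\<^sup>2 - (x $ j)\<^sup>2) < real N"
      using reals_Archimedean2 by blast
    then have N: "2 < real N * (L\<^sup>2 - (x $ j)\<^sup>2)"
      using pos by (simp add: pos_divide_less_eq)
    show ?thesis
    proof (rule eventually_sequentiallyI)
      fix n assume "N \<le> n"
      then have "real N * (L\<^sup>2 - (x $ j)\<^sup>2) \<le> real (Suc n) * (L\<^sup>2 - (x $ j)\<^sup>2)"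
        using pos by (intro mult_right_mono) auto
      with N show "y n (x $ j) \<ge> 2" by (simp add: y_def del: of_nat_Suc)
    qed
  qed
  have sp: "x \<in> square L" if "x \<in> space ?M" for x
    using that by (simp add: space_restrict_space)
  have absL: "\<bar>x $ k\<bar> < L" if "x \<in> square L" for x k
    using that by (simp add: square_iff_abs)
  have "(\<lambda>n. LINT x|?M. G x $ i * \<phi> n x) \<longlonglongrightarrow> (LINT x|?M. G x $ i * \<psi> x)"
  proof (rule integral_dominated_convergence[where w = "\<lambda>x. \<bar>G x $ i * \<psi> x\<bar>"])
    have G2: "(\<lambda>x. G x $ i) \<in> L2_space (square L)"
      using G by (auto simp: is_weak_grad_def intro: L2_space_vec_nth)
    note int = L2_space_integrable_mult[OF G2 continuous_L2_square[OF C1_fun_continuous]]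
    show "integrable ?M (\<lambda>x. \<bar>G x $ i * \<psi> x\<bar>)"
      by (intro integrable_abs int \<psi>)
    show "(\<lambda>x. G x $ i * \<psi> x) \<in> borel_measurable ?M" "(\<lambda>x. G x $ i * \<phi> n x) \<in> borel_measurable ?M" for n
      by (intro borel_measurable_integrable int \<psi> C1)+
    show "AE x in ?M. (\<lambda>n. G x $ i * \<phi> n x) \<longlonglongrightarrow> G x $ i * \<psi> x"
    proof (rule AE_I2)
      fix x assume x: "x \<in> space ?M"
      show "(\<lambda>n. G x $ i * \<phi> n x) \<longlonglongrightarrow> G x $ i * \<psi> x"
        by (rule tendsto_eventually, rule eventually_mono[OF ev[OF sp[OF x]]]) (simp add: \<phi>_def ramp_eq_1)
    qed
    show "AE x in ?M. norm (G x $ i * \<phi> n x) \<le> \<bar>G x $ i * \<psi> x\<bar>" for n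
    proof (rule AE_I2)
      fix x
      have "\<bar>\<phi> n x\<bar> \<le> \<bar>\<psi> x\<bar>"
        using ramp_bounds[of "y n (x $ j)"] by (simp add: \<phi>_def abs_mult mult_left_le_one_le)
      then show "norm (G x $ i * \<phi> n x) \<le> \<bar>G x $ i * \<psi> x\<bar>"
        by (simp add: abs_mult mult_left_mono)
    qed
  qed
  moreover have "(\<lambda>n. LINT x|?M. u x * partial_deriv i (\<phi> n) x) \<longlonglongrightarrow> (LINT x|?M. u x * partial_deriv i \<psi> x)"
  proof -
    obtain M where M: "M \<ge> 0" "\<And>x. (\<And>i. \<bar>x $ i\<bar> \<le> 2 * L) \<Longrightarrow> \<bar>partial_deriv j \<psi> x\<bar> \<le> M"
      using C1_partial_bounded[OF \<psi>] by blast
    \<comment> \<open>Integrate the derivative from the nearest point of the two faces, where \<open>\<psi>\<close> vanishes.\<close>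
    have lip: "\<bar>\<psi> x\<bar> \<le> M * (L - \<bar>x $ j\<bar>)" if x: "x \<in> square L" and ij: "i = j" for x
    proof -
      define t where "t = (if x $ j \<ge> 0 then L - x $ j else - L - x $ j)"
      note ax = absL[OF x]
      have at: "\<bar>t\<bar> = L - \<bar>x $ j\<bar>" "\<bar>t\<bar> \<le> L" using ax[of j] by (auto simp: t_def)
      have "\<bar>\<psi> (coord_affine j 1 0 x) - \<psi> (coord_affine j 1 t x)\<bar> \<le> M * \<bar>0 - t\<bar>"
      proof (rule C1_line_lipschitz[OF \<psi>, where a = "- L" and b = L])
        fix \<tau> assume \<tau>: "\<tau> \<in> {- L..L}"
        show "\<bar>partial_deriv j \<psi> (coord_affine j 1 \<tau> x)\<bar> \<le> M"
        proof (rule M(2))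
          fix k
          show "\<bar>coord_affine j 1 \<tau> x $ k\<bar> \<le> 2 * L"
            using ax[of k] ax[of j] \<tau> by (auto simp: coord_affine_nth)
        qed
      qed (use at L in auto)
      moreover have "\<psi> (coord_affine j 1 t x) = 0"
        using ij L by (intro bdry) (auto simp: coord_affine_nth t_def)
      moreover have "coord_affine j 1 0 x = x"
        by (simp add: vec_eq_iff coord_affine_nth)
      ultimately show ?thesis using at by simp
    qed
    have bound: "\<bar>\<chi>' n (x $ j) * \<psi> x\<bar> \<le> 16 * M" if x: "x \<in> square L" and ij: "i = j" for x n
    proof -
      define t where "t = x $ j"
      have t: "\<bar>t\<bar> < L" using absL[OF x] by (simp add: t_def)
      have sq: "L * (L - \<bar>t\<bar>) \<le> L\<^sup>2 - t\<^sup>2"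
      proof -
        have "L\<^sup>2 - t\<^sup>2 = (L + \<bar>t\<bar>) * (L - \<bar>t\<bar>)"
          by (simp add: algebra_simps power2_eq_square)
        moreover have "L * (L - \<bar>t\<bar>) \<le> (L + \<bar>t\<bar>) * (L - \<bar>t\<bar>)"
          using t by (intro mult_right_mono) auto
        ultimately show ?thesis by simp
      qed
      have "0 \<le> L * (L - \<bar>t\<bar>)"
        using t L by simp
      then have yp: "0 \<le> y n t"
        unfolding y_def using sq by (intro mult_nonneg_nonneg) auto
      have r: "ramp' (y n t) \<ge> 0" by (simp add: ramp'_def)
      have "\<bar>\<chi>' n t * \<psi> x\<bar> = ramp' (y n t) * real (Suc n) * 2 * \<bar>t\<bar> * \<bar>\<psi> x\<bar>"
        using r by (simp add: \<chi>'_def abs_mult del: of_nat_Suc)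
      also have "\<dots> \<le> ramp' (y n t) * real (Suc n) * 2 * L * (M * (L - \<bar>t\<bar>))"
        using r t lip[OF x ij] L M(1) by (intro mult_mono) (auto simp: t_def)
      also have "\<dots> = 2 * M * (ramp' (y n t) * (real (Suc n) * (L * (L - \<bar>t\<bar>))))"
        by (simp only: mult_ac)
      also have "\<dots> \<le> 2 * M * (ramp' (y n t) * y n t)"
        unfolding y_def[of n t] using r M(1) sq by (intro mult_left_mono) (auto simp: y_def)
      also have "\<dots> \<le> 2 * M * 8"
        using ramp'_bound[OF yp] M(1) by (intro mult_left_mono) (auto simp: mult.commute)
      finally show ?thesis by (simp add: t_def)
    qed
    note int = L2_space_integrable_mult[OF u partial_deriv_L2]
    show ?thesis
    proof (rule integral_dominated_convergence[where w = "\<lambda>x. \<bar>u x * partial_deriv i \<psi> x\<bar> + \<bar>u x\<bar> * (16 * M)"])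
      show "integrable ?M (\<lambda>x. \<bar>u x * partial_deriv i \<psi> x\<bar> + \<bar>u x\<bar> * (16 * M))"
        by (intro Bochner_Integration.integrable_add integrable_mult_left integrable_abs int \<psi> L2_integrable_square u)
      show "(\<lambda>x. u x * partial_deriv i \<psi> x) \<in> borel_measurable ?M" "(\<lambda>x. u x * partial_deriv i (\<phi> n) x) \<in> borel_measurable ?M" for n
        by (intro borel_measurable_integrable int \<psi> C1)+
      show "AE x in ?M. (\<lambda>n. u x * partial_deriv i (\<phi> n) x) \<longlonglongrightarrow> u x * partial_deriv i \<psi> x"
      proof (rule AE_I2)
        fix x assume x: "x \<in> space ?M"
        show "(\<lambda>n. u x * partial_deriv i (\<phi> n) x) \<longlonglongrightarrow> u x * partial_deriv i \<psi> x"
          by (rule tendsto_eventually, rule eventually_mono[OF ev[OF sp[OF x]]])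
            (simp add: pd ramp_eq_1 ramp'_eq_0 \<chi>'_def)
      qed
      show "AE x in ?M. norm (u x * partial_deriv i (\<phi> n) x) \<le> \<bar>u x * partial_deriv i \<psi> x\<bar> + \<bar>u x\<bar> * (16 * M)" for n
      proof (rule AE_I2)
        fix x assume x: "x \<in> space ?M"
        have "\<bar>ramp (y n (x $ j)) * partial_deriv i \<psi> x\<bar> \<le> \<bar>partial_deriv i \<psi> x\<bar>"
          using ramp_bounds[of "y n (x $ j)"] by (simp add: abs_mult mult_left_le_one_le)
        moreover have "\<bar>if i = j then \<chi>' n (x $ j) * \<psi> x else 0\<bar> \<le> 16 * M"
          using bound[OF sp[OF x]] M(1) by auto
        ultimately have "\<bar>partial_deriv i (\<phi> n) x\<bar> \<le> \<bar>partial_deriv i \<psi> x\<bar> + 16 * M"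
          unfolding pd by linarith
        from mult_left_mono[OF this, of "\<bar>u x\<bar>"] show "norm (u x * partial_deriv i (\<phi> n) x) \<le> \<bar>u x * partial_deriv i \<psi> x\<bar> + \<bar>u x\<bar> * (16 * M)"
          by (simp add: abs_mult distrib_left)
      qed
    qed
  qed
  moreover have "(LINT x|?M. u x * partial_deriv i (\<phi> n) x) = - (LINT x|?M. G x $ i * \<phi> n x)" for n
    using G T by (simp add: is_weak_grad_def)
  ultimately show ?thesis
    by (intro LIMSEQ_unique[of "\<lambda>n. - (LINT x|?M. G x $ i * \<phi> n x)"] tendsto_minus) (simp_all only:)
qed

section \<open>Reflected and periodic translations\<close>

lemma coord_affine_measure_preserving:
  assumes "\<epsilon> = 1 \<or> \<epsilon> = -1"
  shows "coord_affine j \<epsilon> c \<in> lebesgue \<rightarrow>\<^sub>M lebesgue"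
    and "distr lebesgue lebesgue (coord_affine j \<epsilon> c) = lebesgue"
proof -
  define k where "k b = (if b = axis j (1::real) then \<epsilon> else 1)" for b :: "real^2"
  have k: "\<And>b. b \<in> Basis \<Longrightarrow> k b \<noteq> 0" "(\<Prod>b\<in>Basis. \<bar>k b\<bar>) = 1"
    using assms by (auto simp: k_def intro!: prod.neutral)
  have axis_nth_if: "axis j c $ i = (if i = j then c else 0)" for i
    by (simp add: axis_def)
  have eq: "coord_affine j \<epsilon> c = (\<lambda>x. axis j c + (\<Sum>b\<in>Basis. (k b * (x \<bullet> b)) *\<^sub>R b))"
  proof
    fix x
    show "coord_affine j \<epsilon> c x = axis j c + (\<Sum>b\<in>Basis. (k b * (x \<bullet> b)) *\<^sub>R b)"
    proof (rule euclidean_eqI)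
      fix b :: "real^2" assume b: "b \<in> Basis"
      then obtain i where i: "b = axis i 1"
        by (auto simp: Basis_vec_def)
      have "(axis j c + (\<Sum>b\<in>Basis. (k b * (x \<bullet> b)) *\<^sub>R b)) \<bullet> b = axis j c \<bullet> b + k b * (x \<bullet> b)"
        using b by (simp add: inner_add_left)
      then show "coord_affine j \<epsilon> c x \<bullet> b = (axis j c + (\<Sum>b\<in>Basis. (k b * (x \<bullet> b)) *\<^sub>R b)) \<bullet> b"
        using axis_nth_if by (simp add: i k_def axis_eq_axis coord_affine_nth flip: cart_eq_inner_axis)
    qed
  qed
  show "coord_affine j \<epsilon> c \<in> lebesgue \<rightarrow>\<^sub>M lebesgue"
    unfolding eq by (rule lebesgue_affine_measurable[of k "axis j c", OF k(1)])
  show "distr lebesgue lebesgue (coord_affine j \<epsilon> c) = lebesgue"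
    using lebesgue_affine_euclidean[of k "axis j c", OF k(1)] k(2)
    unfolding eq by (simp add: density_1)
qed

context
  fixes \<epsilon> c :: real and j :: 2
  assumes \<epsilon>: "\<epsilon> = 1 \<or> \<epsilon> = -1"
begin

lemma measurable_coord_affine:
  "f \<in> borel_measurable lebesgue \<Longrightarrow> (\<lambda>x. f (coord_affine j \<epsilon> c x)) \<in> borel_measurable lebesgue"
  using measurable_compose[OF coord_affine_measure_preserving(1)[OF \<epsilon>]] .

lemma integral_coord_affine:
  fixes f :: "real^2 \<Rightarrow> real"
  assumes "f \<in> borel_measurable lebesgue"
  shows "(LINT x|lebesgue. f (coord_affine j \<epsilon> c x)) = (LINT x|lebesgue. f x)"
  using integral_distr[OF coord_affine_measure_preserving(1)[OF \<epsilon>] assms]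
  by (simp add: coord_affine_measure_preserving(2)[OF \<epsilon>])

lemma integrable_coord_affine:
  fixes f :: "real^2 \<Rightarrow> real"
  assumes "integrable lebesgue f"
  shows "integrable lebesgue (\<lambda>x. f (coord_affine j \<epsilon> c x))"
  using integrable_distr[OF coord_affine_measure_preserving(1)[OF \<epsilon>], where f=f] assms
  by (simp add: coord_affine_measure_preserving(2)[OF \<epsilon>])

lemma sq_int_coord_affine:
  assumes "f \<in> sq_int"
  shows "(\<lambda>x. f (coord_affine j \<epsilon> c x)) \<in> sq_int"
  using assms measurable_coord_affine[where f=f] integrable_coord_affine[where f="\<lambda>x. (f x)\<^sup>2"]
  by (simp add: L2_space_def lebesgue_on_UNIV_eq)

lemma coord_affine_adjoint:
  fixes f g :: "real^2 \<Rightarrow> real"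
  assumes "f \<in> borel_measurable lebesgue" "g \<in> borel_measurable lebesgue"
  shows "(LINT x|lebesgue. f (coord_affine j \<epsilon> c x) * g x) = (LINT x|lebesgue. f x * g (coord_affine j \<epsilon> (- \<epsilon> * c) x))"
proof -
  have inv: "coord_affine j \<epsilon> (- \<epsilon> * c) (coord_affine j \<epsilon> c x) = x" for x
    using \<epsilon> by (auto simp: vec_eq_iff coord_affine_nth)
  have "(\<lambda>x. g (coord_affine j \<epsilon> (- \<epsilon> * c) x)) \<in> borel_measurable lebesgue"
    using measurable_compose[OF coord_affine_measure_preserving(1)[OF \<epsilon>] assms(2)] .
  then have "(\<lambda>x. f x * g (coord_affine j \<epsilon> (- \<epsilon> * c) x)) \<in> borel_measurable lebesgue"
    using assms(1) by (intro borel_measurable_times)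
  from integral_coord_affine[OF this] show ?thesis by (simp only: inv)
qed

end

definition cut :: "real \<Rightarrow> (real^2 \<Rightarrow> real) \<Rightarrow> real^2 \<Rightarrow> real" where
  "cut L g x = indicator (square L) x * g x"

text \<open>The value at a point of the translate by \<open>h\<close> of a function on a square, continued across a face:
  by reflection with the sign \<open>\<sigma>\<close>, or periodically. The number \<open>c\<close> is twice the coordinate of the face
  that the point crosses. Because \<open>translate\<close> extends the function by zero, at almost every point of
  the square only one of the two summands contributes.\<close>

definition shift :: "boundary_cond \<Rightarrow> 2 \<Rightarrow> real \<Rightarrow> real \<Rightarrow> real \<Rightarrow> (real^2 \<Rightarrow> real) \<Rightarrow> real^2 \<Rightarrow> real" where
  "shift bc j \<sigma> h c g x = g (coord_affine j 1 h x) +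
     (case bc of Neumann \<Rightarrow> \<sigma> * g (coord_affine j (-1) (c - h) x) | Periodic \<Rightarrow> g (coord_affine j 1 (h - c) x))"

text \<open>The sign \<open>s\<close> selects the direction of the translation and with it the face that is crossed.\<close>

definition translate :: "boundary_cond \<Rightarrow> real \<Rightarrow> 2 \<Rightarrow> real \<Rightarrow> real \<Rightarrow> real \<Rightarrow> (real^2 \<Rightarrow> real) \<Rightarrow> real^2 \<Rightarrow> real" where
  "translate bc L j s \<sigma> h g = shift bc j \<sigma> (s * h) (s * (2 * L)) (cut L g)"

lemma cut_sq_int: "g \<in> L2_space (square L) \<Longrightarrow> cut L g \<in> sq_int"
  using cut_sq_int_iff[OF square_measurable, of L g] by (simp add: cut_def[abs_def])

lemma sq_int_imp_L2:
  assumes "f \<in> sq_int"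
  shows "f \<in> L2_space (square L)"
proof -
  have "(\<lambda>x. indicator (square L) x * f x) \<in> sq_int"
  proof (rule L2_spaceI)
    show m: "(\<lambda>x. indicator (square L) x * f x) \<in> borel_measurable (lebesgue_on UNIV)"
      using assms by (intro borel_measurable_times borel_measurable_indicator L2_space_measurable) (auto simp: lebesgue_on_UNIV_eq)
    show "integrable (lebesgue_on UNIV) (\<lambda>x. (norm (indicator (square L) x * f x))\<^sup>2)"
    proof (rule Bochner_Integration.integrable_bound[OF L2_space_integrable_sq[OF assms]])
      show "AE x in lebesgue_on UNIV. norm ((norm (indicator (square L) x * f x))\<^sup>2) \<le> norm ((f x)\<^sup>2)"
        by (auto intro!: AE_I2 simp: indicator_def)
    qed (use m in measurable)
  qed
  then show ?thesis
    using cut_sq_int_iff[OF square_measurable, of L f] by simp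
qed

lemma integral_square_cut:
  "(LINT x|lebesgue_on (square L). f x * g x) = (LINT x|lebesgue. cut L f x * cut L g x)"
proof -
  have "(LINT x|lebesgue_on (square L). f x * g x) = (LINT x|lebesgue. indicator (square L) x *\<^sub>R (f x * g x))"
    by (rule integral_restrict_space) simp
  also have "\<dots> = (LINT x|lebesgue. cut L f x * cut L g x)"
    by (intro Bochner_Integration.integral_cong) (auto simp: cut_def indicator_def)
  finally show ?thesis .
qed

text \<open>Enough integrability to integrate products of translates of \<open>f\<close> with \<open>g\<close>. Besides two functions in
  \<open>L\<^sup>2\<close> this has to cover an integrable function paired with the constant \<open>1\<close>.\<close>

definition pairable :: "2 \<Rightarrow> real \<Rightarrow> (real^2 \<Rightarrow> real) \<Rightarrow> (real^2 \<Rightarrow> real) \<Rightarrow> bool" where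
  "pairable j L f g \<longleftrightarrow> cut L f \<in> borel_measurable lebesgue \<and> cut L g \<in> borel_measurable lebesgue \<and>
     (\<forall>\<epsilon> c. \<epsilon> = 1 \<or> \<epsilon> = -1 \<longrightarrow> integrable lebesgue (\<lambda>x. cut L f (coord_affine j \<epsilon> c x) * cut L g x)
        \<and> integrable lebesgue (\<lambda>x. cut L f x * cut L g (coord_affine j \<epsilon> c x)))"

lemma pairable_L2:
  assumes "f \<in> L2_space (square L)" "g \<in> L2_space (square L)"
  shows "pairable j L f g"
  unfolding pairable_def
proof (intro conjI allI impI)
  note f = cut_sq_int[OF assms(1)] and g = cut_sq_int[OF assms(2)]
  show "cut L f \<in> borel_measurable lebesgue" "cut L g \<in> borel_measurable lebesgue"
    using f g by (simp_all add: L2_space_def lebesgue_on_UNIV_eq)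
  fix \<epsilon> c :: real assume \<epsilon>: "\<epsilon> = 1 \<or> \<epsilon> = -1"
  show "integrable lebesgue (\<lambda>x. cut L f (coord_affine j \<epsilon> c x) * cut L g x)"
    using L2_space_integrable_mult[OF sq_int_coord_affine[OF \<epsilon> f, where j=j and c=c] g] by (simp add: lebesgue_on_UNIV_eq)
  show "integrable lebesgue (\<lambda>x. cut L f x * cut L g (coord_affine j \<epsilon> c x))"
    using L2_space_integrable_mult[OF f sq_int_coord_affine[OF \<epsilon> g, where j=j and c=c]] by (simp add: lebesgue_on_UNIV_eq)
qed

lemma pairable_one:
  assumes "integrable (lebesgue_on (square L)) f"
  shows "pairable j L f (\<lambda>x. 1)"
proof -
  have f: "integrable lebesgue (cut L f)"
    using assms by (simp add: cut_def[abs_def] integrable_restrict_space)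
  have ind: "cut L (\<lambda>x. 1) = indicator (square L)"
    by (auto simp: cut_def)
  have mi: "(\<lambda>x. indicator (square L) (coord_affine j \<epsilon> c x) :: real) \<in> borel_measurable lebesgue" if "\<epsilon> = 1 \<or> \<epsilon> = -1" for \<epsilon> c
    by (rule measurable_coord_affine[OF that borel_measurable_indicator[OF square_measurable]])
  have int: "integrable lebesgue (\<lambda>x. F x * b x)"
    if F: "integrable lebesgue F" and b: "b \<in> borel_measurable lebesgue" "\<And>x. \<bar>b x\<bar> \<le> 1" for F b :: "real^2 \<Rightarrow> real"
  proof (rule Bochner_Integration.integrable_bound[OF F])
    show "(\<lambda>x. F x * b x) \<in> borel_measurable lebesgue"
      by (intro borel_measurable_times borel_measurable_integrable[OF F] b(1))
    show "AE x in lebesgue. norm (F x * b x) \<le> norm (F x)"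
      using b(2) by (auto intro!: AE_I2 mult_right_le_one_le simp: abs_mult)
  qed
  show ?thesis
    unfolding pairable_def ind
  proof (intro conjI allI impI)
    show "cut L f \<in> borel_measurable lebesgue" using f by (rule borel_measurable_integrable)
    show "(indicator (square L) :: real^2 \<Rightarrow> real) \<in> borel_measurable lebesgue"
      by (rule borel_measurable_indicator[OF square_measurable])
    fix \<epsilon> c :: real assume \<epsilon>: "\<epsilon> = 1 \<or> \<epsilon> = -1"
    show "integrable lebesgue (\<lambda>x. cut L f (coord_affine j \<epsilon> c x) * indicator (square L) x)"
      by (rule int[OF integrable_coord_affine[OF \<epsilon> f] borel_measurable_indicator[OF square_measurable]]) (simp add: indicator_def)
    show "integrable lebesgue (\<lambda>x. cut L f x * indicator (square L) (coord_affine j \<epsilon> c x))"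
      by (rule int[OF f mi[OF \<epsilon>]]) (simp add: indicator_def)
  qed
qed

lemma cut_idem_mult: "cut L f x * cut L g x = f x * cut L g x" "cut L f x * cut L g x = cut L f x * g x"
  by (auto simp: cut_def indicator_def)

text \<open>Substitution in each summand turns a translation into the opposite one and leaves a reflection
  unchanged. The sum of the two translates is therefore symmetric; in the difference the reflected
  terms change sign relative to the others, so the two sides use opposite continuations.\<close>

lemma translate_adjoint:
  assumes "pairable j L f g"
  shows "(LINT x|lebesgue_on (square L). (translate bc L j 1 \<sigma> h f x + translate bc L j (-1) \<sigma> h f x) * g x)
       = (LINT x|lebesgue_on (square L). f x * (translate bc L j 1 \<sigma> h g x + translate bc L j (-1) \<sigma> h g x))" (is ?sum)
    and "(LINT x|lebesgue_on (square L). (translate bc L j 1 (-\<sigma>) h f x - translate bc L j (-1) (-\<sigma>) h f x) * g x)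
       = - (LINT x|lebesgue_on (square L). f x * (translate bc L j 1 \<sigma> h g x - translate bc L j (-1) \<sigma> h g x))" (is ?diff)
proof -
  let ?f = "cut L f" and ?g = "cut L g" and ?A = "\<lambda>\<epsilon> c. coord_affine j \<epsilon> c"
  define I where "I \<epsilon> c = (LINT x|lebesgue. ?f (?A \<epsilon> c x) * ?g x)" for \<epsilon> c
  define J where "J \<epsilon> c = (LINT x|lebesgue. ?f x * ?g (?A \<epsilon> c x))" for \<epsilon> c
  have IJ: "I 1 c = J 1 (- c)" "I (-1) c = J (-1) c" for c
    using coord_affine_adjoint[where \<epsilon>=1 and f="?f" and g="?g" and j=j and c=c] coord_affine_adjoint[where \<epsilon>="-1" and f="?f" and g="?g" and j=j and c=c] assms
    by (simp_all add: I_def J_def pairable_def)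
  have int: "integrable lebesgue (\<lambda>x. ?f (?A 1 c x) * ?g x)" "integrable lebesgue (\<lambda>x. ?f (?A (-1) c x) * ?g x)"
    "integrable lebesgue (\<lambda>x. ?f x * ?g (?A 1 c x))" "integrable lebesgue (\<lambda>x. ?f x * ?g (?A (-1) c x))" for c
    using assms by (simp_all add: pairable_def)
  define e :: real where "e = (case bc of Neumann \<Rightarrow> -1 | Periodic \<Rightarrow> 1)"
  define r :: "real \<Rightarrow> real" where "r \<sigma> = (case bc of Neumann \<Rightarrow> \<sigma> | Periodic \<Rightarrow> 1)" for \<sigma>
  define d :: "real \<Rightarrow> real \<Rightarrow> real" where "d h c = (case bc of Neumann \<Rightarrow> c - h | Periodic \<Rightarrow> h - c)" for h c
  have sh: "shift bc j \<sigma> h c F x = F (?A 1 h x) + r \<sigma> * F (?A e (d h c) x)" for \<sigma> h c F x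
    by (cases bc) (simp_all add: shift_def e_def r_def d_def)
  have e: "e = 1 \<or> e = -1" by (cases bc) (simp_all add: e_def)
  have inte: "integrable lebesgue (\<lambda>x. ?f (?A e c x) * ?g x)" "integrable lebesgue (\<lambda>x. ?f x * ?g (?A e c x))" for c
    using e int by auto
  have left: "(LINT x|lebesgue_on (square L). (translate bc L j 1 \<sigma> h f x + a * translate bc L j (-1) \<sigma> h f x) * g x)
    = I 1 h + r \<sigma> * I e (d h (2 * L)) + a * (I 1 (- h) + r \<sigma> * I e (d (- h) (- (2 * L))))" for \<sigma> a
  proof -
    have "(LINT x|lebesgue_on (square L). (translate bc L j 1 \<sigma> h f x + a * translate bc L j (-1) \<sigma> h f x) * g x)
      = (LINT x|lebesgue. (translate bc L j 1 \<sigma> h f x + a * translate bc L j (-1) \<sigma> h f x) * ?g x)"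
      unfolding integral_square_cut by (simp only: cut_idem_mult(1))
    also have "\<dots> = (LINT x|lebesgue. ?f (?A 1 h x) * ?g x + r \<sigma> * (?f (?A e (d h (2 * L)) x) * ?g x)
        + a * (?f (?A 1 (- h) x) * ?g x + r \<sigma> * (?f (?A e (d (- h) (- (2 * L))) x) * ?g x)))"
      by (intro Bochner_Integration.integral_cong refl) (simp add: translate_def sh algebra_simps)
    also have "\<dots> = I 1 h + r \<sigma> * I e (d h (2 * L)) + a * (I 1 (- h) + r \<sigma> * I e (d (- h) (- (2 * L))))"
      by (simp add: int inte I_def)
    finally show ?thesis .
  qed
  have right: "(LINT x|lebesgue_on (square L). f x * (translate bc L j 1 \<sigma> h g x + a * translate bc L j (-1) \<sigma> h g x))
    = J 1 h + r \<sigma> * J e (d h (2 * L)) + a * (J 1 (- h) + r \<sigma> * J e (d (- h) (- (2 * L))))" for \<sigma> a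
  proof -
    have "(LINT x|lebesgue_on (square L). f x * (translate bc L j 1 \<sigma> h g x + a * translate bc L j (-1) \<sigma> h g x))
      = (LINT x|lebesgue. ?f x * (translate bc L j 1 \<sigma> h g x + a * translate bc L j (-1) \<sigma> h g x))"
      unfolding integral_square_cut by (simp only: cut_idem_mult(2))
    also have "\<dots> = (LINT x|lebesgue. ?f x * ?g (?A 1 h x) + r \<sigma> * (?f x * ?g (?A e (d h (2 * L)) x))
        + a * (?f x * ?g (?A 1 (- h) x) + r \<sigma> * (?f x * ?g (?A e (d (- h) (- (2 * L))) x))))"
      by (intro Bochner_Integration.integral_cong refl) (simp add: translate_def sh algebra_simps)
    also have "\<dots> = J 1 h + r \<sigma> * J e (d h (2 * L)) + a * (J 1 (- h) + r \<sigma> * J e (d (- h) (- (2 * L))))"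
      by (simp add: int inte J_def)
    finally show ?thesis .
  qed
  show ?sum
    using left[of \<sigma> 1] right[of \<sigma> 1] IJ by (cases bc) (simp_all add: e_def r_def d_def algebra_simps)
  show ?diff
    using left[of "-\<sigma>" "-1"] right[of \<sigma> "-1"] IJ by (cases bc) (simp_all add: e_def r_def d_def algebra_simps)
qed

lemma coord_affine_in_square:
  assumes "x \<in> square L"
  shows "coord_affine j \<epsilon> c x \<in> square L \<longleftrightarrow> \<bar>\<epsilon> * x $ j + c\<bar> < L"
  using assms by (auto simp: square_iff_abs coord_affine_nth)

text \<open>Off one line, exactly one of the two candidate points lies in the square. The point and the sign are
  the same for all functions, which makes nonlinear expressions in several translated functions
  accessible.\<close>

lemma translate_pointwise:
  assumes h: "0 < h" "h < 2 * L" and s: "s = 1 \<or> s = -1" and x: "x \<in> square L" "x $ j \<noteq> s * (L - h)"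
  shows "\<exists>y\<in>square L. \<exists>r. \<forall>\<sigma> g. translate bc L j s \<sigma> h g x = (if r then \<sigma> else 1) * g y"
proof -
  define e :: real where "e = (case bc of Neumann \<Rightarrow> -1 | Periodic \<Rightarrow> 1)"
  define d where "d = (case bc of Neumann \<Rightarrow> s * (2 * L - h) | Periodic \<Rightarrow> s * (h - 2 * L))"
  have eq: "translate bc L j s \<sigma> h g x = cut L g (coord_affine j 1 (s * h) x)
      + (if bc = Neumann then \<sigma> else 1) * cut L g (coord_affine j e d x)" for \<sigma> g
    by (cases bc) (simp_all add: translate_def shift_def e_def d_def algebra_simps)
  note in1 = coord_affine_in_square[OF x(1), where j=j and \<epsilon>=1 and c="s * h"]
  note in2 = coord_affine_in_square[OF x(1), where j=j and \<epsilon>=e and c=d]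
  have xj: "\<bar>x $ j\<bar> < L" using x(1) by (simp add: square_iff_abs)
  have xor: "coord_affine j 1 (s * h) x \<in> square L \<longleftrightarrow> coord_affine j e d x \<notin> square L"
    using s
  proof
    assume "s = 1"
    then show ?thesis
      unfolding in1 in2 using x(2) xj h by (cases bc) (auto simp: e_def d_def)
  next
    assume "s = -1"
    then show ?thesis
      unfolding in1 in2 using x(2) xj h by (cases bc) (auto simp: e_def d_def)
  qed
  show ?thesis
  proof (cases "coord_affine j 1 (s * h) x \<in> square L")
    case True
    with xor show ?thesis
      by (intro bexI[of _ "coord_affine j 1 (s * h) x"] exI[of _ False]) (auto simp: eq cut_def)
  next
    case False
    with xor show ?thesis
      by (intro bexI[of _ "coord_affine j e d x"] exI[of _ "bc = Neumann"]) (auto simp: eq cut_def)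
  qed
qed

lemma AE_square_coord_neq: "AE x in lebesgue_on (square L). x $ j \<noteq> a"
proof -
  have "negligible {x :: real^2. axis j 1 \<bullet> x = a}"
    by (rule negligible_hyperplane) (simp add: axis_eq_0_iff)
  then have "{x :: real^2. x $ j = a} \<in> null_sets lebesgue"
    by (simp add: negligible_iff_null_sets inner_axis')
  then have "AE x in lebesgue. x \<notin> {x :: real^2. x $ j = a}"
    by (rule AE_not_in)
  then have "AE x in lebesgue. x \<in> square L \<longrightarrow> x $ j \<noteq> a"
    by eventually_elim simp
  then show ?thesis
    by (simp add: AE_restrict_space_iff)
qed

lemma translate_AE:
  assumes "0 < h" "h < 2 * L" "s = 1 \<or> s = -1"
  shows "AE x in lebesgue_on (square L). \<exists>y\<in>square L. \<exists>r. \<forall>\<sigma> g. translate bc L j s \<sigma> h g x = (if r then \<sigma> else 1) * g y"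
proof -
  have "AE x in lebesgue_on (square L). x \<in> square L"
    by (rule AE_I2) (simp add: space_restrict_space)
  then show ?thesis
    using AE_square_coord_neq[where L=L and j=j and a="s * (L - h)"]
    by eventually_elim (rule translate_pointwise[OF assms])
qed

lemma translate_L2:
  assumes "g \<in> L2_space (square L)"
  shows "translate bc L j s \<sigma> h g \<in> L2_space (square L)"
proof -
  note g = cut_sq_int[OF assms]
  have "(\<lambda>x. cut L g (coord_affine j 1 a x) + (\<sigma> * cut L g (coord_affine j (-1) b x))) \<in> sq_int" for a b
    by (intro L2_space_add L2_space_scale sq_int_coord_affine g) auto
  moreover have "(\<lambda>x. cut L g (coord_affine j 1 a x) + cut L g (coord_affine j 1 b x)) \<in> sq_int" for a b
    by (intro L2_space_add sq_int_coord_affine g) auto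
  ultimately show ?thesis
    by (intro sq_int_imp_L2) (cases bc; simp add: translate_def shift_def[abs_def])
qed

text \<open>The two translates together cover the square twice: pair with the constant \<open>1\<close>.\<close>

lemma integral_translate_sum:
  assumes h: "0 < h" "h < 2 * L" and g: "integrable (lebesgue_on (square L)) g"
  shows "(LINT x|lebesgue_on (square L). translate bc L j 1 1 h g x + translate bc L j (-1) 1 h g x) = 2 * (LINT x|lebesgue_on (square L). g x)"
    and "integrable (lebesgue_on (square L)) (translate bc L j s \<sigma> h g)"
proof -
  have one: "AE x in lebesgue_on (square L). translate bc L j s 1 h (\<lambda>x. 1) x = 1" if "s = 1 \<or> s = -1" for s
    using translate_AE[OF h that, where bc=bc and j=j] by eventually_elim auto
  have gm: "g \<in> borel_measurable (lebesgue_on (square L))"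
    using g by (rule borel_measurable_integrable)
  have tm: "translate bc L j s 1 h (\<lambda>x. 1) \<in> borel_measurable (lebesgue_on (square L))" for s
    by (intro L2_space_measurable translate_L2 L2_space_const) simp
  have "(LINT x|lebesgue_on (square L). translate bc L j 1 1 h g x + translate bc L j (-1) 1 h g x)
    = (LINT x|lebesgue_on (square L). g x * (translate bc L j 1 1 h (\<lambda>x. 1) x + translate bc L j (-1) 1 h (\<lambda>x. 1) x))"
    using translate_adjoint(1)[OF pairable_one[OF g, of j], where bc=bc and \<sigma>=1 and h=h] by simp
  also have "\<dots> = (LINT x|lebesgue_on (square L). 2 * g x)"
  proof (rule integral_cong_AE)
    show "AE x in lebesgue_on (square L). g x * (translate bc L j 1 1 h (\<lambda>x. 1) x + translate bc L j (-1) 1 h (\<lambda>x. 1) x) = 2 * g x"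
      using one[of 1, simplified] one[of "-1", simplified] by eventually_elim simp
  qed (intro borel_measurable_times borel_measurable_add gm tm borel_measurable_const)+
  finally show "(LINT x|lebesgue_on (square L). translate bc L j 1 1 h g x + translate bc L j (-1) 1 h g x) = 2 * (LINT x|lebesgue_on (square L). g x)"
    by simp
  have f: "integrable lebesgue (cut L g)"
    using g by (simp add: cut_def[abs_def] integrable_restrict_space)
  have "integrable lebesgue (\<lambda>x. cut L g (coord_affine j 1 a x) + \<sigma> * cut L g (coord_affine j (-1) b x))"
    "integrable lebesgue (\<lambda>x. cut L g (coord_affine j 1 a x) + cut L g (coord_affine j 1 b x))" for a b
    by (intro Bochner_Integration.integrable_add integrable_mult_right integrable_coord_affine f; simp)+
  then have "integrable lebesgue (translate bc L j s \<sigma> h g)"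
    by (cases bc) (simp_all add: translate_def shift_def[abs_def])
  then show "integrable (lebesgue_on (square L)) (translate bc L j s \<sigma> h g)"
    using integrable_mult_indicator[of "square L" lebesgue "translate bc L j s \<sigma> h g"] by (simp add: integrable_restrict_space)
qed

section \<open>Translates of test functions\<close>

text \<open>The continuation of a test function across one face is again continuously differentiable, so no
  extension by zero is needed: in the Neumann case the test function vanishes near the faces and its
  mirror image is added, in the periodic case it is already defined beyond them.\<close>

definition extended :: "boundary_cond \<Rightarrow> 2 \<Rightarrow> real \<Rightarrow> real \<Rightarrow> (real^2 \<Rightarrow> real) \<Rightarrow> real^2 \<Rightarrow> real" where
  "extended bc j \<sigma> c \<phi> x = \<phi> x + (case bc of Neumann \<Rightarrow> \<sigma> * \<phi> (coord_affine j (-1) c x) | Periodic \<Rightarrow> 0)"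

text \<open>What test functions share with their partial derivatives.\<close>

definition admissible :: "boundary_cond \<Rightarrow> real \<Rightarrow> (real^2 \<Rightarrow> real) \<Rightarrow> bool" where
  "admissible bc L \<phi> \<longleftrightarrow> (case bc of Neumann \<Rightarrow> (\<forall>x. x \<notin> square L \<longrightarrow> \<phi> x = 0)
      | Periodic \<Rightarrow> (\<forall>x i. \<phi> (coord_affine i 1 (2 * L) x) = \<phi> x))"

lemma add_axis_coord_affine: "x + axis i c = coord_affine i 1 c x"
  by (auto simp: vec_eq_iff coord_affine_nth axis_def)

lemma test_function_admissible:
  assumes "\<phi> \<in> test_functions bc L"
  shows "admissible bc L \<phi>" "admissible bc L (partial_deriv i \<phi>)"
proof -
  have C1: "C1_fun \<phi>" using assms by (rule test_functions_C1)
  have per: "\<phi> (coord_affine k 1 (2 * L) x) = \<phi> x" if "bc = Periodic" for k x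
    using assms that by (simp add: test_functions_def add_axis_coord_affine)
  have zero: "\<phi> y = 0" if "y \<in> - closure {x. \<phi> x \<noteq> 0}" for y
    using that closure_subset[of "{x. \<phi> x \<noteq> 0}"] by blast
  have sub: "closure {x. \<phi> x \<noteq> 0} \<subseteq> square L" if "bc = Neumann"
    using assms that by (simp add: test_functions_def)
  show "admissible bc L \<phi>"
  proof (cases bc)
    case Neumann
    show ?thesis
      unfolding admissible_def Neumann boundary_cond.case using zero sub[OF Neumann] by blast
  next
    case Periodic
    show ?thesis
      unfolding admissible_def Periodic boundary_cond.case using per[OF Periodic] by blast
  qed
  show "admissible bc L (partial_deriv i \<phi>)"
  proof (cases bc)
    case Neumann
    have "partial_deriv i \<phi> x = 0" if x: "x \<notin> square L" for x
    proof -
      have "x \<in> - closure {x. \<phi> x \<noteq> 0}"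
        using sub[OF Neumann] x by blast
      then have "(\<phi> has_derivative (\<lambda>h. 0)) (at x)"
        by (rule has_derivative_transform_within_open[OF has_derivative_const[of 0] open_Compl[OF closed_closure]])
          (rule zero[symmetric])
      from partial_derivI[OF this] show ?thesis .
    qed
    then show ?thesis
      unfolding admissible_def Neumann boundary_cond.case by blast
  next
    case Periodic
    have eq: "(\<lambda>x. \<phi> (coord_affine k 1 (2 * L) x)) = \<phi>" for k
      by (rule ext) (rule per[OF Periodic])
    have "partial_deriv i \<phi> (coord_affine k 1 (2 * L) x) = partial_deriv i \<phi> x" for k x
      using C1_fun_coord_affine(2)[OF C1, where i=i and j=k and \<epsilon>=1 and c="2 * L", unfolded eq[of k]]
      by (simp add: fun_eq_iff)
    then show ?thesis
      unfolding admissible_def Periodic boundary_cond.case by blast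
  qed
qed

lemma coord_affine_compose:
  "coord_affine j \<epsilon> c (coord_affine j \<epsilon>' c' x) = coord_affine j (\<epsilon> * \<epsilon>') (\<epsilon> * c' + c) x"
  by (auto simp: vec_eq_iff coord_affine_nth algebra_simps)

lemma translate_admissible:
  assumes \<phi>: "admissible bc L \<phi>" and h: "0 < h" "h < 2 * L" and s: "s = 1 \<or> s = -1"
    and x: "x \<in> square L" "x $ j \<noteq> s * (L - h)"
  shows "translate bc L j s \<sigma> h \<phi> x = extended bc j \<sigma> (s * (2 * L)) \<phi> (coord_affine j 1 (s * h) x)"
proof (cases bc)
  case Neumann
  then have "cut L \<phi> = \<phi>"
    using \<phi> by (auto simp: cut_def fun_eq_iff admissible_def indicator_def)
  then show ?thesis
    using Neumann by (simp add: translate_def shift_def extended_def coord_affine_compose algebra_simps)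
next
  case Periodic
  have per: "\<phi> (coord_affine j 1 (c + 2 * L) x) = \<phi> (coord_affine j 1 c x)" for c x
  proof -
    have "coord_affine j 1 (c + 2 * L) x = coord_affine j 1 (2 * L) (coord_affine j 1 c x)"
      by (simp add: coord_affine_compose)
    then show ?thesis using \<phi> Periodic by (simp add: admissible_def)
  qed
  have eq: "\<phi> (coord_affine j 1 (s * h - s * (2 * L)) x) = \<phi> (coord_affine j 1 (s * h) x)"
    using s per[of "h - 2 * L" x] per[of "- h" x] by auto
  have xj: "\<bar>x $ j\<bar> < L" using x(1) by (simp add: square_iff_abs)
  have "coord_affine j 1 (s * h) x \<in> square L \<longleftrightarrow> coord_affine j 1 (s * h - s * (2 * L)) x \<notin> square L"
    using s x(2) xj h unfolding coord_affine_in_square[OF x(1)] by auto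
  then show ?thesis
    using Periodic eq by (auto simp: translate_def shift_def extended_def cut_def indicator_def)
qed

lemma translate_admissible_AE:
  assumes "admissible bc L \<phi>" "0 < h" "h < 2 * L" "s = 1 \<or> s = -1"
  shows "AE x in lebesgue_on (square L). translate bc L j s \<sigma> h \<phi> x = extended bc j \<sigma> (s * (2 * L)) \<phi> (coord_affine j 1 (s * h) x)"
proof -
  have "AE x in lebesgue_on (square L). x \<in> square L"
    by (rule AE_I2) (simp add: space_restrict_space)
  then show ?thesis
    using AE_square_coord_neq[where L=L and j=j and a="s * (L - h)"]
    by eventually_elim (rule translate_admissible[OF assms])
qed

lemma extended_on_square:
  assumes "admissible bc L \<phi>" "s = 1 \<or> s = -1" "x \<in> square L"
  shows "extended bc j \<sigma> (s * (2 * L)) \<phi> x = \<phi> x"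
proof (cases bc)
  case Neumann
  have "\<bar>x $ j\<bar> < L" using assms(3) by (simp add: square_iff_abs)
  then have "coord_affine j (-1) (s * (2 * L)) x \<notin> square L"
    using assms(2) unfolding coord_affine_in_square[OF assms(3)] by auto
  then show ?thesis
    using Neumann assms(1) by (simp add: extended_def admissible_def)
qed (simp add: extended_def)

lemma extended_C1:
  assumes "C1_fun \<phi>"
  shows "C1_fun (extended bc j \<sigma> c \<phi>)"
    and "partial_deriv i (extended bc j \<sigma> c \<phi>) = extended bc j (\<sigma> * (if i = j then -1 else 1)) c (partial_deriv i \<phi>)"
proof -
  note a = C1_fun_coord_affine[OF assms, where j=j and \<epsilon>="-1" and c=c]
  have "C1_fun (extended bc j \<sigma> c \<phi>) \<and> partial_deriv i (extended bc j \<sigma> c \<phi>) = extended bc j (\<sigma> * (if i = j then -1 else 1)) c (partial_deriv i \<phi>)"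
  proof (cases bc)
    case Neumann
    have eq: "extended bc j \<sigma> c \<phi> = (\<lambda>x. \<phi> x + \<sigma> * \<phi> (coord_affine j (-1) c x))"
      using Neumann by (simp add: extended_def[abs_def])
    show ?thesis
      unfolding eq using C1_fun_add[OF assms C1_fun_scale(1)[OF a(1), where c=\<sigma>]] C1_fun_scale(2)[OF a(1), where c=\<sigma>] a(2) Neumann
      by (auto simp: extended_def fun_eq_iff)
  next
    case Periodic
    then show ?thesis using assms by (simp add: extended_def[abs_def])
  qed
  then show "C1_fun (extended bc j \<sigma> c \<phi>)" "partial_deriv i (extended bc j \<sigma> c \<phi>) = extended bc j (\<sigma> * (if i = j then -1 else 1)) c (partial_deriv i \<phi>)"
    by auto
qed

lemma test_function_margin:
  assumes L: "L > 0" and \<phi>: "\<phi> \<in> test_functions Neumann L"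
  obtains d where "d > 0" "\<And>x k. \<phi> x \<noteq> 0 \<Longrightarrow> \<bar>x $ k\<bar> \<le> L - d"
proof -
  define C where "C = closure {x. \<phi> x \<noteq> 0}"
  have C: "compact C" "C \<subseteq> square L" using \<phi> by (simp_all add: C_def test_functions_def)
  have sub: "{x. \<phi> x \<noteq> 0} \<subseteq> C" by (simp add: C_def closure_subset)
  show thesis
  proof (cases "C = {}")
    case True
    then show ?thesis using that[of 1] sub by auto
  next
    case False
    have ex: "\<exists>y\<in>C. \<forall>x\<in>C. \<bar>x $ k\<bar> \<le> \<bar>y $ k\<bar>" for k
      using C(1) False by (intro continuous_attains_sup continuous_intros)
    have dk: "\<exists>d>0. \<forall>x\<in>C. \<bar>x $ k\<bar> \<le> L - d" for k
    proof -
      from ex[of k] obtain y where y: "y \<in> C" "\<And>x. x \<in> C \<Longrightarrow> \<bar>x $ k\<bar> \<le> \<bar>y $ k\<bar>" by blast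
      then have "\<bar>y $ k\<bar> < L" using C(2) by (auto simp: square_iff_abs)
      then show ?thesis using y(2) by (intro exI[of _ "L - \<bar>y $ k\<bar>"]) auto
    qed
    obtain d1 d2 where d: "d1 > 0" "\<And>x. x \<in> C \<Longrightarrow> \<bar>x $ 1\<bar> \<le> L - d1" "d2 > 0" "\<And>x. x \<in> C \<Longrightarrow> \<bar>x $ 2\<bar> \<le> L - d2"
      using dk[of 1] dk[of 2] by blast
    show ?thesis
    proof (rule that[of "min d1 d2"])
      fix x k assume "\<phi> x \<noteq> 0"
      then have "x \<in> C" using sub by auto
      then show "\<bar>x $ k\<bar> \<le> L - min d1 d2"
        using d(2)[of x] d(4)[of x] exhaust_2[of k] by auto
    qed (use d in auto)
  qed
qed

text \<open>After translation and reflection a Neumann test function no longer vanishes near the faces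
  orthogonal to the axis \<open>j\<close>. For \<open>i = j\<close> the sign \<open>\<sigma> = - a\<close> makes the two translates cancel there, as
  \<open>neumann_test_extension\<close> demands.\<close>

lemma translated_test_function_by_parts:
  fixes a :: real
  assumes L: "L > 0" and u: "u \<in> L2_space (square L)" and G: "is_weak_grad bc L u G"
    and \<phi>: "\<phi> \<in> test_functions bc L" and h: "0 < h" "h < 2 * L"
    and a: "a = 1 \<or> a = -1" and sg: "i = j \<Longrightarrow> \<sigma> = - a"
  defines "\<psi> \<equiv> \<lambda>x. extended bc j \<sigma> (2 * L) \<phi> (coord_affine j 1 h x) + a * extended bc j \<sigma> (- (2 * L)) \<phi> (coord_affine j 1 (- h) x)"
  shows "(LINT x|lebesgue_on (square L). u x * partial_deriv i \<psi> x) = - (LINT x|lebesgue_on (square L). G x $ i * \<psi> x)"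
    and "C1_fun \<psi>"
    and "partial_deriv i \<psi> = (\<lambda>x. partial_deriv i (extended bc j \<sigma> (2 * L) \<phi>) (coord_affine j 1 h x) + a * partial_deriv i (extended bc j \<sigma> (- (2 * L)) \<phi>) (coord_affine j 1 (- h) x))"
proof -
  note C1 = test_functions_C1[OF \<phi>]
  note e = C1_fun_coord_affine[OF extended_C1(1)[OF C1, where bc=bc and j=j and \<sigma>=\<sigma>], where j=j and \<epsilon>=1]
  show C1\<psi>: "C1_fun \<psi>"
    unfolding \<psi>_def by (intro C1_fun_add C1_fun_scale e)
  show "partial_deriv i \<psi> = (\<lambda>x. partial_deriv i (extended bc j \<sigma> (2 * L) \<phi>) (coord_affine j 1 h x) + a * partial_deriv i (extended bc j \<sigma> (- (2 * L)) \<phi>) (coord_affine j 1 (- h) x))"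
    unfolding \<psi>_def C1_fun_add(2)[OF e(1) C1_fun_scale(1)[OF e(1)]] C1_fun_scale(2)[OF e(1)] e(2) by auto
  show "(LINT x|lebesgue_on (square L). u x * partial_deriv i \<psi> x) = - (LINT x|lebesgue_on (square L). G x $ i * \<psi> x)"
  proof (cases bc)
    case Periodic
    have "coord_affine j 1 c (x + axis k (2 * L)) = coord_affine j 1 c x + axis k (2 * L)" for c x k
      by (auto simp: vec_eq_iff coord_affine_nth axis_def)
    then have "\<psi> (x + axis k (2 * L)) = \<psi> x" for x k
      using \<phi> Periodic by (simp add: \<psi>_def extended_def test_functions_def)
    then have "\<psi> \<in> test_functions bc L"
      using C1\<psi> Periodic by (simp add: test_functions_def)
    then show ?thesis using G by (simp add: is_weak_grad_def)
  next
    case Neumann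
    obtain d where d: "d > 0" "\<And>x k. \<phi> x \<noteq> 0 \<Longrightarrow> \<bar>x $ k\<bar> \<le> L - d"
      using test_function_margin[OF L] \<phi> Neumann by blast
    have \<psi>eq: "\<psi> x = \<phi> (coord_affine j 1 h x) + \<sigma> * \<phi> (coord_affine j (-1) (2 * L - h) x)
        + a * (\<phi> (coord_affine j 1 (- h) x) + \<sigma> * \<phi> (coord_affine j (-1) (h - 2 * L) x))" for x
      using Neumann by (simp add: \<psi>_def extended_def coord_affine_compose algebra_simps)
    show ?thesis
    proof (rule neumann_test_extension[OF L u G[unfolded Neumann] C1\<psi> d(1), where j = j])
      fix x k assume "\<psi> x \<noteq> 0" and k: "k \<noteq> j"
      then obtain \<epsilon> c where "\<phi> (coord_affine j \<epsilon> c x) \<noteq> 0"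
        unfolding \<psi>eq by force
      from d(2)[OF this, of k] k show "\<bar>x $ k\<bar> \<le> L - d"
        by (simp add: coord_affine_nth)
    next
      fix x assume ij: "i = j" and x: "\<bar>x $ j\<bar> = L"
      have out: "\<phi> (coord_affine j \<epsilon> c x) = 0" if "\<bar>\<epsilon> * x $ j + c\<bar> \<ge> L" for \<epsilon> c
        using d(2)[of "coord_affine j \<epsilon> c x" j] d(1) that by (auto simp: coord_affine_nth)
      have flip: "coord_affine j (-1) c x = coord_affine j 1 (c - 2 * x $ j) x" for c
        by (simp add: vec_eq_iff coord_affine_nth)
      consider "x $ j = L" | "x $ j = - L" using x by linarith
      then show "\<psi> x = 0"
      proof cases
        case 1
        have "\<phi> (coord_affine j 1 h x) = 0" "\<phi> (coord_affine j (-1) (h - 2 * L) x) = 0"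
          using 1 h L by (auto intro!: out)
        moreover have "coord_affine j (-1) (2 * L - h) x = coord_affine j 1 (- h) x"
          using 1 by (simp add: flip)
        ultimately show ?thesis using sg[OF ij] by (simp add: \<psi>eq)
      next
        case 2
        have "\<phi> (coord_affine j 1 (- h) x) = 0" "\<phi> (coord_affine j (-1) (2 * L - h) x) = 0"
          using 2 h L by (auto intro!: out)
        moreover have "coord_affine j (-1) (h - 2 * L) x = coord_affine j 1 h x"
          using 2 by (simp add: flip)
        ultimately show ?thesis using sg[OF ij] a by (auto simp: \<psi>eq)
      qed
    qed
  qed
qed

section \<open>Second derivatives\<close>

text \<open>Even reflection of a function across a face orthogonal to the axis \<open>j\<close> reverses the sign of its \<open>j\<close>-th
  partial derivative and preserves that of the other one.\<close>

definition parity :: "2 \<Rightarrow> 2 \<Rightarrow> real" where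
  "parity i j = (if i = j then -1 else 1)"

lemma parity_sq [simp]: "parity i j * parity i j = 1"
  by (simp add: parity_def)

definition translate_grad :: "boundary_cond \<Rightarrow> real \<Rightarrow> 2 \<Rightarrow> real \<Rightarrow> real \<Rightarrow> (real^2 \<Rightarrow> real^2) \<Rightarrow> real^2 \<Rightarrow> real^2" where
  "translate_grad bc L j s h G x = (\<chi> i. translate bc L j s (parity i j) h (\<lambda>x. G x $ i) x)"

lemma translate_grad_L2:
  assumes "G \<in> L2_space (square L)"
  shows "translate_grad bc L j s h G \<in> L2_space (square L)"
  by (rule L2_space_vecI) (simp add: translate_grad_def translate_L2[OF L2_space_vec_nth[OF assms]])

lemma L2_space_vec_lincomb:
  fixes F G :: "real^2 \<Rightarrow> real^2"
  assumes "F \<in> L2_space S" "G \<in> L2_space S"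
  shows "(\<lambda>x. a *\<^sub>R F x + b *\<^sub>R G x) \<in> L2_space S"
  by (rule L2_space_vecI) (simp add: L2_space_add L2_space_scale L2_space_vec_nth[OF assms(1)] L2_space_vec_nth[OF assms(2)])

lemma L2_space_vec_diff:
  fixes F G :: "real^2 \<Rightarrow> real^2"
  assumes "F \<in> L2_space S" "G \<in> L2_space S"
  shows "(\<lambda>x. F x - G x) \<in> L2_space S"
  using L2_space_vec_lincomb[OF assms, of 1 "-1"] by simp

lemma integral_mult_cong_AE:
  fixes f g g' :: "real^2 \<Rightarrow> real"
  assumes "f \<in> L2_space S" "g \<in> L2_space S" "g' \<in> L2_space S" "AE x in lebesgue_on S. g x = g' x"
  shows "(LINT x|lebesgue_on S. f x * g x) = (LINT x|lebesgue_on S. f x * g' x)"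
proof (rule integral_cong_AE)
  show "AE x in lebesgue_on S. f x * g x = f x * g' x"
    using assms(4) by eventually_elim simp
qed (intro borel_measurable_times L2_space_measurable assms)+

lemma integral_mult_add:
  fixes f g w :: "real^2 \<Rightarrow> real"
  assumes "f \<in> L2_space S" "g \<in> L2_space S" "w \<in> L2_space S"
  shows "(LINT x|lebesgue_on S. (a * f x + b * g x) * w x) = a * (LINT x|lebesgue_on S. f x * w x) + b * (LINT x|lebesgue_on S. g x * w x)"
proof -
  have "(LINT x|lebesgue_on S. (a * f x + b * g x) * w x) = (LINT x|lebesgue_on S. a * (f x * w x) + b * (g x * w x))"
    by (simp only: distrib_right mult.assoc)
  also have "\<dots> = (LINT x|lebesgue_on S. a * (f x * w x)) + (LINT x|lebesgue_on S. b * (g x * w x))"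
    by (intro Bochner_Integration.integral_add integrable_mult_right L2_space_integrable_mult assms)
  finally show ?thesis by simp
qed

lemma is_weak_grad_lincomb:
  assumes "is_weak_grad bc L u G" "is_weak_grad bc L w W" "u \<in> L2_space (square L)" "w \<in> L2_space (square L)"
  shows "is_weak_grad bc L (\<lambda>x. a * u x + b * w x) (\<lambda>x. a *\<^sub>R G x + b *\<^sub>R W x)"
  unfolding is_weak_grad_def
proof (intro conjI ballI allI)
  have L2: "G \<in> L2_space (square L)" "W \<in> L2_space (square L)"
    using assms by (simp_all add: is_weak_grad_def)
  show "(\<lambda>x. a *\<^sub>R G x + b *\<^sub>R W x) \<in> L2_space (square L)"
    by (rule L2_space_vec_lincomb[OF L2])
  fix \<phi> i assume \<phi>: "\<phi> \<in> test_functions bc L"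
  show "(LINT x|lebesgue_on (square L). (a * u x + b * w x) * partial_deriv i \<phi> x) = - (LINT x|lebesgue_on (square L). (a *\<^sub>R G x + b *\<^sub>R W x) $ i * \<phi> x)"
    using assms(1,2) \<phi> integral_mult_add[OF assms(3,4) partial_deriv_L2[OF test_functions_C1[OF \<phi>]], of a b i]
      integral_mult_add[OF L2_space_vec_nth[OF L2(1)] L2_space_vec_nth[OF L2(2)] test_functions_L2[OF \<phi>], of a i b i]
    by (simp add: is_weak_grad_def algebra_simps)
qed

lemma translate_admissible_both_AE:
  assumes "admissible bc L \<phi>" "0 < h" "h < 2 * L"
  shows "AE x in lebesgue_on (square L).
    translate bc L j 1 \<sigma> h \<phi> x = extended bc j \<sigma> (2 * L) \<phi> (coord_affine j 1 h x) \<and>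
    translate bc L j (-1) \<sigma> h \<phi> x = extended bc j \<sigma> (- (2 * L)) \<phi> (coord_affine j 1 (- h) x)"
proof -
  have "AE x in lebesgue_on (square L). translate bc L j 1 \<sigma> h \<phi> x = extended bc j \<sigma> (2 * L) \<phi> (coord_affine j 1 h x)"
    "AE x in lebesgue_on (square L). translate bc L j (-1) \<sigma> h \<phi> x = extended bc j \<sigma> (- (2 * L)) \<phi> (coord_affine j 1 (- h) x)"
    using translate_admissible_AE[OF assms, of 1 j \<sigma>] translate_admissible_AE[OF assms, of "-1" j \<sigma>] by simp_all
  then show ?thesis by eventually_elim simp
qed

text \<open>Only the sum of the two translates is treated: it is the symmetric combination whose continuation is
  compatible with the boundary condition.\<close>

lemma translate_weak_grad:
  assumes L: "L > 0" and u: "u \<in> L2_space (square L)" and G: "is_weak_grad bc L u G" and h: "0 < h" "h < 2 * L"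
  shows "is_weak_grad bc L (\<lambda>x. translate bc L j 1 1 h u x + translate bc L j (-1) 1 h u x)
    (\<lambda>x. translate_grad bc L j 1 h G x + translate_grad bc L j (-1) h G x)"
  unfolding is_weak_grad_def
proof (intro conjI ballI allI)
  have G2: "G \<in> L2_space (square L)" using G by (simp add: is_weak_grad_def)
  show "(\<lambda>x. translate_grad bc L j 1 h G x + translate_grad bc L j (-1) h G x) \<in> L2_space (square L)"
    using L2_space_vec_lincomb[OF translate_grad_L2[OF G2, of bc j 1 h] translate_grad_L2[OF G2, of bc j "-1" h], of 1 1] by simp
  fix \<phi> i assume \<phi>: "\<phi> \<in> test_functions bc L"
  let ?M = "lebesgue_on (square L)"
  let ?T = "\<lambda>s \<sigma> g. translate bc L j s \<sigma> h g"
  let ?\<psi> = "\<lambda>x. extended bc j (parity i j) (2 * L) \<phi> (coord_affine j 1 h x) + 1 * extended bc j (parity i j) (- (2 * L)) \<phi> (coord_affine j 1 (- h) x)"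
  note C1 = test_functions_C1[OF \<phi>]
  note d2 = partial_deriv_L2[OF C1, of i]
  have Gi: "(\<lambda>x. G x $ i) \<in> L2_space (square L)" by (rule L2_space_vec_nth[OF G2])
  note ibp = translated_test_function_by_parts[OF L u G \<phi> h, where a = 1 and \<sigma> = "parity i j" and i = i and j = j]
  have ibp1: "(LINT x|?M. u x * partial_deriv i ?\<psi> x) = - (LINT x|?M. G x $ i * ?\<psi> x)"
    and C1\<psi>: "C1_fun ?\<psi>"
    and pd: "partial_deriv i ?\<psi> = (\<lambda>x. partial_deriv i (extended bc j (parity i j) (2 * L) \<phi>) (coord_affine j 1 h x) + 1 * partial_deriv i (extended bc j (parity i j) (- (2 * L)) \<phi>) (coord_affine j 1 (- h) x))"
    using ibp by (simp_all add: parity_def)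
  have pe: "partial_deriv i (extended bc j (parity i j) c \<phi>) = extended bc j 1 c (partial_deriv i \<phi>)" for c
    using extended_C1(2)[OF C1, of i bc j "parity i j" c] by (simp add: parity_def[symmetric])
  have AE1: "AE x in ?M. ?T 1 1 (partial_deriv i \<phi>) x + ?T (-1) 1 (partial_deriv i \<phi>) x = partial_deriv i ?\<psi> x"
    using translate_admissible_both_AE[OF test_function_admissible(2)[OF \<phi>, of i] h, of j 1]
    unfolding pd pe by eventually_elim simp
  have AE2: "AE x in ?M. ?T 1 (parity i j) \<phi> x + ?T (-1) (parity i j) \<phi> x = ?\<psi> x"
    using translate_admissible_both_AE[OF test_function_admissible(1)[OF \<phi>] h, of j "parity i j"]
    by eventually_elim simp
  have "(LINT x|?M. (?T 1 1 u x + ?T (-1) 1 u x) * partial_deriv i \<phi> x)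
      = (LINT x|?M. u x * (?T 1 1 (partial_deriv i \<phi>) x + ?T (-1) 1 (partial_deriv i \<phi>) x))"
    by (rule translate_adjoint(1)[OF pairable_L2[OF u d2]])
  also have "\<dots> = (LINT x|?M. u x * partial_deriv i ?\<psi> x)"
    by (rule integral_mult_cong_AE[OF u L2_space_add[OF translate_L2[OF d2] translate_L2[OF d2]] partial_deriv_L2[OF C1\<psi>] AE1])
  also have "\<dots> = - (LINT x|?M. G x $ i * ?\<psi> x)"
    by (rule ibp1)
  also have "(LINT x|?M. G x $ i * ?\<psi> x) = (LINT x|?M. G x $ i * (?T 1 (parity i j) \<phi> x + ?T (-1) (parity i j) \<phi> x))"
    by (rule integral_mult_cong_AE[OF Gi L2_space_add[OF translate_L2 translate_L2] continuous_L2_square[OF C1_fun_continuous[OF C1\<psi>]] AE2, symmetric])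
      (rule test_functions_L2[OF \<phi>])+
  also have "\<dots> = (LINT x|?M. (?T 1 (parity i j) (\<lambda>x. G x $ i) x + ?T (-1) (parity i j) (\<lambda>x. G x $ i) x) * \<phi> x)"
    by (rule translate_adjoint(1)[OF pairable_L2[OF Gi test_functions_L2[OF \<phi>]], symmetric])
  finally show "(LINT x|?M. (?T 1 1 u x + ?T (-1) 1 u x) * partial_deriv i \<phi> x) =
      - (LINT x|?M. (translate_grad bc L j 1 h G x + translate_grad bc L j (-1) h G x) $ i * \<phi> x)"
    by (simp add: translate_grad_def)
qed

lemma translated_difference_pairing:
  assumes g: "g \<in> L2_space (square L)" and \<phi>: "\<phi> \<in> L2_space (square L)"
    and m: "\<And>a. a = 1 \<or> a = -1 \<Longrightarrow> L2_norm (square L) (\<lambda>x. translate bc L j a (- \<sigma>) s g x - g x) \<le> m"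
  shows "\<bar>LINT x|lebesgue_on (square L). g x * (translate bc L j 1 \<sigma> s \<phi> x - translate bc L j (-1) \<sigma> s \<phi> x)\<bar> \<le> 2 * m * L2_norm (square L) \<phi>"
proof -
  let ?M = "lebesgue_on (square L)"
  let ?D = "\<lambda>a x. translate bc L j a (- \<sigma>) s g x - g x"
  have D: "?D a \<in> L2_space (square L)" for a
    by (rule L2_space_diff[OF translate_L2[OF g] g])
  have cs: "\<bar>LINT x|?M. ?D a x * \<phi> x\<bar> \<le> m * L2_norm (square L) \<phi>" if "a = 1 \<or> a = -1" for a
  proof -
    have "\<bar>LINT x|?M. ?D a x * \<phi> x\<bar> \<le> L2_norm (square L) (?D a) * L2_norm (square L) \<phi>"
      by (rule L2_inner_Cauchy_Schwarz[OF square_measurable D \<phi>])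
    also have "\<dots> \<le> m * L2_norm (square L) \<phi>"
      using m[OF that] by (intro mult_right_mono) auto
    finally show ?thesis .
  qed
  have "- (LINT x|?M. g x * (translate bc L j 1 \<sigma> s \<phi> x - translate bc L j (-1) \<sigma> s \<phi> x))
    = (LINT x|?M. (translate bc L j 1 (- \<sigma>) s g x - translate bc L j (-1) (- \<sigma>) s g x) * \<phi> x)"
    by (rule translate_adjoint(2)[OF pairable_L2[OF g \<phi>], symmetric])
  also have "\<dots> = (LINT x|?M. (1 * ?D 1 x + (-1) * ?D (-1) x) * \<phi> x)"
    by simp
  also have "\<dots> = 1 * (LINT x|?M. ?D 1 x * \<phi> x) + (-1) * (LINT x|?M. ?D (-1) x * \<phi> x)"
    by (rule integral_mult_add[OF D D \<phi>])
  finally show ?thesis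
    using cs[of 1] cs[of "-1"] by simp
qed

text \<open>As a function of \<open>h\<close>, the pairing of the sum of the two translates of \<open>u\<close> with \<open>\<phi>\<close> has a derivative in
  which integration by parts produces first differences of the \<open>j\<close>-th component of the gradient. So
  the second difference of \<open>u\<close> is bounded by \<open>h\<close> times the first differences of its gradient.\<close>

lemma second_difference_pairing:
  assumes L: "L > 0" and u: "u \<in> L2_space (square L)" and G: "is_weak_grad bc L u G"
    and \<phi>: "\<phi> \<in> test_functions bc L" and h: "0 < h" "h < 2 * L"
    and m: "\<And>s a. 0 < s \<Longrightarrow> s < h \<Longrightarrow> a = 1 \<or> a = -1 \<Longrightarrow>
      L2_norm (square L) (\<lambda>x. translate bc L j a (-1) s (\<lambda>x. G x $ j) x - G x $ j) \<le> m"
  shows "\<bar>LINT x|lebesgue_on (square L). (translate bc L j 1 1 h u x + translate bc L j (-1) 1 h u x - 2 * u x) * \<phi> x\<bar>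
    \<le> 2 * m * h * L2_norm (square L) \<phi>"
proof -
  let ?M = "lebesgue_on (square L)"
  let ?T = "\<lambda>s \<sigma> g. translate bc L j s \<sigma> h g"
  note C1 = test_functions_C1[OF \<phi>]
  note \<phi>2 = test_functions_L2[OF \<phi>]
  define \<Psi> where "\<Psi> a = extended bc j 1 (a * (2 * L)) \<phi>" for a
  have C1\<Psi>: "C1_fun (\<Psi> a)" for a
    unfolding \<Psi>_def by (rule extended_C1(1)[OF C1])
  have L2\<Psi>: "(\<lambda>x. \<Psi> a (coord_affine j 1 s x)) \<in> L2_space (square L)"
    "(\<lambda>x. partial_deriv j (\<Psi> a) (coord_affine j 1 s x)) \<in> L2_space (square L)" for a s
    using continuous_L2_square[OF C1_fun_continuous[OF C1_fun_coord_affine(1)[OF C1\<Psi>]]]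
      partial_deriv_L2[OF C1_fun_coord_affine(1)[OF C1\<Psi>, of a j 1 s], of j]
    by (simp_all add: C1_fun_coord_affine(2)[OF C1\<Psi>])
  define F where "F s = (LINT x|?M. u x * \<Psi> 1 (coord_affine j 1 s x)) + (LINT x|?M. u x * \<Psi> (-1) (coord_affine j 1 (- s) x))" for s
  define F' where "F' s = (LINT x|?M. u x * partial_deriv j (\<Psi> 1) (coord_affine j 1 s x)) + - (LINT x|?M. u x * partial_deriv j (\<Psi> (-1)) (coord_affine j 1 (- s) x))" for s
  have der: "(F has_real_derivative F' s) (at s)" for s
  proof -
    have minus: "(uminus has_real_derivative -1) (at s)" for s :: real
      by (auto intro!: derivative_eq_intros)
    have "((\<lambda>s. LINT x|?M. u x * \<Psi> (-1) (coord_affine j 1 (- s) x)) has_real_derivative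
        (LINT x|?M. u x * partial_deriv j (\<Psi> (-1)) (coord_affine j 1 (- s) x)) * (-1)) (at s)"
      by (rule DERIV_chain2[OF translated_integral_derivative[OF L u C1\<Psi>] minus])
    then have "((\<lambda>s. LINT x|?M. u x * \<Psi> (-1) (coord_affine j 1 (- s) x)) has_real_derivative
        - (LINT x|?M. u x * partial_deriv j (\<Psi> (-1)) (coord_affine j 1 (- s) x))) (at s)"
      by simp
    from DERIV_add[OF translated_integral_derivative[OF L u C1\<Psi>, of 1 j s] this]
    show ?thesis unfolding F_def F'_def .
  qed
  have F'_bound: "\<bar>F' s\<bar> \<le> 2 * m * L2_norm (square L) \<phi>" if s: "0 < s" "s < h" for s
  proof -
    have s2: "s < 2 * L" using s h by simp
    let ?\<psi> = "\<lambda>x. extended bc j 1 (2 * L) \<phi> (coord_affine j 1 s x) + (-1) * extended bc j 1 (- (2 * L)) \<phi> (coord_affine j 1 (- s) x)"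
    note ibp = translated_test_function_by_parts[OF L u G \<phi> s(1) s2, where a = "-1" and \<sigma> = 1 and i = j and j = j]
    have ibp1: "(LINT x|?M. u x * partial_deriv j ?\<psi> x) = - (LINT x|?M. G x $ j * ?\<psi> x)"
      and C1\<psi>: "C1_fun ?\<psi>"
      and pd: "partial_deriv j ?\<psi> = (\<lambda>x. partial_deriv j (extended bc j 1 (2 * L) \<phi>) (coord_affine j 1 s x) + (-1) * partial_deriv j (extended bc j 1 (- (2 * L)) \<phi>) (coord_affine j 1 (- s) x))"
      using ibp by simp_all
    have Gj: "(\<lambda>x. G x $ j) \<in> L2_space (square L)"
      using G by (auto simp: is_weak_grad_def intro: L2_space_vec_nth)
    have AE2: "AE x in ?M. translate bc L j 1 1 s \<phi> x - translate bc L j (-1) 1 s \<phi> x = ?\<psi> x"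
      using translate_admissible_both_AE[OF test_function_admissible(1)[OF \<phi>] s(1) s2, of j 1]
      by eventually_elim simp
    have "F' s = (LINT x|?M. u x * partial_deriv j ?\<psi> x)"
      unfolding pd F'_def using L2_space_integrable_mult[OF u L2\<Psi>(2)[of 1 s]] L2_space_integrable_mult[OF u L2\<Psi>(2)[of "-1" "- s"]]
      by (simp add: \<Psi>_def right_diff_distrib)
    also have "\<dots> = - (LINT x|?M. G x $ j * ?\<psi> x)" by (rule ibp1)
    also have "(LINT x|?M. G x $ j * ?\<psi> x) = (LINT x|?M. G x $ j * (translate bc L j 1 1 s \<phi> x - translate bc L j (-1) 1 s \<phi> x))"
      by (rule integral_mult_cong_AE[OF Gj L2_space_diff[OF translate_L2[OF \<phi>2] translate_L2[OF \<phi>2]] continuous_L2_square[OF C1_fun_continuous[OF C1\<psi>]] AE2, symmetric])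
    finally show ?thesis
      using translated_difference_pairing[OF Gj \<phi>2, of bc j 1 s m] m[OF s] by simp
  qed
  have F0: "F 0 = 2 * (LINT x|?M. u x * \<phi> x)"
  proof -
    have id: "coord_affine j 1 0 x = x" for x by (simp add: vec_eq_iff coord_affine_nth)
    have "(LINT x|?M. u x * \<Psi> a (coord_affine j 1 0 x)) = (LINT x|?M. u x * \<phi> x)" if "a = 1 \<or> a = -1" for a
      using extended_on_square[OF test_function_admissible(1)[OF \<phi>] that]
      by (intro Bochner_Integration.integral_cong) (auto simp: id \<Psi>_def space_restrict_space)
    from this[of 1] this[of "-1"] show ?thesis by (simp add: F_def)
  qed
  have Fh: "F h = (LINT x|?M. (?T 1 1 u x + ?T (-1) 1 u x) * \<phi> x)"
  proof -
    have AE: "AE x in ?M. ?T 1 1 \<phi> x + ?T (-1) 1 \<phi> x = \<Psi> 1 (coord_affine j 1 h x) + \<Psi> (-1) (coord_affine j 1 (- h) x)"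
      using translate_admissible_both_AE[OF test_function_admissible(1)[OF \<phi>] h, of j 1]
      by eventually_elim (simp add: \<Psi>_def)
    have "F h = (LINT x|?M. u x * (\<Psi> 1 (coord_affine j 1 h x) + \<Psi> (-1) (coord_affine j 1 (- h) x)))"
      unfolding F_def using L2_space_integrable_mult[OF u L2\<Psi>(1)] by (simp add: distrib_left)
    also have "\<dots> = (LINT x|?M. u x * (?T 1 1 \<phi> x + ?T (-1) 1 \<phi> x))"
      by (rule integral_mult_cong_AE[OF u L2_space_add[OF translate_L2[OF \<phi>2] translate_L2[OF \<phi>2]] L2_space_add[OF L2\<Psi>(1) L2\<Psi>(1)] AE, symmetric])
    also have "\<dots> = (LINT x|?M. (?T 1 1 u x + ?T (-1) 1 u x) * \<phi> x)"
      by (rule translate_adjoint(1)[OF pairable_L2[OF u \<phi>2], symmetric])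
    finally show ?thesis .
  qed
  obtain z where z: "0 < z" "z < h" "F h - F 0 = (h - 0) * F' z"
    using MVT2[OF h(1), of F F'] der by blast
  have "(LINT x|?M. (?T 1 1 u x + ?T (-1) 1 u x - 2 * u x) * \<phi> x) = F h - F 0"
    using integral_mult_add[OF L2_space_add[OF translate_L2[OF u, of bc j 1 1 h] translate_L2[OF u, of bc j "-1" 1 h]] u \<phi>2, of 1 "-2"]
    by (simp add: Fh F0)
  also have "\<dots> = h * F' z" using z(3) by simp
  finally have "\<bar>LINT x|?M. (?T 1 1 u x + ?T (-1) 1 u x - 2 * u x) * \<phi> x\<bar> = h * \<bar>F' z\<bar>"
    using h(1) by (simp add: abs_mult)
  also have "\<dots> \<le> h * (2 * m * L2_norm (square L) \<phi>)"
    using F'_bound[OF z(1,2)] h(1) by (intro mult_left_mono) auto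
  finally show ?thesis by (simp add: mult_ac)
qed

text \<open>The Riesz representation gives a function of norm at most \<open>C\<close> with the same pairings, and by the
  fundamental lemma it is \<open>w\<close>.\<close>

lemma L2_norm_le_dual:
  assumes L: "L > 0" and w: "w \<in> L2_space (square L)" and C: "C \<ge> 0"
    and le: "\<And>\<phi>. \<phi> \<in> test_functions bc L \<Longrightarrow> \<bar>LINT x|lebesgue_on (square L). w x * \<phi> x\<bar> \<le> C * L2_norm (square L) \<phi>"
  shows "L2_norm (square L) w \<le> C"
proof -
  let ?M = "lebesgue_on (square L)"
  have int: "integrable ?M (\<lambda>x. w x * \<phi> x)" if "\<phi> \<in> test_functions bc L" for \<phi>
    by (rule L2_space_integrable_mult[OF w test_functions_L2[OF that]])
  have "\<exists>g\<in>L2_space (square L). L2_norm (square L) g \<le> C \<and> (\<forall>\<phi>\<in>test_functions bc L. (LINT x|?M. g x * \<phi> x) = (LINT x|?M. w x * \<phi> x))"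
  proof (rule riesz_L2[OF square_lmeasurable _ test_functions_zero test_functions_add test_functions_scale _ _ le C])
    show "test_functions bc L \<subseteq> L2_space (square L)" using test_functions_L2 by blast
    show "(LINT x|?M. w x * (\<phi> x + \<psi> x)) = (LINT x|?M. w x * \<phi> x) + (LINT x|?M. w x * \<psi> x)"
      if "\<phi> \<in> test_functions bc L" "\<psi> \<in> test_functions bc L" for \<phi> \<psi>
      using int[OF that(1)] int[OF that(2)] by (simp add: distrib_left)
    show "(LINT x|?M. w x * (c * \<phi> x)) = c * (LINT x|?M. w x * \<phi> x)" for c \<phi>
      by (simp add: mult.left_commute)
  qed
  then obtain g where g: "g \<in> L2_space (square L)" "L2_norm (square L) g \<le> C"
    "\<And>\<phi>. \<phi> \<in> test_functions bc L \<Longrightarrow> (LINT x|?M. g x * \<phi> x) = (LINT x|?M. w x * \<phi> x)" by blast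
  have "AE x in ?M. g x - w x = 0"
  proof (rule fundamental_lemma[OF L L2_space_diff[OF g(1) w], of bc])
    fix \<phi> assume \<phi>: "\<phi> \<in> test_functions bc L"
    show "(LINT x|?M. (g x - w x) * \<phi> x) = 0"
      using integral_mult_add[OF g(1) w test_functions_L2[OF \<phi>], of 1 "-1"] g(3)[OF \<phi>] by simp
  qed
  then have "AE x in ?M. g x = w x" by eventually_elim simp
  from L2_norm_cong_AE[OF this g(1) w] g(2) show ?thesis by simp
qed

section \<open>Regularity of points with a subgradient\<close>

definition energy_density :: "real \<Rightarrow> real^2 \<Rightarrow> real" where
  "energy_density \<gamma> v = \<gamma> / 2 * (norm v)\<^sup>2 + \<bar>v $ 1\<bar> + \<bar>v $ 2\<bar>"

lemma norm_sq_real2: "(norm (v :: real^2))\<^sup>2 = (v $ 1)\<^sup>2 + (v $ 2)\<^sup>2"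
  by (simp add: norm_sq_vec sum_2)

lemma energy_density_integrable:
  assumes "G \<in> L2_space (square L)"
  shows "integrable (lebesgue_on (square L)) (\<lambda>x. energy_density \<gamma> (G x))"
proof -
  have "integrable (lebesgue_on (square L)) (\<lambda>x. (norm (G x))\<^sup>2)"
    using assms by (simp add: L2_space_def)
  moreover have "integrable (lebesgue_on (square L)) (\<lambda>x. \<bar>G x $ i\<bar>)" for i
    by (intro integrable_abs L2_integrable_square L2_space_vec_nth[OF assms])
  ultimately show ?thesis
    unfolding energy_density_def by (intro Bochner_Integration.integrable_add integrable_mult_right)
qed

text \<open>The left argument is the mean of the midpoints of \<open>v, a\<close> and of \<open>v, b\<close>. The absolute values are convex,
  and the parallelogram identity gives the gain of the quadratic part.\<close>

lemma energy_density_midpoint: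
  assumes "\<gamma> \<ge> 0"
  shows "energy_density \<gamma> ((1/2) *\<^sub>R v + (1/4) *\<^sub>R (a + b)) \<le> 1/2 * energy_density \<gamma> v + 1/4 * (energy_density \<gamma> a + energy_density \<gamma> b)
    - \<gamma> / 16 * ((norm (a - v))\<^sup>2 + (norm (b - v))\<^sup>2)"
proof -
  have comp: "(1/2 * p + 1/4 * (q + r))\<^sup>2 \<le> 1/2 * p\<^sup>2 + 1/4 * (q\<^sup>2 + r\<^sup>2) - 1/8 * ((q - p)\<^sup>2 + (r - p)\<^sup>2)" for p q r :: real
  proof -
    have "1/2 * p\<^sup>2 + 1/4 * (q\<^sup>2 + r\<^sup>2) - 1/8 * ((q - p)\<^sup>2 + (r - p)\<^sup>2) - (1/2 * p + 1/4 * (q + r))\<^sup>2 = ((q - r) / 4)\<^sup>2"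
      by (simp add: power2_eq_square field_simps)
    also have "\<dots> \<ge> 0" by simp
    finally show ?thesis by simp
  qed
  have abs: "\<bar>1/2 * p + 1/4 * (q + r)\<bar> \<le> 1/2 * \<bar>p\<bar> + 1/4 * (\<bar>q\<bar> + \<bar>r\<bar>)" for p q r :: real
  proof -
    have "\<bar>p/2 + (q/4 + r/4)\<bar> \<le> \<bar>p\<bar>/2 + (\<bar>q\<bar>/4 + \<bar>r\<bar>/4)"
      by linarith
    then show ?thesis by (simp add: add_divide_distrib)
  qed
  let ?w = "(1/2) *\<^sub>R v + (1/4) *\<^sub>R (a + b)"
  have "(norm ?w)\<^sup>2 \<le> 1/2 * (norm v)\<^sup>2 + 1/4 * ((norm a)\<^sup>2 + (norm b)\<^sup>2) - 1/8 * ((norm (a - v))\<^sup>2 + (norm (b - v))\<^sup>2)"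
    using comp[of "v $ 1" "a $ 1" "b $ 1"] comp[of "v $ 2" "a $ 2" "b $ 2"]
    unfolding norm_sq_real2 by (simp add: algebra_simps)
  from mult_left_mono[OF this, of "\<gamma> / 2"] assms
  have "\<gamma> / 2 * (norm ?w)\<^sup>2 \<le> 1/2 * (\<gamma> / 2 * (norm v)\<^sup>2) + 1/4 * (\<gamma> / 2 * (norm a)\<^sup>2 + \<gamma> / 2 * (norm b)\<^sup>2)
    - \<gamma> / 16 * ((norm (a - v))\<^sup>2 + (norm (b - v))\<^sup>2)"
    by (simp add: algebra_simps)
  moreover have "\<bar>?w $ k\<bar> \<le> 1/2 * \<bar>v $ k\<bar> + 1/4 * (\<bar>a $ k\<bar> + \<bar>b $ k\<bar>)" for k
    using abs[of "v $ k" "a $ k" "b $ k"] by simp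
  note this[of 1] this[of 2]
  ultimately show ?thesis
    unfolding energy_density_def by (simp add: algebra_simps)
qed

lemma energy_density_translate_grad:
  assumes "0 < h" "h < 2 * L" "s = 1 \<or> s = -1"
  shows "AE x in lebesgue_on (square L).
    energy_density \<gamma> (translate_grad bc L j s h G x) = translate bc L j s 1 h (\<lambda>x. energy_density \<gamma> (G x)) x"
  using translate_AE[OF assms, of bc j]
proof eventually_elim
  case (elim x)
  then obtain y r where y: "\<And>\<sigma> g. translate bc L j s \<sigma> h g x = (if r then \<sigma> else 1) * g y" by blast
  have "(translate_grad bc L j s h G x $ i)\<^sup>2 = (G y $ i)\<^sup>2" "\<bar>translate_grad bc L j s h G x $ i\<bar> = \<bar>G y $ i\<bar>" for i
    by (auto simp: translate_grad_def y parity_def)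
  then show ?case
    by (simp add: energy_density_def norm_sq_real2 y)
qed

lemma translate_norm_bound:
  assumes h: "0 < h" "h < 2 * L" and s: "s = 1 \<or> s = -1" and \<sigma>: "\<sigma> = 1 \<or> \<sigma> = -1"
    and g: "g \<in> L2_space (square L)"
  shows "(L2_norm (square L) (translate bc L j s \<sigma> h g))\<^sup>2 \<le> 2 * (L2_norm (square L) g)\<^sup>2"
proof -
  let ?M = "lebesgue_on (square L)"
  let ?S = "\<lambda>s. translate bc L j s 1 h (\<lambda>x. (g x)\<^sup>2)"
  have gi: "integrable ?M (\<lambda>x. (g x)\<^sup>2)" by (rule L2_space_integrable_sq[OF g])
  note Si = integral_translate_sum(2)[OF h gi, of bc j _ 1]
  have nonneg: "?S s x \<ge> 0" for s x
    by (cases bc) (auto simp: translate_def shift_def cut_def)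
  have "(LINT x|?M. (translate bc L j s \<sigma> h g x)\<^sup>2) \<le> (LINT x|?M. ?S 1 x + ?S (-1) x)"
  proof (rule integral_mono_AE)
    show "integrable ?M (\<lambda>x. (translate bc L j s \<sigma> h g x)\<^sup>2)"
      by (rule L2_space_integrable_sq[OF translate_L2[OF g]])
    show "integrable ?M (\<lambda>x. ?S 1 x + ?S (-1) x)"
      by (intro Bochner_Integration.integrable_add Si)
    show "AE x in ?M. (translate bc L j s \<sigma> h g x)\<^sup>2 \<le> ?S 1 x + ?S (-1) x"
      using translate_AE[OF h s, of bc j]
    proof eventually_elim
      case (elim x)
      then obtain y r where y: "\<And>\<sigma> g. translate bc L j s \<sigma> h g x = (if r then \<sigma> else 1) * g y" by blast
      have "(translate bc L j s \<sigma> h g x)\<^sup>2 = ?S s x"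
        using \<sigma> by (auto simp: y)
      then show ?case using s nonneg[of 1 x] nonneg[of "-1" x] by auto
    qed
  qed
  also have "\<dots> = 2 * (LINT x|?M. (g x)\<^sup>2)"
    by (rule integral_translate_sum(1)[OF h gi])
  finally show ?thesis by (simp add: L2_norm_def)
qed

text \<open>Test the subgradient inequality with the mean of \<open>u\<close> and its two translates. The translates together
  carry twice the energy of \<open>u\<close>, so strong convexity leaves the squared differences of the gradient on
  the left and the pairing of \<open>f\<close> with the second difference of \<open>u\<close> on the right. The nonsmooth part
  of the energy only has to be convex and invariant under sign changes of the components.\<close>

lemma subdifferential_gap:
  assumes L: "L > 0" and \<gamma>: "\<gamma> > 0" and f: "f \<in> subdifferential (square L) (energy \<gamma> bc L) u"
    and G: "is_weak_grad bc L u G" and h: "0 < h" "h < 2 * L"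
  shows "\<gamma> * ((L2_norm (square L) (\<lambda>x. translate_grad bc L j 1 h G x - G x))\<^sup>2
      + (L2_norm (square L) (\<lambda>x. translate_grad bc L j (-1) h G x - G x))\<^sup>2)
    \<le> 4 * (L2_norm (square L) f * L2_norm (square L) (\<lambda>x. translate bc L j 1 1 h u x + translate bc L j (-1) 1 h u x - 2 * u x))"
proof -
  let ?M = "lebesgue_on (square L)"
  have f2: "f \<in> L2_space (square L)" and u: "u \<in> L2_space (square L)"
    and sub: "\<And>v. v \<in> L2_space (square L) \<Longrightarrow> energy \<gamma> bc L u + ereal (L2_inner (square L) f (\<lambda>x. v x - u x)) \<le> energy \<gamma> bc L v"
    using f by (auto simp: subdifferential_def)
  have G2: "G \<in> L2_space (square L)" using G by (simp add: is_weak_grad_def)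
  define Su where "Su x = translate bc L j 1 1 h u x + translate bc L j (-1) 1 h u x" for x
  define A B where "A = translate_grad bc L j 1 h G" and "B = translate_grad bc L j (-1) h G"
  have Su2: "Su \<in> L2_space (square L)"
    unfolding Su_def[abs_def] by (intro L2_space_add translate_L2 u)
  have AB2: "A \<in> L2_space (square L)" "B \<in> L2_space (square L)"
    unfolding A_def B_def by (intro translate_grad_L2 G2)+
  \<comment> \<open>The competitor: the mean of \<open>u\<close> and the average of its two translates.\<close>
  define v where "v x = 1/2 * u x + 1/4 * Su x" for x
  define H where "H x = (1/2) *\<^sub>R G x + (1/4) *\<^sub>R (A x + B x)" for x
  have v2: "v \<in> L2_space (square L)"
    unfolding v_def[abs_def] by (intro L2_space_add L2_space_scale u Su2)
  have wg: "is_weak_grad bc L v H"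
    unfolding v_def[abs_def] H_def[abs_def] A_def B_def
    using is_weak_grad_lincomb[OF G translate_weak_grad[OF L u G h, of j] u Su2[unfolded Su_def[abs_def]], of "1/2" "1/4"]
    by (simp add: Su_def)
  have H2: "H \<in> L2_space (square L)" using wg by (simp add: is_weak_grad_def)
  define w where "w x = Su x - 2 * u x" for x
  have w2: "w \<in> L2_space (square L)"
    unfolding w_def[abs_def] by (intro L2_space_diff L2_space_scale u Su2)
  define E where "E = (LINT x|?M. energy_density \<gamma> (G x))"
  have "energy \<gamma> bc L u = ereal E" "energy \<gamma> bc L v = ereal (LINT x|?M. energy_density \<gamma> (H x))"
    using energy_pos_eq[OF L \<gamma> u G] energy_pos_eq[OF L \<gamma> v2 wg] by (simp_all add: E_def energy_density_def)
  with sub[OF v2] have 1: "E + L2_inner (square L) f (\<lambda>x. v x - u x) \<le> (LINT x|?M. energy_density \<gamma> (H x))"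
    by simp
  have "L2_inner (square L) f (\<lambda>x. v x - u x) = (LINT x|?M. 1/4 * (f x * w x))"
    unfolding L2_inner_def by (intro Bochner_Integration.integral_cong) (auto simp: v_def w_def algebra_simps)
  also have "\<dots> = 1/4 * (LINT x|?M. f x * w x)" by simp
  finally have inner: "L2_inner (square L) f (\<lambda>x. v x - u x) \<ge> - (1/4 * (L2_norm (square L) f * L2_norm (square L) w))"
    using L2_inner_Cauchy_Schwarz[OF square_measurable f2 w2] by (simp add: abs_le_iff)
  have dA: "(\<lambda>x. A x - G x) \<in> L2_space (square L)" "(\<lambda>x. B x - G x) \<in> L2_space (square L)"
    by (intro L2_space_vec_diff AB2 G2)+
  have sqi: "integrable ?M (\<lambda>x. (norm (A x - G x))\<^sup>2)" "integrable ?M (\<lambda>x. (norm (B x - G x))\<^sup>2)"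
    using dA by (simp_all add: L2_space_def)
  have sqn: "(LINT x|?M. (norm (A x - G x))\<^sup>2) = (L2_norm (square L) (\<lambda>x. A x - G x))\<^sup>2"
    "(LINT x|?M. (norm (B x - G x))\<^sup>2) = (L2_norm (square L) (\<lambda>x. B x - G x))\<^sup>2"
    by (simp_all add: L2_norm_def)
  have dens: "(LINT x|?M. energy_density \<gamma> (A x) + energy_density \<gamma> (B x)) = 2 * E"
  proof -
    note gi = energy_density_integrable[OF G2, of \<gamma>]
    have AE: "AE x in ?M. energy_density \<gamma> (A x) = translate bc L j 1 1 h (\<lambda>x. energy_density \<gamma> (G x)) x"
      "AE x in ?M. energy_density \<gamma> (B x) = translate bc L j (-1) 1 h (\<lambda>x. energy_density \<gamma> (G x)) x"
      unfolding A_def B_def using energy_density_translate_grad[OF h, of 1] energy_density_translate_grad[OF h, of "-1"] by simp_all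
    have "(LINT x|?M. energy_density \<gamma> (A x) + energy_density \<gamma> (B x)) =
      (LINT x|?M. translate bc L j 1 1 h (\<lambda>x. energy_density \<gamma> (G x)) x + translate bc L j (-1) 1 h (\<lambda>x. energy_density \<gamma> (G x)) x)"
    proof (rule integral_cong_AE)
      show "AE x in ?M. energy_density \<gamma> (A x) + energy_density \<gamma> (B x) = translate bc L j 1 1 h (\<lambda>x. energy_density \<gamma> (G x)) x + translate bc L j (-1) 1 h (\<lambda>x. energy_density \<gamma> (G x)) x"
        using AE by eventually_elim simp
    qed (intro borel_measurable_add borel_measurable_integrable energy_density_integrable AB2 integral_translate_sum(2)[OF h gi])+
    also have "\<dots> = 2 * E"
      unfolding E_def by (rule integral_translate_sum(1)[OF h gi])
    finally show ?thesis .
  qed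
  have "(LINT x|?M. energy_density \<gamma> (H x)) \<le> (LINT x|?M. 1/2 * energy_density \<gamma> (G x) + 1/4 * (energy_density \<gamma> (A x) + energy_density \<gamma> (B x))
      - \<gamma> / 16 * ((norm (A x - G x))\<^sup>2 + (norm (B x - G x))\<^sup>2))"
    using \<gamma> unfolding H_def
    by (intro integral_mono energy_density_midpoint Bochner_Integration.integrable_diff Bochner_Integration.integrable_add
        integrable_mult_right energy_density_integrable G2 AB2 sqi H2[unfolded H_def[abs_def]]) auto
  also have "\<dots> = 1/2 * E + 1/4 * (2 * E) - \<gamma> / 16 * ((L2_norm (square L) (\<lambda>x. A x - G x))\<^sup>2 + (L2_norm (square L) (\<lambda>x. B x - G x))\<^sup>2)"
  proof -
    have i: "integrable ?M (\<lambda>x. energy_density \<gamma> (A x) + energy_density \<gamma> (B x))" "integrable ?M (\<lambda>x. energy_density \<gamma> (G x))"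
      by (intro Bochner_Integration.integrable_add energy_density_integrable AB2 G2)+
    have q: "integrable ?M (\<lambda>x. (norm (A x - G x))\<^sup>2 + (norm (B x - G x))\<^sup>2)"
      by (intro Bochner_Integration.integrable_add sqi)
    have "(LINT x|?M. (norm (A x - G x))\<^sup>2 + (norm (B x - G x))\<^sup>2) = (L2_norm (square L) (\<lambda>x. A x - G x))\<^sup>2 + (L2_norm (square L) (\<lambda>x. B x - G x))\<^sup>2"
      using Bochner_Integration.integral_add[OF sqi] by (simp only: sqn)
    then show ?thesis
      by (subst Bochner_Integration.integral_diff, intro Bochner_Integration.integrable_add integrable_mult_right i,
          intro integrable_mult_right q, subst Bochner_Integration.integral_add,
          intro integrable_mult_right i, intro integrable_mult_right i)
        (simp only: integral_mult_right_zero dens E_def[symmetric])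
  qed
  finally have "(LINT x|?M. energy_density \<gamma> (H x)) \<le> E - \<gamma> / 16 * ((L2_norm (square L) (\<lambda>x. A x - G x))\<^sup>2 + (L2_norm (square L) (\<lambda>x. B x - G x))\<^sup>2)"
    by simp
  with 1 inner have "\<gamma> / 16 * ((L2_norm (square L) (\<lambda>x. A x - G x))\<^sup>2 + (L2_norm (square L) (\<lambda>x. B x - G x))\<^sup>2)
    \<le> 1/4 * (L2_norm (square L) f * L2_norm (square L) w)"
    by linarith
  then show ?thesis
    by (simp add: A_def B_def w_def[abs_def] Su_def)
qed

text \<open>Let \<open>m\<close> be the supremum of the gradient differences over all translations of length at most \<open>h\<close>. It
  is finite because translation is bounded in \<open>L\<^sup>2\<close>. The second difference of \<open>u\<close> over a length \<open>s \<le> h\<close> is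
  at most \<open>2 m s\<close>, and \<open>subdifferential_gap\<close> yields \<open>\<gamma> m\<^sup>2 \<le> 8 |f| m h\<close>, where one factor \<open>m\<close> cancels.\<close>

lemma gradient_translation_estimate:
  assumes L: "L > 0" and \<gamma>: "\<gamma> > 0" and f: "f \<in> subdifferential (square L) (energy \<gamma> bc L) u"
    and G: "is_weak_grad bc L u G" and h: "0 < h" "h < 2 * L" and a: "a = 1 \<or> a = -1"
  shows "L2_norm (square L) (\<lambda>x. translate bc L j a (parity i j) h (\<lambda>x. G x $ i) x - G x $ i) \<le> 8 * L2_norm (square L) f / \<gamma> * h"
proof -
  let ?N = "L2_norm (square L)"
  have u: "u \<in> L2_space (square L)" using f by (simp add: subdifferential_def)
  have G2: "G \<in> L2_space (square L)" using G by (simp add: is_weak_grad_def)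
  define D where "D s i a = ?N (\<lambda>x. translate bc L j a (parity i j) s (\<lambda>x. G x $ i) x - G x $ i)" for s i a
  have D0: "D s i a \<ge> 0" for s i a by (simp add: D_def)
  define b where "b s = sqrt ((?N (\<lambda>x. translate_grad bc L j 1 s G x - G x))\<^sup>2 + (?N (\<lambda>x. translate_grad bc L j (-1) s G x - G x))\<^sup>2)" for s
  have b0: "b s \<ge> 0" for s by (simp add: b_def)
  have Dsq: "(?N (\<lambda>x. translate_grad bc L j a s G x - G x))\<^sup>2 = (D s 1 a)\<^sup>2 + (D s 2 a)\<^sup>2" for s a
    using L2_norm_vec[OF L2_space_vec_diff[OF translate_grad_L2[OF G2, of bc j a s] G2]]
    by (simp add: sum_2 D_def translate_grad_def)
  have D_le: "D s i a \<le> b s" if "a = 1 \<or> a = -1" for s i a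
  proof -
    have "(D s i a)\<^sup>2 \<le> (b s)\<^sup>2"
      using that exhaust_2[of i] by (auto simp: b_def Dsq)
    then show ?thesis using b0 by (rule power2_le_imp_le)
  qed
  \<comment> \<open>A crude bound suffices here; its only purpose is to make the supremum \<open>m\<close> finite.\<close>
  have bdd: "bdd_above (b ` {0<..h})"
  proof (rule bdd_aboveI)
    define C where "C = (?N (\<lambda>x. G x $ 1))\<^sup>2 + (?N (\<lambda>x. G x $ 2))\<^sup>2"
    fix y assume "y \<in> b ` {0<..h}"
    then obtain s where s: "0 < s" "s \<le> h" "y = b s" by auto
    have le: "(D s i a)\<^sup>2 \<le> 8 * C" if a: "a = 1 \<or> a = -1" for i a
    proof -
      let ?g = "\<lambda>x. G x $ i"
      let ?t = "translate bc L j a (parity i j) s ?g"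
      have g2: "?g \<in> L2_space (square L)" by (rule L2_space_vec_nth[OF G2])
      have "(?N ?t)\<^sup>2 \<le> 2 * (?N ?g)\<^sup>2"
        using s h by (intro translate_norm_bound a g2) (auto simp: parity_def)
      moreover have "(D s i a)\<^sup>2 \<le> 2 * (?N ?t)\<^sup>2 + 2 * (?N ?g)\<^sup>2"
      proof -
        have "D s i a = norm (emb (square L) ?t - emb (square L) ?g)"
          unfolding D_def by (subst emb_diff[symmetric]) (simp_all add: norm_emb L2_space_diff translate_L2 g2)
        also have "\<dots> \<le> ?N ?t + ?N ?g"
          by (rule order_trans[OF norm_triangle_ineq4]) (simp add: norm_emb translate_L2 g2)
        finally have "(D s i a)\<^sup>2 \<le> (?N ?t + ?N ?g)\<^sup>2"
          using D0 by (intro power_mono) auto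
        also have "\<dots> \<le> 2 * (?N ?t)\<^sup>2 + 2 * (?N ?g)\<^sup>2"
          using sum_squares_bound[of "?N ?t" "?N ?g"] by (simp add: power2_sum)
        finally show ?thesis .
      qed
      moreover have "(?N ?g)\<^sup>2 \<le> C" using exhaust_2[of i] by (auto simp: C_def)
      moreover have "0 \<le> C" by (simp add: C_def)
      ultimately show ?thesis by linarith
    qed
    have "(b s)\<^sup>2 \<le> 32 * C"
      using le[of 1 1] le[of 1 2] le[of "-1" 1] le[of "-1" 2] by (simp add: b_def Dsq)
    then show "y \<le> sqrt (32 * C)"
      using s(3) b0[of s] by (simp add: real_le_rsqrt)
  qed
  define m where "m = Sup (b ` {0<..h})"
  have b_le: "b s \<le> m" if "0 < s" "s \<le> h" for s
    unfolding m_def using bdd that by (intro cSup_upper) auto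
  have m0: "m \<ge> 0" using b_le[OF h(1)] b0[of h] by simp
  let ?F = "?N f"
  have step: "(b s)\<^sup>2 \<le> 8 * ?F * m * h / \<gamma>" if s: "0 < s" "s \<le> h" for s
  proof -
    have s2: "s < 2 * L" using s h by simp
    let ?w = "\<lambda>x. translate bc L j 1 1 s u x + translate bc L j (-1) 1 s u x - 2 * u x"
    have "?N ?w \<le> 2 * m * s"
    proof (rule L2_norm_le_dual[OF L])
      show "?w \<in> L2_space (square L)"
        by (intro L2_space_diff L2_space_add L2_space_scale translate_L2 u)
      show "0 \<le> 2 * m * s" using m0 s by simp
      fix \<phi> assume \<phi>: "\<phi> \<in> test_functions bc L"
      show "\<bar>LINT x|lebesgue_on (square L). ?w x * \<phi> x\<bar> \<le> 2 * m * s * ?N \<phi>"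
      proof (rule second_difference_pairing[OF L u G \<phi> s(1) s2])
        fix t a :: real assume t: "0 < t" "t < s" and a: "a = 1 \<or> a = -1"
        have "D t j a \<le> m" using D_le[OF a, of t j] b_le[of t] t s by simp
        then show "?N (\<lambda>x. translate bc L j a (-1) t (\<lambda>x. G x $ j) x - G x $ j) \<le> m"
          by (simp add: D_def parity_def)
      qed
    qed
    also have "\<dots> \<le> 2 * m * h" using m0 s by (intro mult_left_mono) auto
    finally have w: "?N ?w \<le> 2 * m * h" .
    have "\<gamma> * (b s)\<^sup>2 \<le> 4 * (?F * ?N ?w)"
      using subdifferential_gap[OF L \<gamma> f G s(1) s2, of j] by (simp add: b_def)
    also have "\<dots> \<le> 4 * (?F * (2 * m * h))"
      using w by (intro mult_left_mono) auto
    finally show ?thesis using \<gamma> by (simp add: field_simps)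
  qed
  have "m \<le> sqrt (8 * ?F * m * h / \<gamma>)"
    unfolding m_def
  proof (rule cSup_least)
    show "b ` {0<..h} \<noteq> {}" using h by auto
    fix y assume "y \<in> b ` {0<..h}"
    then show "y \<le> sqrt (8 * ?F * Sup (b ` {0<..h}) * h / \<gamma>)"
      using step[folded m_def] b0 unfolding m_def[symmetric] by (auto intro!: real_le_rsqrt)
  qed
  from power_mono[OF this m0, of 2] have "m\<^sup>2 \<le> (sqrt (8 * ?F * m * h / \<gamma>))\<^sup>2" .
  also have "\<dots> = 8 * ?F * m * h / \<gamma>"
    using m0 h \<gamma> by (intro real_sqrt_pow2) simp
  finally have mm: "m * m \<le> (8 * ?F / \<gamma> * h) * m"
    by (simp add: power2_eq_square mult_ac)
  have m: "m \<le> 8 * ?F / \<gamma> * h"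
  proof (cases "m = 0")
    case False
    then have "m > 0" using m0 by simp
    from mult_right_le_imp_le[OF mm this] show ?thesis .
  qed (use h \<gamma> in simp)
  have "D h i a \<le> m" using D_le[OF a, of h i] b_le[of h] h by simp
  with m show ?thesis by (simp add: D_def)
qed

text \<open>The difference quotients of \<open>g\<close> are bounded, so integration by parts in its discrete form bounds
  the functional \<open>\<phi> \<mapsto> - \<integral> g \<partial>\<^sub>j \<phi>\<close> by the norm of \<open>\<phi>\<close>, and the Riesz representation of this functional is
  the weak derivative. The test function is continued with the sign opposite to that of \<open>g\<close>.\<close>

lemma weak_derivative_exists:
  assumes L: "L > 0" and g: "g \<in> L2_space (square L)" and c: "c \<ge> 0"
    and est: "\<And>a h j. a = 1 \<or> a = -1 \<Longrightarrow> 0 < h \<Longrightarrow> h < 2 * L \<Longrightarrow>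
      L2_norm (square L) (\<lambda>x. translate bc L j a (\<sigma> j) h g x - g x) \<le> c * h"
  shows "\<exists>G. is_weak_grad bc L g G \<and> (\<forall>j. L2_norm (square L) (\<lambda>x. G x $ j) \<le> c)"
proof -
  let ?M = "lebesgue_on (square L)" and ?N = "L2_norm (square L)"
  have bound: "\<bar>LINT x|?M. g x * partial_deriv j \<phi> x\<bar> \<le> c * ?N \<phi>" if \<phi>: "\<phi> \<in> test_functions bc L" for \<phi> j
  proof -
    note C1 = test_functions_C1[OF \<phi>] and \<phi>2 = test_functions_L2[OF \<phi>]
    \<comment> \<open>The difference of \<open>\<Psi> 1\<close>, translated by \<open>s\<close>, and \<open>\<Psi> (-1)\<close>, translated by \<open>- s\<close>, vanishes on the
        square for \<open>s = 0\<close> and has there the derivative \<open>2 \<partial>\<^sub>j \<phi>\<close> in \<open>s\<close>.\<close>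
    define \<Psi> where "\<Psi> a = extended bc j (- \<sigma> j) (a * (2 * L)) \<phi>" for a
    have C1\<Psi>: "C1_fun (\<Psi> a)" for a
      unfolding \<Psi>_def by (rule extended_C1(1)[OF C1])
    have L2\<Psi>: "(\<lambda>x. \<Psi> a (coord_affine j 1 s x)) \<in> L2_space (square L)" for a s
      by (rule continuous_L2_square[OF C1_fun_continuous[OF C1_fun_coord_affine(1)[OF C1\<Psi>]]])
    define F where "F s = (LINT x|?M. g x * \<Psi> 1 (coord_affine j 1 s x)) - (LINT x|?M. g x * \<Psi> (-1) (coord_affine j 1 (- s) x))" for s
    have id: "coord_affine j 1 0 x = x" for x by (simp add: vec_eq_iff coord_affine_nth)
    have on_square: "(LINT x|?M. g x * \<Psi> a (coord_affine j 1 0 x)) = (LINT x|?M. g x * \<phi> x)"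
      "(LINT x|?M. g x * partial_deriv j (\<Psi> a) (coord_affine j 1 0 x)) = (LINT x|?M. g x * partial_deriv j \<phi> x)"
      if "a = 1 \<or> a = -1" for a
    proof -
      have e: "\<Psi> a x = \<phi> x" "partial_deriv j (\<Psi> a) x = partial_deriv j \<phi> x" if x: "x \<in> square L" for x
        unfolding \<Psi>_def extended_C1(2)[OF C1]
        by (rule extended_on_square[OF test_function_admissible(1)[OF \<phi>] \<open>a = 1 \<or> a = -1\<close> x]
            extended_on_square[OF test_function_admissible(2)[OF \<phi>] \<open>a = 1 \<or> a = -1\<close> x])+
      show "(LINT x|?M. g x * \<Psi> a (coord_affine j 1 0 x)) = (LINT x|?M. g x * \<phi> x)"
        by (rule Bochner_Integration.integral_cong) (simp_all add: id e space_restrict_space)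
      show "(LINT x|?M. g x * partial_deriv j (\<Psi> a) (coord_affine j 1 0 x)) = (LINT x|?M. g x * partial_deriv j \<phi> x)"
        by (rule Bochner_Integration.integral_cong) (simp_all add: id e space_restrict_space)
    qed
    have "(F has_real_derivative 2 * (LINT x|?M. g x * partial_deriv j \<phi> x)) (at 0)"
    proof -
      have minus: "(uminus has_real_derivative -1) (at s)" for s :: real
        by (auto intro!: derivative_eq_intros)
      note d = translated_integral_derivative[OF L g C1\<Psi>]
      have "((\<lambda>s. LINT x|?M. g x * \<Psi> (-1) (coord_affine j 1 (- s) x)) has_real_derivative
          (LINT x|?M. g x * partial_deriv j (\<Psi> (-1)) (coord_affine j 1 (- 0) x)) * (-1)) (at 0)"
        by (rule DERIV_chain2[OF d minus])
      from DERIV_diff[OF d[of 1 j 0] this] show ?thesis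
        unfolding F_def[abs_def] by (simp add: on_square)
    qed
    moreover have "F 0 = 0" using on_square(1)[of 1] on_square(1)[of "-1"] by (simp add: F_def)
    ultimately have "((\<lambda>h. F h / h) \<longlongrightarrow> 2 * (LINT x|?M. g x * partial_deriv j \<phi> x)) (at 0)"
      by (simp add: DERIV_def)
    then have "((\<lambda>h. F h / h) \<longlongrightarrow> 2 * (LINT x|?M. g x * partial_deriv j \<phi> x)) (at_right 0)"
      by (rule tendsto_within_subset) simp
    then have "((\<lambda>h. \<bar>F h / h\<bar>) \<longlongrightarrow> \<bar>2 * (LINT x|?M. g x * partial_deriv j \<phi> x)\<bar>) (at_right 0)"
      by (rule tendsto_rabs)
    moreover have "\<forall>\<^sub>F h in at_right 0. \<bar>F h / h\<bar> \<le> 2 * c * ?N \<phi>"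
    proof -
      have "\<forall>\<^sub>F h in at_right 0. h \<in> {0<..<2 * L}"
        using L by (intro eventually_at_right_real) simp
      then show ?thesis
      proof eventually_elim
        case (elim h)
        then have h: "0 < h" "h < 2 * L" by auto
        have AE: "AE x in ?M. translate bc L j 1 (- \<sigma> j) h \<phi> x - translate bc L j (-1) (- \<sigma> j) h \<phi> x
            = \<Psi> 1 (coord_affine j 1 h x) - \<Psi> (-1) (coord_affine j 1 (- h) x)"
          using translate_admissible_both_AE[OF test_function_admissible(1)[OF \<phi>] h, of j "- \<sigma> j"]
          by eventually_elim (simp add: \<Psi>_def)
        have "F h = (LINT x|?M. g x * (\<Psi> 1 (coord_affine j 1 h x) - \<Psi> (-1) (coord_affine j 1 (- h) x)))"
          unfolding F_def using L2_space_integrable_mult[OF g L2\<Psi>] by (simp add: right_diff_distrib)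
        also have "\<dots> = (LINT x|?M. g x * (translate bc L j 1 (- \<sigma> j) h \<phi> x - translate bc L j (-1) (- \<sigma> j) h \<phi> x))"
          by (rule integral_mult_cong_AE[OF g L2_space_diff[OF translate_L2[OF \<phi>2] translate_L2[OF \<phi>2]] L2_space_diff[OF L2\<Psi> L2\<Psi>] AE, symmetric])
        finally have Fh: "F h = (LINT x|?M. g x * (translate bc L j 1 (- \<sigma> j) h \<phi> x - translate bc L j (-1) (- \<sigma> j) h \<phi> x))" .
        have "\<bar>F h\<bar> \<le> 2 * (c * h) * ?N \<phi>"
          unfolding Fh
        proof (rule translated_difference_pairing[OF g \<phi>2])
          fix a :: real assume "a = 1 \<or> a = -1"
          from est[OF this h, of j] show "?N (\<lambda>x. translate bc L j a (- (- \<sigma> j)) h g x - g x) \<le> c * h"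
            by simp
        qed
        then show ?case
          using h by (simp add: abs_divide pos_divide_le_eq mult_ac)
      qed
    qed
    ultimately have "\<bar>2 * (LINT x|?M. g x * partial_deriv j \<phi> x)\<bar> \<le> 2 * c * ?N \<phi>"
      by (rule tendsto_upperbound) simp
    then show ?thesis by simp
  qed
  have int: "integrable ?M (\<lambda>x. g x * partial_deriv j \<phi> x)" if "\<phi> \<in> test_functions bc L" for \<phi> j
    by (rule L2_space_integrable_mult[OF g partial_deriv_L2[OF test_functions_C1[OF that]]])
  have "\<exists>k\<in>L2_space (square L). ?N k \<le> c \<and> (\<forall>\<phi>\<in>test_functions bc L. (LINT x|?M. k x * \<phi> x) = - (LINT x|?M. g x * partial_deriv j \<phi> x))" for j
  proof (rule riesz_L2[OF square_lmeasurable _ test_functions_zero test_functions_add test_functions_scale _ _ _ c])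
    show "test_functions bc L \<subseteq> L2_space (square L)" using test_functions_L2 by blast
    show "- (LINT x|?M. g x * partial_deriv j (\<lambda>x. \<phi> x + \<psi> x) x) = - (LINT x|?M. g x * partial_deriv j \<phi> x) + - (LINT x|?M. g x * partial_deriv j \<psi> x)"
      if "\<phi> \<in> test_functions bc L" "\<psi> \<in> test_functions bc L" for \<phi> \<psi>
      using int[OF that(1)] int[OF that(2)] by (simp add: C1_fun_add(2)[OF test_functions_C1 test_functions_C1, OF that] distrib_left)
    show "- (LINT x|?M. g x * partial_deriv j (\<lambda>x. a * \<phi> x) x) = a * - (LINT x|?M. g x * partial_deriv j \<phi> x)"
      if "\<phi> \<in> test_functions bc L" for a \<phi>
      by (simp add: C1_fun_scale(2)[OF test_functions_C1[OF that]] mult.left_commute)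
    show "\<bar>- (LINT x|?M. g x * partial_deriv j \<phi> x)\<bar> \<le> c * ?N \<phi>" if "\<phi> \<in> test_functions bc L" for \<phi>
      using bound[OF that] by simp
  qed
  then have "\<forall>j. \<exists>k. k \<in> L2_space (square L) \<and> ?N k \<le> c \<and>
      (\<forall>\<phi>\<in>test_functions bc L. (LINT x|?M. k x * \<phi> x) = - (LINT x|?M. g x * partial_deriv j \<phi> x))"
    by blast
  from choice[OF this] obtain k where k: "\<And>j. k j \<in> L2_space (square L)" "\<And>j. ?N (k j) \<le> c"
    "\<And>j \<phi>. \<phi> \<in> test_functions bc L \<Longrightarrow> (LINT x|?M. k j x * \<phi> x) = - (LINT x|?M. g x * partial_deriv j \<phi> x)"
    by blast
  have "(\<lambda>x. \<chi> j. k j x) \<in> L2_space (square L)"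
    by (rule L2_space_vecI) (simp add: k(1))
  then show ?thesis
    using k(2,3) by (intro exI[of _ "\<lambda>x. \<chi> j. k j x"]) (simp add: is_weak_grad_def)
qed

text \<open>Each of the four second derivatives has norm at most \<open>8 |f| / \<gamma>\<close>, so the Frobenius norm of the
  Hessian is at most twice that.\<close>

theorem H2_regularity:
  assumes L: "L > 0" and \<gamma>: "\<gamma> > 0" and f: "f \<in> subdifferential (square L) (energy \<gamma> bc L) u"
  shows "u \<in> H2_space bc L"
    and "(\<lambda>x. \<gamma> *\<^sub>R weak_hessian bc L u x) \<in> L2_space (square L)"
    and "L2_norm (square L) (\<lambda>x. \<gamma> *\<^sub>R weak_hessian bc L u x) \<le> 16 * L2_norm (square L) f"
proof -
  let ?N = "L2_norm (square L)"
  have u: "u \<in> L2_space (square L)" and fin: "energy \<gamma> bc L u < \<infinity>"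
    using f by (simp_all add: subdifferential_def)
  have u1: "u \<in> H1_space bc L"
    using fin \<gamma> by (auto simp: energy_def split: if_splits)
  let ?G = "weak_grad bc L u"
  note G = weak_grad_works[OF u1]
  have G2: "?G \<in> L2_space (square L)" using G by (simp add: is_weak_grad_def)
  define c where "c = 8 * ?N f / \<gamma>"
  have c: "c \<ge> 0" using \<gamma> by (simp add: c_def)
  have ex: "\<exists>H. is_weak_grad bc L (\<lambda>x. ?G x $ i) H \<and> (\<forall>j. ?N (\<lambda>x. H x $ j) \<le> c)" for i
    using gradient_translation_estimate[OF L \<gamma> f G] unfolding c_def[symmetric]
    by (intro weak_derivative_exists[OF L L2_space_vec_nth[OF G2] c, where \<sigma> = "parity i"]) blast
  have Gi: "(\<lambda>x. ?G x $ i) \<in> H1_space bc L" for i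
    using ex[of i] L2_space_vec_nth[OF G2] by (auto simp: H1_space_def)
  then show u2: "u \<in> H2_space bc L" using u1 by (simp add: H2_space_def)
  let ?H = "\<lambda>i. weak_grad bc L (\<lambda>x. ?G x $ i)"
  have H2: "?H i \<in> L2_space (square L)" for i
    using weak_grad_works[OF Gi] by (simp add: is_weak_grad_def)
  have Hij: "?N (\<lambda>x. ?H i x $ j) \<le> c" for i j
  proof -
    obtain H where H: "is_weak_grad bc L (\<lambda>x. ?G x $ i) H" "?N (\<lambda>x. H x $ j) \<le> c"
      using ex by blast
    have "AE x in lebesgue_on (square L). ?H i x $ j = H x $ j"
      using weak_grad_unique[OF L weak_grad_works[OF Gi] H(1)] by eventually_elim simp
    from L2_norm_cong_AE[OF this L2_space_vec_nth[OF H2] L2_space_vec_nth] H show ?thesis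
      by (simp add: is_weak_grad_def)
  qed
  define W where "W x = \<gamma> *\<^sub>R weak_hessian bc L u x" for x
  have Wnth: "W x $ i = \<gamma> *\<^sub>R ?H i x" for x i
    by (simp add: W_def weak_hessian_def)
  have Wi: "(\<lambda>x. W x $ i) \<in> L2_space (square L)" for i
    unfolding Wnth by (rule L2_space_vecI) (simp add: L2_space_scale L2_space_vec_nth[OF H2])
  then have W: "W \<in> L2_space (square L)" by (rule L2_space_vecI)
  then show "(\<lambda>x. \<gamma> *\<^sub>R weak_hessian bc L u x) \<in> L2_space (square L)"
    by (simp add: W_def[abs_def])
  have entry: "(?N (\<lambda>x. W x $ i $ j))\<^sup>2 \<le> (8 * ?N f)\<^sup>2" for i j
  proof -
    have "?N (\<lambda>x. W x $ i $ j) = \<gamma> * ?N (\<lambda>x. ?H i x $ j)"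
      using norm_emb[OF square_measurable L2_space_scale[OF L2_space_vec_nth[OF H2]], of \<gamma> i j]
        emb_scale[OF square_measurable L2_space_vec_nth[OF H2], of \<gamma> i j] norm_emb[OF square_measurable L2_space_vec_nth[OF H2], of i j] \<gamma>
      by (simp add: Wnth)
    also have "\<dots> \<le> \<gamma> * c" using Hij \<gamma> by (intro mult_left_mono) auto
    also have "\<dots> = 8 * ?N f" using \<gamma> by (simp add: c_def)
    finally show ?thesis by (intro power_mono) auto
  qed
  have "(?N W)\<^sup>2 = (\<Sum>i\<in>UNIV. \<Sum>j\<in>UNIV. (?N (\<lambda>x. W x $ i $ j))\<^sup>2)"
    using L2_norm_vec[OF W] L2_norm_vec[OF Wi] by simp
  also have "\<dots> \<le> 4 * (8 * ?N f)\<^sup>2"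
    using entry[of 1 1] entry[of 1 2] entry[of 2 1] entry[of 2 2] by (simp add: sum_2)
  also have "\<dots> = (16 * ?N f)\<^sup>2" by (simp add: power_mult_distrib)
  finally have "?N W \<le> 16 * ?N f"
    by (rule power2_le_imp_le) simp
  then show "?N (\<lambda>x. \<gamma> *\<^sub>R weak_hessian bc L u x) \<le> 16 * ?N f"
    by (simp add: W_def[abs_def])
qed

section \<open>Sampling a right-continuous curve\<close>

text \<open>The first multiple of \<open>1 / (n + 1)\<close> beyond \<open>t\<close>. Sampling strictly to the right of \<open>t\<close> fits curves that
  are continuous from the right, and turns the integral of a decreasing function into a lower sum.\<close>

definition next_grid :: "nat \<Rightarrow> real \<Rightarrow> real" where
  "next_grid n t = (real (nat \<lfloor>real (Suc n) * t\<rfloor>) + 1) / real (Suc n)"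

lemma next_grid_bounds:
  assumes "t \<ge> 0"
  shows "t < next_grid n t" "next_grid n t \<le> t + 1 / real (Suc n)"
proof -
  define k where "k = nat \<lfloor>real (Suc n) * t\<rfloor>"
  have k: "real k \<le> real (Suc n) * t" "real (Suc n) * t < real k + 1"
    using assms by (auto simp: k_def simp del: of_nat_Suc)
  show "t < next_grid n t"
    unfolding next_grid_def k_def[symmetric]
    using k(2) by (simp add: pos_less_divide_eq mult.commute[of t] del: of_nat_Suc)
  have "(real k + 1) / real (Suc n) \<le> (real (Suc n) * t + 1) / real (Suc n)"
    using k(1) by (intro divide_right_mono) auto
  also have "\<dots> = t + 1 / real (Suc n)" by (simp add: add_divide_distrib del: of_nat_Suc)
  finally show "next_grid n t \<le> t + 1 / real (Suc n)" by (simp add: next_grid_def k_def)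
qed

lemma next_grid_pos: "0 < next_grid n t"
  by (simp add: next_grid_def add_nonneg_pos del: of_nat_Suc)

lemma next_grid_limit:
  assumes "t \<ge> 0"
  shows "filterlim (\<lambda>n. next_grid n t - t) (at_right 0) sequentially"
proof (rule tendsto_imp_filterlim_at_right)
  show "\<forall>\<^sub>F n in sequentially. 0 < next_grid n t - t"
    using next_grid_bounds(1)[OF assms] by simp
  show "(\<lambda>n. next_grid n t - t) \<longlonglongrightarrow> 0"
  proof (rule tendsto_sandwich[OF _ _ tendsto_const LIMSEQ_inverse_real_of_nat])
    show "\<forall>\<^sub>F n in sequentially. 0 \<le> next_grid n t - t"
      using next_grid_bounds(1)[OF assms] by (simp add: less_imp_le)
    show "\<forall>\<^sub>F n in sequentially. next_grid n t - t \<le> inverse (real (Suc n))"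
      using next_grid_bounds(2)[OF assms] by (simp add: inverse_eq_divide algebra_simps del: of_nat_Suc)
  qed
qed

lemma next_grid_converges:
  fixes V :: "real \<Rightarrow> 'a::topological_space"
  assumes "t \<ge> 0" "((\<lambda>h. V (t + h)) \<longlongrightarrow> V t) (at_right 0)"
  shows "(\<lambda>n. V (next_grid n t)) \<longlonglongrightarrow> V t"
  using filterlim_compose[OF assms(2) next_grid_limit[OF assms(1)]] by simp

text \<open>The sampled function takes countably many values in its first argument, so each slice may be
  measurable separately.\<close>

lemma measurable_next_grid:
  fixes F :: "real \<Rightarrow> 'b \<Rightarrow> 'c::topological_space"
  assumes "\<And>t. t > 0 \<Longrightarrow> F t \<in> borel_measurable M" and f: "f \<in> borel_measurable M"
  shows "(\<lambda>x. F (next_grid n (f x)) x) \<in> borel_measurable M"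
proof -
  have "(\<lambda>x. F ((real (nat \<lfloor>real (Suc n) * f x\<rfloor>) + 1) / real (Suc n)) x) \<in> borel_measurable M"
  proof (rule measurable_compose_countable[where f = "\<lambda>k x. F ((real k + 1) / real (Suc n)) x" and g = "\<lambda>x. nat \<lfloor>real (Suc n) * f x\<rfloor>"])
    show "(\<lambda>x. F ((real k + 1) / real (Suc n)) x) \<in> borel_measurable M" for k
      using assms(1)[of "(real k + 1) / real (Suc n)"] by (simp add: add_nonneg_pos del: of_nat_Suc)
    show "(\<lambda>x. nat \<lfloor>real (Suc n) * f x\<rfloor>) \<in> M \<rightarrow>\<^sub>M count_space UNIV"
      using f by measurable
  qed
  then show ?thesis by (simp add: next_grid_def)
qed

context subgradient_flow
begin

text \<open>The energy lost in one grid interval dominates the length of the interval times the squared speed at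
  its right end, and these losses telescope.\<close>

lemma speed_sampled_integral:
  assumes nonneg: "\<And>t. t \<ge> 0 \<Longrightarrow> \<phi> t \<ge> 0"
  shows "(\<integral>\<^sup>+t. ennreal ((indicator {0<..} t * norm (V (next_grid n t)))\<^sup>2) \<partial>lborel) \<le> ennreal (\<phi> 0)"
proof -
  let ?n = "real (Suc n)"
  have n: "?n > 0" by simp
  define c where "c k = (norm (V ((real k + 1) / ?n)))\<^sup>2" for k
  \<comment> \<open>On \<open>A k\<close> the grid point in use is the right end of the interval.\<close>
  define A where "A k = {real k / ?n ..< (real k + 1) / ?n}" for k
  have "(\<integral>\<^sup>+t. ennreal ((indicator {0<..} t * norm (V (next_grid n t)))\<^sup>2) \<partial>lborel)
    \<le> (\<integral>\<^sup>+t. (\<Sum>k. ennreal (c k) * indicator (A k) t) \<partial>lborel)"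
  proof (rule nn_integral_mono)
    fix t :: real
    show "ennreal ((indicator {0<..} t * norm (V (next_grid n t)))\<^sup>2) \<le> (\<Sum>k. ennreal (c k) * indicator (A k) t)"
    proof (cases "t > 0")
      case True
      define k where "k = nat \<lfloor>?n * t\<rfloor>"
      have k: "real k \<le> ?n * t" "?n * t < real k + 1"
        using True by (auto simp: k_def simp del: of_nat_Suc)
      then have "t \<in> A k"
        using n by (simp add: A_def pos_divide_le_eq pos_less_divide_eq mult.commute del: of_nat_Suc)
      then have "ennreal ((indicator {0<..} t * norm (V (next_grid n t)))\<^sup>2) = ennreal (c k) * indicator (A k) t"
        using True by (simp add: c_def next_grid_def k_def del: of_nat_Suc)
      also have "\<dots> \<le> (\<Sum>j<Suc k. ennreal (c j) * indicator (A j) t)"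
        by (rule member_le_sum) auto
      also have "\<dots> \<le> (\<Sum>k. ennreal (c k) * indicator (A k) t)"
        unfolding suminf_eq_SUP by (rule SUP_upper) simp
      finally show ?thesis .
    qed simp
  qed
  also have "\<dots> = (\<Sum>k. \<integral>\<^sup>+t. ennreal (c k) * indicator (A k) t \<partial>lborel)"
    by (rule nn_integral_suminf) (simp add: A_def)
  also have "\<dots> = (\<Sum>k. ennreal (c k * (1 / ?n)))"
  proof (rule suminf_cong)
    fix k
    have "(\<integral>\<^sup>+t. ennreal (c k) * indicator (A k) t \<partial>lborel) = ennreal (c k) * emeasure lborel (A k)"
      by (rule nn_integral_cmult_indicator) (simp add: A_def)
    also have "emeasure lborel (A k) = ennreal (1 / ?n)"
      using n unfolding A_def by (subst emeasure_lborel_Ico) (auto simp: divide_right_mono add_divide_distrib simp del: of_nat_Suc)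
    also have "ennreal (c k) * ennreal (1 / ?n) = ennreal (c k * (1 / ?n))"
      by (rule ennreal_mult[symmetric]) (simp_all add: c_def)
    finally show "(\<integral>\<^sup>+t. ennreal (c k) * indicator (A k) t \<partial>lborel) = ennreal (c k * (1 / ?n))" .
  qed
  also have "\<dots> \<le> ennreal (\<phi> 0)"
    unfolding suminf_eq_SUP
  proof (rule SUP_least)
    fix m
    have step: "c k * (1 / ?n) \<le> \<phi> (real k / ?n) - \<phi> ((real k + 1) / ?n)" for k
    proof -
      have "((real k + 1) / ?n - real k / ?n) * c k \<le> \<phi> (real k / ?n) - \<phi> ((real k + 1) / ?n)"
        unfolding c_def using n by (intro energy_drop_initial divide_right_mono) (auto simp: add_nonneg_pos simp del: of_nat_Suc)
      then show ?thesis by (simp add: add_divide_distrib del: of_nat_Suc)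
    qed
    have "(\<Sum>k<m. c k * (1 / ?n)) \<le> \<phi> 0 - \<phi> (real m / ?n)"
    proof (induction m)
      case (Suc m)
      then show ?case using step[of m] by (simp add: add.commute del: of_nat_Suc) (simp add: of_nat_Suc add.commute)
    qed simp
    also have "\<dots> \<le> \<phi> 0"
      using nonneg[of "real m / ?n"] by simp
    finally have "(\<Sum>k<m. c k * (1 / ?n)) \<le> \<phi> 0" .
    then show "(\<Sum>k<m. ennreal (c k * (1 / ?n))) \<le> ennreal (\<phi> 0)"
      by (subst sum_ennreal) (auto simp: c_def intro!: ennreal_leI)
  qed
  finally show ?thesis .
qed

lemma speed_integral:
  assumes nonneg: "\<And>t. t \<ge> 0 \<Longrightarrow> \<phi> t \<ge> 0"
  shows "(\<integral>\<^sup>+t. ennreal ((indicator {0<..} t * norm (V t))\<^sup>2) \<partial>lborel) \<le> ennreal (\<phi> 0)"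
proof (rule nn_integral_sq_limit_le)
  show "(\<lambda>t. indicator {0<..} t * norm (V (next_grid n t))) \<in> borel_measurable lborel" for n
    by (rule borel_measurable_times[OF _ measurable_next_grid[where F = "\<lambda>t _. norm (V t)" and f = "\<lambda>t. t"]]) simp_all
  show "AE t in lborel. (\<lambda>n. indicator {0<..} t * norm (V (next_grid n t))) \<longlonglongrightarrow> indicator {0<..} t * norm (V t)"
  proof (rule AE_I2)
    fix t :: real
    show "(\<lambda>n. indicator {0<..} t * norm (V (next_grid n t))) \<longlonglongrightarrow> indicator {0<..} t * norm (V t)"
    proof (cases "t > 0")
      case True
      then show ?thesis
        by (intro tendsto_intros next_grid_converges V_right_continuous) auto
    qed simp
  qed
  show "\<forall>\<^sub>F n in sequentially. (\<integral>\<^sup>+t. ennreal ((indicator {0<..} t * norm (V (next_grid n t)))\<^sup>2) \<partial>lborel) \<le> ennreal (\<phi> 0)"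
    using speed_sampled_integral[OF nonneg] by simp
qed

lemma speed_bound:
  assumes nonneg: "\<And>t. t \<ge> 0 \<Longrightarrow> \<phi> t \<ge> 0" and t: "t > 0"
  shows "norm (V t) \<le> sqrt (\<phi> 0 / t)"
proof -
  have "t * (norm (V t))\<^sup>2 \<le> \<phi> 0"
    using energy_drop_initial[of 0 t] nonneg[of t] t by simp
  then show ?thesis
    using t by (intro real_le_rsqrt) (simp add: pos_le_divide_eq mult.commute)
qed

end

lemma L2_limit_eq_AE_limit:
  fixes f :: "nat \<Rightarrow> 'a::euclidean_space \<Rightarrow> real"
  assumes S: "S \<in> sets lebesgue" and f: "\<And>n. f n \<in> L2_space S" and G: "G \<in> L2_space S"
    and lim: "(\<lambda>n. emb S (f n)) \<longlonglongrightarrow> emb S G"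
    and AE: "AE x in lebesgue_on S. (\<lambda>n. f n x) \<longlonglongrightarrow> F x" and F: "F \<in> borel_measurable (lebesgue_on S)"
  shows "AE x in lebesgue_on S. F x = G x"
proof -
  have [measurable]: "f n \<in> borel_measurable (lebesgue_on S)" "G \<in> borel_measurable (lebesgue_on S)" for n
    by (rule L2_space_measurable[OF f] L2_space_measurable[OF G])+
  note F[measurable]
  have le: "(\<integral>\<^sup>+x. ennreal ((F x - G x)\<^sup>2) \<partial>lebesgue_on S) \<le> ennreal e" if e: "e > 0" for e
  proof (rule nn_integral_sq_limit_le)
    show "(\<lambda>x. f n x - G x) \<in> borel_measurable (lebesgue_on S)" for n by measurable
    show "AE x in lebesgue_on S. (\<lambda>n. f n x - G x) \<longlonglongrightarrow> F x - G x"
      using AE by eventually_elim (intro tendsto_intros)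
    have "\<forall>\<^sub>F n in sequentially. dist (emb S (f n)) (emb S G) < sqrt e"
      using lim e by (intro tendstoD) auto
    then show "\<forall>\<^sub>F n in sequentially. (\<integral>\<^sup>+x. ennreal ((f n x - G x)\<^sup>2) \<partial>lebesgue_on S) \<le> ennreal e"
    proof eventually_elim
      case (elim n)
      then have "(L2_norm S (\<lambda>x. f n x - G x))\<^sup>2 \<le> (sqrt e)\<^sup>2"
        unfolding L2_norm_diff_emb[OF S f G, symmetric] by (intro power_mono) auto
      then show ?case
        using e by (simp add: nn_integral_sq_eq_L2_norm[OF L2_space_diff[OF f G]] ennreal_leI)
    qed
  qed
  have "(\<integral>\<^sup>+x. ennreal ((F x - G x)\<^sup>2) \<partial>lebesgue_on S) \<le> 0"
    by (rule ennreal_le_epsilon) (simp add: le)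
  then have "(\<integral>\<^sup>+x. ennreal ((F x - G x)\<^sup>2) \<partial>lebesgue_on S) = 0"
    by simp
  then have "AE x in lebesgue_on S. ennreal ((F x - G x)\<^sup>2) = 0"
    by (subst (asm) nn_integral_0_iff_AE) auto
  then show ?thesis by eventually_elim simp
qed

section \<open>Representatives measurable in time and space\<close>

text \<open>A curve in \<open>L\<^sup>2\<close> assigns to each time only a class of functions, and the space-time norm needs a choice of
  representatives that is measurable in both variables. The step functions that sample the curve on
  finer and finer grids are measurable, and they form a Cauchy sequence in \<open>L\<^sup>1\<close> of the space-time
  cylinder because the curve is bounded and continuous from the right. A subsequence converges almost
  everywhere, and by Fubini its limit represents the curve at almost every time.\<close>

lemma joint_representative_interval:
  fixes v :: "real \<Rightarrow> real^2 \<Rightarrow> real"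
  assumes S: "S \<in> lmeasurable" "S \<in> sets borel" and ab: "0 < a" "a < b"
    and v: "\<And>t. t > 0 \<Longrightarrow> v t \<in> borel_measurable borel" "\<And>t. t > 0 \<Longrightarrow> v t \<in> L2_space S"
    and right: "\<And>t. t > 0 \<Longrightarrow> ((\<lambda>h. emb S (v (t + h))) \<longlongrightarrow> emb S (v t)) (at_right 0)"
    and bound: "\<And>t. t \<ge> a \<Longrightarrow> norm (emb S (v t)) \<le> C"
  shows "\<exists>g \<in> borel_measurable borel. AE t in lborel. a < t \<and> t < b \<longrightarrow> (AE x in lebesgue_on S. g (t, x) = v t x)"
proof -
  note S' = fmeasurableD[OF S(1)]
  note pos = next_grid_pos
  have C0: "C \<ge> 0" using bound[of a] norm_ge_zero order_trans by blast
  define V where "V t = emb S (v t)" for t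
  define I where "I t = (indicator {a<..<b} t :: real)" for t
  define f where "f n = (\<lambda>(t, x). I t * (indicator S x * v (next_grid n t) x))" for n
  have f_borel: "f n \<in> borel_measurable borel" for n
  proof -
    have "(\<lambda>p::real \<times> (real^2). v (next_grid n (fst p)) (snd p)) \<in> borel_measurable borel"
    proof (rule measurable_next_grid[where F = "\<lambda>t p. v t (snd p)" and f = fst])
      show "(\<lambda>p. v t (snd p)) \<in> borel_measurable (borel :: (real \<times> (real^2)) measure)" if "t > 0" for t
        by (rule measurable_compose[OF _ v(1)[OF that]]) (intro borel_measurable_continuous_onI continuous_intros)
      show "fst \<in> borel_measurable (borel :: (real \<times> (real^2)) measure)"
        by (intro borel_measurable_continuous_onI continuous_intros)
    qed
    moreover have "(\<lambda>p::real \<times> (real^2). I (fst p)) \<in> borel_measurable borel"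
      unfolding I_def by (rule measurable_compose[OF _ borel_measurable_indicator[of "{a<..<b}" borel]])
        (auto intro!: borel_measurable_continuous_onI continuous_intros)
    moreover have "(\<lambda>p::real \<times> (real^2). indicator S (snd p) :: real) \<in> borel_measurable borel"
      by (rule measurable_compose[OF _ borel_measurable_indicator[OF S(2)]])
        (auto intro!: borel_measurable_continuous_onI continuous_intros)
    ultimately show ?thesis
      unfolding f_def case_prod_beta by (intro borel_measurable_times)
  qed
  have lp: "lborel \<Otimes>\<^sub>M lborel = (lborel :: (real \<times> (real^2)) measure)"
    by (rule lborel_prod)
  have slice: "(LINT x|lebesgue_on S. \<bar>w x\<bar>) = (LINT x|lborel. indicator S x * \<bar>w x\<bar>)"
    if "w \<in> borel_measurable borel" for w :: "real^2 \<Rightarrow> real"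
  proof -
    have "(LINT x|lebesgue_on S. \<bar>w x\<bar>) = (LINT x|lebesgue. indicator S x *\<^sub>R \<bar>w x\<bar>)"
      using S' by (intro integral_restrict_space) simp
    also have "\<dots> = (LINT x|lborel. indicator S x *\<^sub>R \<bar>w x\<bar>)"
      using that S(2) by (intro integral_completion) simp
    finally show ?thesis by simp
  qed
  have slice_nn: "(\<integral>\<^sup>+x. ennreal (indicator S x * \<bar>w x\<bar>) \<partial>lborel) \<le> ennreal (sqrt (measure lebesgue S) * norm (emb S w))"
    if w: "w \<in> borel_measurable borel" "w \<in> L2_space S" for w :: "real^2 \<Rightarrow> real"
  proof -
    have "(\<integral>\<^sup>+x. ennreal (indicator S x * \<bar>w x\<bar>) \<partial>lborel) = (\<integral>\<^sup>+x. ennreal \<bar>w x\<bar> * indicator S x \<partial>lebesgue)"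
      using w(1) S(2) by (subst nn_integral_completion) (auto intro!: nn_integral_cong simp: indicator_def)
    also have "\<dots> = (\<integral>\<^sup>+x. ennreal \<bar>w x\<bar> \<partial>lebesgue_on S)"
      using S' by (subst nn_integral_restrict_space) auto
    also have "\<dots> = ennreal (LINT x|lebesgue_on S. \<bar>w x\<bar>)"
      by (intro nn_integral_eq_integral integrable_abs L1_le_L2(1)[OF S(1) w(2)]) auto
    also have "\<dots> \<le> ennreal (sqrt (measure lebesgue S) * norm (emb S w))"
      using L1_le_L2(2)[OF S(1) w(2)] by (simp add: norm_emb[OF S' w(2)] ennreal_leI)
    finally show ?thesis .
  qed
  define K where "K = sqrt (measure lebesgue S)"
  have K: "K \<ge> 0" by (simp add: K_def)
  define d where "d n m t = I t * norm (V (next_grid n t) - V (next_grid m t))" for n m t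
  \<comment> \<open>Measurability of \<open>e\<close> in time is only available through its approximation by the \<open>d n m\<close>.\<close>
  define e where "e n t = I t * norm (V (next_grid n t) - V t)" for n t
  have d_meas: "d n m \<in> borel_measurable borel" for n m
  proof -
    have "(\<lambda>t. norm (V (next_grid n t) - V (next_grid m t))) \<in> borel_measurable borel"
    proof (rule measurable_next_grid[where F = "\<lambda>s t. norm (V s - V (next_grid m t))" and f = "\<lambda>t. t"])
      fix s :: real
      show "(\<lambda>t. norm (V s - V (next_grid m t))) \<in> borel_measurable borel"
        by (rule measurable_next_grid[where F = "\<lambda>r t. norm (V s - V r)" and f = "\<lambda>t. t"]) simp_all
    qed simp
    then show ?thesis
      unfolding d_def[abs_def] I_def by (intro borel_measurable_times) auto
  qed
  have conv: "(\<lambda>n. V (next_grid n t)) \<longlonglongrightarrow> V t" if "t > 0" for t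
    using that right[OF that] unfolding V_def by (intro next_grid_converges) auto
  have d_lim: "(\<lambda>m. d n m t) \<longlonglongrightarrow> e n t" for n t
  proof (cases "t \<in> {a<..<b}")
    case True
    then show ?thesis unfolding d_def e_def using ab by (intro tendsto_intros conv) auto
  qed (simp add: d_def e_def I_def)
  have e_meas: "e n \<in> borel_measurable borel" for n
    by (rule borel_measurable_LIMSEQ_real[OF d_lim d_meas])
  have Vb: "norm (V t) \<le> C" if "t \<ge> a" for t using bound[OF that] by (simp add: V_def)
  have grid_ge: "next_grid n t \<ge> a" if "t > a" for n t
    using next_grid_bounds(1)[of t n] that ab by simp
  have e_le: "\<bar>e n t\<bar> \<le> 2 * C * I t" for n t
  proof (cases "t \<in> {a<..<b}")
    case True
    have "norm (V (next_grid n t) - V t) \<le> norm (V (next_grid n t)) + norm (V t)"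
      by (rule norm_triangle_ineq4)
    also have "\<dots> \<le> C + C"
      using True grid_ge[of t n] by (intro add_mono Vb) auto
    finally show ?thesis using True by (simp add: e_def I_def)
  qed (simp add: e_def I_def)
  have I_int: "integrable lborel (\<lambda>t. 2 * C * I t)"
    unfolding I_def using ab by (intro integrable_mult_right) (simp add: integrable_indicator_iff)
  have e_int: "integrable lborel (e n)" for n
    using e_meas e_le by (intro Bochner_Integration.integrable_bound[OF I_int]) (auto intro!: AE_I2 order_trans[OF e_le])
  have e_lim: "(\<lambda>n. LINT t|lborel. e n t) \<longlonglongrightarrow> integral\<^sup>L lborel (\<lambda>t::real. 0)"
  proof (rule integral_dominated_convergence[where w = "\<lambda>t. 2 * C * I t"])
    show "e n \<in> borel_measurable lborel" for n using e_meas by simp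
    show "integrable lborel (\<lambda>t. 2 * C * I t)" by (rule I_int)
    show "AE t in lborel. (\<lambda>n. e n t) \<longlonglongrightarrow> 0"
    proof (rule AE_I2)
      fix t :: real
      show "(\<lambda>n. e n t) \<longlonglongrightarrow> 0"
      proof (cases "t \<in> {a<..<b}")
        case True
        then have "(\<lambda>n. I t * norm (V (next_grid n t) - V t)) \<longlonglongrightarrow> I t * norm (V t - V t)"
          using ab by (intro tendsto_intros conv) auto
        then show ?thesis by (simp add: e_def)
      qed (simp add: e_def I_def)
    qed
    show "AE t in lborel. norm (e n t) \<le> 2 * C * I t" for n
      using e_le by simp
  qed simp
  have diff_nn: "(\<integral>\<^sup>+p. ennreal \<bar>f n p - f m p\<bar> \<partial>lborel) \<le> ennreal (K * ((LINT t|lborel. e n t) + (LINT t|lborel. e m t)))" for n m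
  proof -
    have "(\<integral>\<^sup>+p. ennreal \<bar>f n p - f m p\<bar> \<partial>lborel) = (\<integral>\<^sup>+t. \<integral>\<^sup>+x. ennreal \<bar>f n (t, x) - f m (t, x)\<bar> \<partial>lborel \<partial>lborel)"
      unfolding lp[symmetric] using f_borel
      by (intro lborel.nn_integral_fst[symmetric]) (simp add: lp)
    also have "\<dots> \<le> (\<integral>\<^sup>+t. ennreal (K * (e n t + e m t)) \<partial>lborel)"
    proof (rule nn_integral_mono)
      fix t :: real
      show "(\<integral>\<^sup>+x. ennreal \<bar>f n (t, x) - f m (t, x)\<bar> \<partial>lborel) \<le> ennreal (K * (e n t + e m t))"
      proof (cases "t \<in> {a<..<b}")
        case True
        let ?w = "\<lambda>x. v (next_grid n t) x - v (next_grid m t) x"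
        have w: "?w \<in> borel_measurable borel" "?w \<in> L2_space S"
          by (intro borel_measurable_diff v pos L2_space_diff)+
        have "(\<integral>\<^sup>+x. ennreal \<bar>f n (t, x) - f m (t, x)\<bar> \<partial>lborel) = (\<integral>\<^sup>+x. ennreal (indicator S x * \<bar>?w x\<bar>) \<partial>lborel)"
          using True by (intro nn_integral_cong) (auto simp: f_def I_def indicator_def)
        also have "\<dots> \<le> ennreal (K * norm (emb S ?w))"
          unfolding K_def by (rule slice_nn[OF w])
        also have "\<dots> \<le> ennreal (K * (e n t + e m t))"
        proof (intro ennreal_leI mult_left_mono K)
          have "emb S ?w = (V (next_grid n t) - V t) - (V (next_grid m t) - V t)"
            unfolding V_def by (simp add: emb_diff[OF S' v(2)[OF pos] v(2)[OF pos]])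
          then show "norm (emb S ?w) \<le> e n t + e m t"
            using True norm_triangle_ineq4[of "V (next_grid n t) - V t" "V (next_grid m t) - V t"]
            by (simp add: e_def I_def)
        qed
        finally show ?thesis .
      qed (simp add: f_def I_def)
    qed
    also have "\<dots> = ennreal (LINT t|lborel. K * (e n t + e m t))"
      using K by (intro nn_integral_eq_integral integrable_mult_right Bochner_Integration.integrable_add e_int)
        (auto intro!: AE_I2 mult_nonneg_nonneg add_nonneg_nonneg simp: e_def I_def)
    also have "(LINT t|lborel. K * (e n t + e m t)) = K * ((LINT t|lborel. e n t) + (LINT t|lborel. e m t))"
      using e_int by simp
    finally show ?thesis .
  qed
  have f_int: "integrable lborel (f n)" for n
  proof (rule integrableI_bounded)
    show "f n \<in> borel_measurable lborel" using f_borel by simp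
    have "(\<integral>\<^sup>+p. ennreal (norm (f n p)) \<partial>lborel) = (\<integral>\<^sup>+t. \<integral>\<^sup>+x. ennreal \<bar>f n (t, x)\<bar> \<partial>lborel \<partial>lborel)"
      unfolding lp[symmetric] real_norm_def using f_borel
      by (intro lborel.nn_integral_fst[symmetric]) (simp add: lp)
    also have "\<dots> \<le> (\<integral>\<^sup>+t. ennreal (K * C) * indicator {a<..<b} t \<partial>lborel)"
    proof (rule nn_integral_mono)
      fix t :: real
      show "(\<integral>\<^sup>+x. ennreal \<bar>f n (t, x)\<bar> \<partial>lborel) \<le> ennreal (K * C) * indicator {a<..<b} t"
      proof (cases "t \<in> {a<..<b}")
        case True
        have "(\<integral>\<^sup>+x. ennreal \<bar>f n (t, x)\<bar> \<partial>lborel) = (\<integral>\<^sup>+x. ennreal (indicator S x * \<bar>v (next_grid n t) x\<bar>) \<partial>lborel)"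
          using True by (intro nn_integral_cong) (auto simp: f_def I_def indicator_def)
        also have "\<dots> \<le> ennreal (K * norm (emb S (v (next_grid n t))))"
          unfolding K_def by (rule slice_nn[OF v(1)[OF pos] v(2)[OF pos]])
        also have "\<dots> \<le> ennreal (K * C)"
          using True K grid_ge[of t n] by (intro ennreal_leI mult_left_mono bound) auto
        finally show ?thesis using True by simp
      qed (simp add: f_def I_def)
    qed
    also have "\<dots> < \<infinity>"
      using ab by (subst nn_integral_cmult_indicator) (auto simp: ennreal_mult_less_top)
    finally show "(\<integral>\<^sup>+p. ennreal (norm (f n p)) \<partial>lborel) < \<infinity>" .
  qed
  have "\<exists>N. \<forall>i\<ge>N. \<forall>j\<ge>N. (LINT p|lborel. norm (f i p - f j p)) < \<delta>" if \<delta>: "\<delta> > 0" for \<delta>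
  proof -
    have "\<forall>\<^sub>F n in sequentially. (LINT t|lborel. e n t) < \<delta> / (2 * (K + 1))"
      using e_lim \<delta> K by (intro order_tendstoD(2)[where y = 0]) auto
    then obtain N where N: "\<And>n. n \<ge> N \<Longrightarrow> (LINT t|lborel. e n t) < \<delta> / (2 * (K + 1))"
      by (auto simp: eventually_sequentially)
    have "(LINT p|lborel. norm (f i p - f j p)) < \<delta>" if ij: "i \<ge> N" "j \<ge> N" for i j
    proof -
      have int: "integrable lborel (\<lambda>p. f i p - f j p)"
        by (intro Bochner_Integration.integrable_diff f_int)
      have e0: "(LINT t|lborel. e n t) \<ge> 0" for n
        by (intro integral_nonneg_AE AE_I2) (simp add: e_def I_def)
      have "ennreal (LINT p|lborel. norm (f i p - f j p)) \<le> ennreal (K * ((LINT t|lborel. e i t) + (LINT t|lborel. e j t)))"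
        using diff_nn[of i j] nn_integral_eq_integral[OF integrable_norm[OF int]] by simp
      then have "(LINT p|lborel. norm (f i p - f j p)) \<le> K * ((LINT t|lborel. e i t) + (LINT t|lborel. e j t))"
        using K e0 by (simp add: ennreal_le_iff)
      also have "\<dots> \<le> (K + 1) * ((LINT t|lborel. e i t) + (LINT t|lborel. e j t))"
        using e0[of i] e0[of j] by (intro mult_right_mono) auto
      also have "\<dots> < (K + 1) * (\<delta> / (2 * (K + 1)) + \<delta> / (2 * (K + 1)))"
        using N[OF ij(1)] N[OF ij(2)] K by (intro mult_strict_left_mono add_strict_mono) auto
      also have "\<dots> = \<delta>"
      proof -
        have alg: "k * (\<delta> / (2 * k) + \<delta> / (2 * k)) = \<delta>" if "k > 0" for k :: real
          using that by (simp add: field_simps)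
        show ?thesis by (rule alg) (use K in simp)
      qed
      finally show ?thesis .
    qed
    then show ?thesis by blast
  qed
  then obtain r where r: "strict_mono r" "AE p in lborel. Cauchy (\<lambda>i. f (r i) p)"
    using cauchy_L1_AE_cauchy_subseq[of lborel f, OF f_int] by blast
  define g where "g p = lim (\<lambda>i. f (r i) p)" for p
  have g: "g \<in> borel_measurable borel"
    unfolding g_def[abs_def] using f_borel by (intro borel_measurable_lim_metric)
  have "AE p in lborel. (\<lambda>i. f (r i) p) \<longlonglongrightarrow> g p"
    using r(2) by eventually_elim (simp add: g_def Cauchy_convergent_iff convergent_LIMSEQ_iff)
  then have "AE p in lborel \<Otimes>\<^sub>M lborel. (\<lambda>i. f (r i) p) \<longlonglongrightarrow> g p"
    by (simp only: lp)
  then have "AE t in lborel. AE x in lborel. (\<lambda>i. f (r i) (t, x)) \<longlonglongrightarrow> g (t, x)"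
    by (rule lborel_pair.AE_pair)
  then have "AE t in lborel. a < t \<and> t < b \<longrightarrow> (AE x in lebesgue_on S. g (t, x) = v t x)"
  proof eventually_elim
    case (elim t)
    show ?case
    proof
      assume t: "a < t \<and> t < b"
      then have t0: "t > 0" using ab by simp
      have "AE x in lebesgue. (\<lambda>i. f (r i) (t, x)) \<longlonglongrightarrow> g (t, x)"
        using elim by (rule AE_completion)
      then have "AE x in lebesgue. x \<in> S \<longrightarrow> (\<lambda>i. v (next_grid (r i) t) x) \<longlonglongrightarrow> g (t, x)"
      proof eventually_elim
        case (elim x)
        have "I t = 1" using t by (simp add: I_def)
        with elim show ?case by (auto simp: f_def)
      qed
      then have AE: "AE x in lebesgue_on S. (\<lambda>i. v (next_grid (r i) t) x) \<longlonglongrightarrow> g (t, x)"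
        using S' by (simp add: AE_restrict_space_iff)
      have lim: "(\<lambda>i. emb S (v (next_grid (r i) t))) \<longlonglongrightarrow> emb S (v t)"
        using LIMSEQ_subseq_LIMSEQ[OF conv[OF t0] r(1)] by (simp add: V_def comp_def)
      have "(\<lambda>x. g (t, x)) \<in> borel_measurable borel"
        by (rule measurable_compose[OF _ g]) (intro borel_measurable_continuous_onI continuous_intros)
      then have "(\<lambda>x. g (t, x)) \<in> borel_measurable (lebesgue_on S)"
        by (intro measurable_restrict_space1 measurable_completion) simp
      from L2_limit_eq_AE_limit[OF S' v(2)[OF pos] v(2)[OF t0] lim AE this]
      show "AE x in lebesgue_on S. g (t, x) = v t x" .
    qed
  qed
  with g show ?thesis by blast
qed

text \<open>Exhaust the half line by the intervals \<open>(1 / (k + 2), k + 2)\<close> and use at each time the representative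
  of the first of these intervals that is certain to contain it.\<close>

lemma joint_representative:
  fixes v :: "real \<Rightarrow> real^2 \<Rightarrow> real"
  assumes S: "S \<in> lmeasurable" "S \<in> sets borel"
    and v: "\<And>t. t > 0 \<Longrightarrow> v t \<in> borel_measurable borel" "\<And>t. t > 0 \<Longrightarrow> v t \<in> L2_space S"
    and right: "\<And>t. t > 0 \<Longrightarrow> ((\<lambda>h. emb S (v (t + h))) \<longlongrightarrow> emb S (v t)) (at_right 0)"
    and bound: "\<And>a. a > 0 \<Longrightarrow> \<exists>C. \<forall>t\<ge>a. norm (emb S (v t)) \<le> C"
  shows "\<exists>g \<in> borel_measurable borel. AE t in lborel. t > 0 \<longrightarrow> (AE x in lebesgue_on S. g (t, x) = v t x)"
proof -
  have "\<forall>k. \<exists>g. g \<in> borel_measurable borel \<and> (AE t in lborel. 1 / real (k + 2) < t \<and> t < real (k + 2) \<longrightarrow> (AE x in lebesgue_on S. g (t, x) = v t x))"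
  proof
    fix k
    have "1 * 1 < real (k + 2) * real (k + 2)"
      by (intro mult_strict_mono) auto
    then have ab: "0 < 1 / real (k + 2)" "1 / real (k + 2) < real (k + 2)"
      by (simp_all add: pos_divide_less_eq del: of_nat_add)
    obtain C where "\<And>t. t \<ge> 1 / real (k + 2) \<Longrightarrow> norm (emb S (v t)) \<le> C"
      using bound[OF ab(1)] by blast
    from joint_representative_interval[OF S ab v right this]
    show "\<exists>g. g \<in> borel_measurable borel \<and> (AE t in lborel. 1 / real (k + 2) < t \<and> t < real (k + 2) \<longrightarrow> (AE x in lebesgue_on S. g (t, x) = v t x))"
      by blast
  qed
  from choice[OF this] obtain g where g: "\<And>k. g k \<in> borel_measurable borel"
    "\<And>k. AE t in lborel. 1 / real (k + 2) < t \<and> t < real (k + 2) \<longrightarrow> (AE x in lebesgue_on S. g k (t, x) = v t x)"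
    by blast
  define \<kappa> where "\<kappa> t = nat \<lceil>max t (1 / t)\<rceil>" for t :: real
  define G where "G p = g (\<kappa> (fst p)) p" for p
  have \<kappa>: "1 / real (\<kappa> t + 2) < t \<and> t < real (\<kappa> t + 2)" if t: "t > 0" for t
  proof -
    have le: "max t (1 / t) \<le> real (\<kappa> t)"
      unfolding \<kappa>_def by (rule real_nat_ceiling_ge)
    then have "1 / t < real (\<kappa> t + 2)" "t < real (\<kappa> t + 2)" by simp_all
    then show ?thesis using t by (simp add: divide_less_eq mult.commute)
  qed
  have "G \<in> borel_measurable borel"
    unfolding G_def
  proof (rule measurable_compose_countable[where f = g and g = "\<lambda>p. \<kappa> (fst p)"])
    have "fst \<in> borel_measurable (borel :: (real \<times> (real^2)) measure)"
      by (intro borel_measurable_continuous_onI continuous_intros)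
    moreover have "\<kappa> \<in> borel \<rightarrow>\<^sub>M count_space UNIV"
      unfolding \<kappa>_def[abs_def] by measurable
    ultimately show "(\<lambda>p::real \<times> (real^2). \<kappa> (fst p)) \<in> borel \<rightarrow>\<^sub>M count_space UNIV"
      by (rule measurable_compose)
  qed (rule g(1))
  moreover have "AE t in lborel. t > 0 \<longrightarrow> (AE x in lebesgue_on S. G (t, x) = v t x)"
  proof -
    have "AE t in lborel. \<forall>k. 1 / real (k + 2) < t \<and> t < real (k + 2) \<longrightarrow> (AE x in lebesgue_on S. g k (t, x) = v t x)"
      using g(2) by (subst AE_all_countable) blast
    then show ?thesis
    proof eventually_elim
      case (elim t)
      show ?case
      proof
        assume "t > 0"
        with elim \<kappa>[of t] show "AE x in lebesgue_on S. G (t, x) = v t x"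
          by (simp add: G_def)
      qed
    qed
  qed
  ultimately show ?thesis by blast
qed

lemma borel_measurable_lebesgue_modification:
  fixes f g :: "'a::euclidean_space \<Rightarrow> real"
  assumes g: "g \<in> borel_measurable borel" and N: "N \<in> null_sets lborel" and eq: "\<And>x. x \<notin> N \<Longrightarrow> f x = g x"
  shows "f \<in> borel_measurable lebesgue"
proof (rule measurableI)
  fix A :: "real set" assume A: "A \<in> sets borel"
  have "g -` A \<in> sets borel"
    using measurable_sets[OF g A] by simp
  then have "g -` A - N \<in> sets lebesgue"
    using N by (intro sets.Diff) auto
  moreover have "f -` A \<inter> N \<in> sets lebesgue"
    using N by (intro sets_completionI_sub[of N]) auto
  moreover have "f -` A \<inter> space lebesgue = (g -` A - N) \<union> (f -` A \<inter> N)"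
    using eq by auto
  ultimately show "f -` A \<inter> space lebesgue \<in> sets lebesgue" by (simp del: space_completion)
qed simp

lemma L2_space_cong_AE:
  fixes f g :: "'a::euclidean_space \<Rightarrow> real"
  assumes f: "f \<in> L2_space S" and g: "g \<in> borel_measurable (lebesgue_on S)" and AE: "AE x in lebesgue_on S. g x = f x"
  shows "g \<in> L2_space S"
proof (rule L2_spaceI[OF g])
  note [measurable] = g L2_space_measurable[OF f]
  have "integrable (lebesgue_on S) (\<lambda>x. (g x)\<^sup>2)"
  proof (subst integrable_cong_AE)
    show "AE x in lebesgue_on S. (g x)\<^sup>2 = (f x)\<^sup>2"
      using AE by eventually_elim simp
    show "integrable (lebesgue_on S) (\<lambda>x. (f x)\<^sup>2)"
      by (rule L2_space_integrable_sq[OF f])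
  qed measurable
  then show "integrable (lebesgue_on S) (\<lambda>x. (norm (g x))\<^sup>2)" by simp
qed

lemma borel_representative:
  assumes S: "S \<in> sets lebesgue" and f: "f \<in> L2_space S"
  shows "\<exists>g. g \<in> borel_measurable borel \<and> g \<in> L2_space S \<and> (AE x in lebesgue_on S. g x = (f x :: real))"
proof -
  have cut: "(\<lambda>x. indicator S x * f x) \<in> sq_int"
    using f by (simp add: cut_sq_int_iff[OF S])
  then have "(\<lambda>x. indicator S x * f x) \<in> borel_measurable (completion lborel)"
    by (simp add: L2_space_def lebesgue_on_UNIV_eq)
  from completion_ex_borel_measurable_real[OF this] obtain g
    where g: "g \<in> borel_measurable lborel" "AE x in lborel. indicator S x * f x = g x" by blast
  have gb: "g \<in> borel_measurable borel" using g(1) by simp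
  have "AE x in lebesgue. indicator S x * f x = g x" using g(2) by (rule AE_completion)
  then have "AE x in lebesgue. x \<in> S \<longrightarrow> g x = f x"
    by eventually_elim auto
  then have AE: "AE x in lebesgue_on S. g x = f x"
    using S by (simp add: AE_restrict_space_iff)
  have gm: "g \<in> borel_measurable (lebesgue_on S)"
    by (intro measurable_restrict_space1 measurable_completion g(1))
  from L2_space_cong_AE[OF f gm AE] gb AE show ?thesis by blast
qed

section \<open>The energy\<close>

lemma energy_nonneg: "0 \<le> energy \<gamma> bc L u"
proof (cases "\<gamma> > 0")
  case True
  then show ?thesis by (auto simp: energy_def intro!: integral_nonneg_AE AE_I2)
next
  case False
  let ?Z = "{z. (\<forall>i. (\<lambda>x. z x $ i) \<in> test_functions bc L) \<and> (\<forall>x. max \<bar>z x $ 1\<bar> \<bar>z x $ 2\<bar> \<le> 1)}"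
  have "(\<lambda>x. 0) \<in> ?Z" by (simp add: test_functions_zero)
  then have "ereal (LINT x|lebesgue_on (square L). u x * divergence (\<lambda>x. 0) x) \<le> energy \<gamma> bc L u"
    unfolding energy_def if_not_P[OF False] by (rule SUP_upper)
  then show ?thesis by (simp add: divergence_def C1_fun_const(2) zero_ereal_def)
qed

text \<open>For \<open>\<gamma> = 0\<close> the integration by parts in the definition of the weak gradient bounds the total
  variation by the \<open>L\<^sup>1\<close> norm of the gradient components.\<close>

lemma energy_le_H1:
  assumes \<gamma>: "\<gamma> \<ge> 0" and u: "u \<in> H1_space bc L"
  shows "energy \<gamma> bc L u \<le> ereal (\<gamma> / 2 * (H1_norm bc L u)\<^sup>2 + 2 * sqrt (measure lebesgue (square L)) * H1_norm bc L u)"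
proof -
  let ?M = "lebesgue_on (square L)" and ?N = "L2_norm (square L)"
  define G where "G = weak_grad bc L u"
  have G: "is_weak_grad bc L u G" unfolding G_def by (rule weak_grad_works[OF u])
  have G2: "G \<in> L2_space (square L)" using G by (simp add: is_weak_grad_def)
  note Gi = L2_space_vec_nth[OF G2]
  define K where "K = sqrt (measure lebesgue (square L))"
  have K: "K \<ge> 0" by (simp add: K_def)
  have NG: "?N G \<le> H1_norm bc L u"
    unfolding H1_norm_def G_def[symmetric] by (rule real_le_rsqrt) simp
  have NGi: "?N (\<lambda>x. G x $ i) \<le> H1_norm bc L u" for i
  proof -
    have "(?N (\<lambda>x. G x $ i))\<^sup>2 \<le> (?N G)\<^sup>2"
      unfolding L2_norm_vec[OF G2] by (rule member_le_sum) auto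
    then have "?N (\<lambda>x. G x $ i) \<le> ?N G" by (rule power2_le_imp_le) simp
    with NG show ?thesis by simp
  qed
  have abs_int: "integrable ?M (\<lambda>x. \<bar>G x $ i\<bar>)" for i
    by (intro integrable_abs L2_integrable_square Gi)
  have L1: "(LINT x|?M. \<bar>G x $ i\<bar>) \<le> K * H1_norm bc L u" for i
  proof -
    have "(LINT x|?M. \<bar>G x $ i\<bar>) \<le> K * ?N (\<lambda>x. G x $ i)"
      unfolding K_def by (rule L1_le_L2(2)[OF square_lmeasurable Gi])
    also have "\<dots> \<le> K * H1_norm bc L u" using K NGi by (intro mult_left_mono)
    finally show ?thesis .
  qed
  show ?thesis
  proof (cases "\<gamma> > 0")
    case True
    have sq: "integrable ?M (\<lambda>x. (norm (G x))\<^sup>2)" using G2 by (simp add: L2_space_def)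
    have "energy \<gamma> bc L u = ereal (LINT x|?M. \<gamma> / 2 * (norm (G x))\<^sup>2 + \<bar>G x $ 1\<bar> + \<bar>G x $ 2\<bar>)"
      using True u unfolding energy_def G_def by (simp only: if_True)
    also have "(LINT x|?M. \<gamma> / 2 * (norm (G x))\<^sup>2 + \<bar>G x $ 1\<bar> + \<bar>G x $ 2\<bar>)
      = \<gamma> / 2 * (LINT x|?M. (norm (G x))\<^sup>2) + (LINT x|?M. \<bar>G x $ 1\<bar>) + (LINT x|?M. \<bar>G x $ 2\<bar>)"
      using sq abs_int by simp
    also have "(LINT x|?M. (norm (G x))\<^sup>2) = (?N G)\<^sup>2" by (simp add: L2_norm_def)
    also have "\<gamma> / 2 * (?N G)\<^sup>2 \<le> \<gamma> / 2 * (H1_norm bc L u)\<^sup>2"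
      using NG \<gamma> by (intro mult_left_mono power_mono) auto
    finally have "energy \<gamma> bc L u \<le> ereal (\<gamma> / 2 * (H1_norm bc L u)\<^sup>2 + (LINT x|?M. \<bar>G x $ 1\<bar>) + (LINT x|?M. \<bar>G x $ 2\<bar>))"
      by simp
    also have "\<dots> \<le> ereal (\<gamma> / 2 * (H1_norm bc L u)\<^sup>2 + 2 * K * H1_norm bc L u)"
      using L1[of 1] L1[of 2] by simp
    finally show ?thesis by (simp only: K_def)
  next
    case False
    have "energy \<gamma> bc L u \<le> ereal (2 * K * H1_norm bc L u)"
      unfolding energy_def if_not_P[OF False]
    proof (rule SUP_least)
      fix z :: "real^2 \<Rightarrow> real^2" assume z: "z \<in> {z. (\<forall>i. (\<lambda>x. z x $ i) \<in> test_functions bc L) \<and> (\<forall>x. max \<bar>z x $ 1\<bar> \<bar>z x $ 2\<bar> \<le> 1)}"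
      have u2: "u \<in> L2_space (square L)" using u by (simp add: H1_space_def)
      have zi: "(\<lambda>x. z x $ i) \<in> test_functions bc L" "\<bar>z x $ i\<bar> \<le> 1" for i x
      proof -
        show "(\<lambda>x. z x $ i) \<in> test_functions bc L" using z by blast
        have "\<bar>z x $ 1\<bar> \<le> 1 \<and> \<bar>z x $ 2\<bar> \<le> 1" using z by simp
        then show "\<bar>z x $ i\<bar> \<le> 1" using exhaust_2[of i] by blast
      qed
      note z2 = test_functions_L2[OF zi(1)] and d2 = partial_deriv_L2[OF test_functions_C1[OF zi(1)]]
      have "(LINT x|?M. u x * divergence z x) = (LINT x|?M. u x * partial_deriv 1 (\<lambda>y. z y $ 1) x) + (LINT x|?M. u x * partial_deriv 2 (\<lambda>y. z y $ 2) x)"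
        using L2_space_integrable_mult[OF u2 d2] by (simp add: divergence_def sum_2 distrib_left)
      also have "\<dots> = - (LINT x|?M. G x $ 1 * z x $ 1) + - (LINT x|?M. G x $ 2 * z x $ 2)"
        using G zi(1) by (simp add: is_weak_grad_def)
      also have "\<dots> \<le> K * H1_norm bc L u + K * H1_norm bc L u"
      proof (rule add_mono)
        have le: "- (LINT x|?M. G x $ i * z x $ i) \<le> K * H1_norm bc L u" for i
        proof -
          have "- (LINT x|?M. G x $ i * z x $ i) = (LINT x|?M. - (G x $ i * z x $ i))" by simp
          also have "\<dots> \<le> (LINT x|?M. \<bar>G x $ i\<bar>)"
          proof (rule integral_mono)
            show "integrable ?M (\<lambda>x. - (G x $ i * z x $ i))"
              by (intro Bochner_Integration.integrable_minus L2_space_integrable_mult Gi z2)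
            show "- (G x $ i * z x $ i) \<le> \<bar>G x $ i\<bar>" for x
            proof -
              have "- (G x $ i * z x $ i) \<le> \<bar>G x $ i\<bar> * \<bar>z x $ i\<bar>"
                using abs_ge_minus_self[of "G x $ i * z x $ i"] by (simp add: abs_mult)
              also have "\<dots> \<le> \<bar>G x $ i\<bar> * 1" using zi(2) by (intro mult_left_mono) auto
              finally show ?thesis by simp
            qed
          qed (rule abs_int)
          also note L1
          finally show ?thesis .
        qed
        show "- (LINT x|?M. G x $ 1 * z x $ 1) \<le> K * H1_norm bc L u" "- (LINT x|?M. G x $ 2 * z x $ 2) \<le> K * H1_norm bc L u"
          by (rule le)+
      qed
      finally show "ereal (LINT x|?M. u x * divergence z x) \<le> ereal (2 * K * H1_norm bc L u)"
        by simp
    qed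
    also have "\<dots> \<le> ereal (\<gamma> / 2 * (H1_norm bc L u)\<^sup>2 + 2 * K * H1_norm bc L u)"
      using \<gamma> by simp
    finally show ?thesis by (simp add: K_def)
  qed
qed

section \<open>A priori bounds for the solution\<close>

text \<open>At time \<open>0\<close> the energy is that of \<open>u0\<close>, whose class is that of \<open>u 0\<close>.\<close>

lemma solution_is_subgradient_flow:
  assumes L: "L > 0" and \<gamma>: "\<gamma> \<ge> 0" and u0: "u0 \<in> H1_space bc L"
    and sol: "gradient_flow_solution \<gamma> bc L u0 u"
    and v: "\<And>t. t > 0 \<Longrightarrow> has_right_L2_deriv (square L) u (v t) t"
      "\<And>t. t > 0 \<Longrightarrow> (\<lambda>x. - v t x) \<in> subdifferential (square L) (energy \<gamma> bc L) (u t)"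
  shows "subgradient_flow (\<lambda>t. emb (square L) (u t)) (\<lambda>t. emb (square L) (v t))
    (\<lambda>t. real_of_ereal (energy \<gamma> bc L (if t = 0 then u0 else u t)))"
proof (rule subgradient_flow.intro)
  note S = square_measurable[of L]
  let ?E = "energy \<gamma> bc L"
  have u2: "u t \<in> L2_space (square L)" if "t \<ge> 0" for t
    using sol that unfolding gradient_flow_solution_def by blast
  have u02: "u0 \<in> L2_space (square L)" using u0 by (simp add: H1_space_def)
  have v2: "v t \<in> L2_space (square L)" if "t > 0" for t
    using v(1)[OF that] by (simp add: has_right_L2_deriv_def)
  show "continuous_on {0..} (\<lambda>t. emb (square L) (u t))"
    unfolding continuous_on_def
  proof
    fix t :: real assume t: "t \<in> {0..}"
    have "((\<lambda>s. L2_norm (square L) (\<lambda>x. u s x - u t x)) \<longlongrightarrow> 0) (at t within {0..})"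
      using sol t unfolding gradient_flow_solution_def atLeast_iff by blast
    then have "((\<lambda>s. dist (emb (square L) (u s)) (emb (square L) (u t))) \<longlongrightarrow> 0) (at t within {0..})"
    proof (rule Lim_transform_eventually)
      show "\<forall>\<^sub>F s in at t within {0..}. L2_norm (square L) (\<lambda>x. u s x - u t x) = dist (emb (square L) (u s)) (emb (square L) (u t))"
        unfolding eventually_at_filter
      proof (rule always_eventually, intro allI impI)
        fix s :: real assume "s \<in> {0..}"
        then show "L2_norm (square L) (\<lambda>x. u s x - u t x) = dist (emb (square L) (u s)) (emb (square L) (u t))"
          using t by (intro L2_norm_diff_emb S u2) auto
      qed
    qed
    then show "((\<lambda>s. emb (square L) (u s)) \<longlongrightarrow> emb (square L) (u t)) (at t within {0..})"
      by (rule tendsto_dist_iff[THEN iffD2])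
  qed
  show "has_right_deriv (\<lambda>t. emb (square L) (u t)) (emb (square L) (v t)) t" if t: "t > 0" for t
  proof -
    have "((\<lambda>h. L2_norm (square L) (\<lambda>x. (u (t + h) x - u t x) / h - v t x)) \<longlongrightarrow> 0) (at_right 0)"
      using v(1)[OF t] by (simp add: has_right_L2_deriv_def)
    then have "((\<lambda>h. dist ((emb (square L) (u (t + h)) - emb (square L) (u t)) /\<^sub>R h) (emb (square L) (v t))) \<longlongrightarrow> 0) (at_right 0)"
    proof (rule Lim_transform_eventually)
      show "\<forall>\<^sub>F h in at_right 0. L2_norm (square L) (\<lambda>x. (u (t + h) x - u t x) / h - v t x) =
          dist ((emb (square L) (u (t + h)) - emb (square L) (u t)) /\<^sub>R h) (emb (square L) (v t))"
        using eventually_at_right_less[of "0::real"]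
      proof eventually_elim
        case (elim h)
        have d: "(\<lambda>x. u (t + h) x - u t x) \<in> L2_space (square L)"
          using t elim by (intro L2_space_diff u2) auto
        have "L2_norm (square L) (\<lambda>x. inverse h * (u (t + h) x - u t x) - v t x) = dist (emb (square L) (\<lambda>x. inverse h * (u (t + h) x - u t x))) (emb (square L) (v t))"
          by (rule L2_norm_diff_emb[OF S L2_space_scale[OF d] v2[OF t]])
        also have "emb (square L) (\<lambda>x. inverse h * (u (t + h) x - u t x)) = (emb (square L) (u (t + h)) - emb (square L) (u t)) /\<^sub>R h"
          using t elim by (subst emb_scale[OF S d], subst emb_diff[OF S u2 u2]) auto
        finally show ?case by (simp add: divide_inverse_commute)
      qed
    qed
    then show ?thesis unfolding has_right_deriv_def by (rule tendsto_dist_iff[THEN iffD2])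
  qed
  show "real_of_ereal (?E (if s = 0 then u0 else u s)) \<ge> real_of_ereal (?E (if t = 0 then u0 else u t)) - inner (emb (square L) (v t)) (emb (square L) (u s) - emb (square L) (u t))"
    if t: "t > 0" and s: "s \<ge> 0" for s t
  proof -
    define z where "z = (if s = 0 then u0 else u s)"
    have z2: "z \<in> L2_space (square L)" using s u2 u02 by (simp add: z_def)
    have embz: "emb (square L) z = emb (square L) (u s)"
    proof (cases "s = 0")
      case True
      have "AE x in lebesgue_on (square L). u 0 x = u0 x"
        using sol unfolding gradient_flow_solution_def by blast
      from emb_eqI[OF S u2 u02 this] True show ?thesis by (simp add: z_def)
    qed (simp add: z_def)
    have fin_z: "?E z < \<infinity>"
    proof (cases "s = 0")
      case True
      then have z: "z = u0" by (simp add: z_def)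
      show ?thesis
        unfolding z by (rule le_less_trans[OF energy_le_H1[OF \<gamma> u0]]) simp
    next
      case False
      then have z: "z = u s" and s0: "s > 0" using s by (simp_all add: z_def)
      show ?thesis unfolding z using v(2)[OF s0] unfolding subdifferential_def by blast
    qed
    have fin_u: "?E (u t) < \<infinity>" using v(2)[OF t] unfolding subdifferential_def by blast
    have finite: "\<exists>r. e = ereal r" if "0 \<le> e" "e < \<infinity>" for e
      using that by (cases e) simp_all
    obtain a where a: "?E z = ereal a"
      using finite[OF energy_nonneg fin_z] by (rule exE)
    obtain b where b: "?E (u t) = ereal b"
      using finite[OF energy_nonneg fin_u] by (rule exE)
    note ab = a b
    have inner: "L2_inner (square L) (\<lambda>x. - v t x) (\<lambda>x. z x - u t x) = - inner (emb (square L) (v t)) (emb (square L) (u s) - emb (square L) (u t))"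
    proof -
      have "inner (emb (square L) (v t)) (emb (square L) (u s) - emb (square L) (u t)) = (LINT x|lebesgue_on (square L). v t x * (z x - u t x))"
      proof -
        have ut: "u t \<in> L2_space (square L)" using u2 t by simp
        show ?thesis
          unfolding embz[symmetric] emb_diff[OF S z2 ut, symmetric]
          by (rule inner_emb[OF S v2[OF t] L2_space_diff[OF z2 ut]])
      qed
      then show ?thesis by (simp add: L2_inner_def)
    qed
    have "?E (u t) + ereal (L2_inner (square L) (\<lambda>x. - v t x) (\<lambda>x. z x - u t x)) \<le> ?E z"
      using v(2)[OF t] z2 unfolding subdifferential_def by blast
    then have "b - inner (emb (square L) (v t)) (emb (square L) (u s) - emb (square L) (u t)) \<le> a"
      by (simp add: ab inner)
    then show ?thesis using t ab by (simp add: z_def)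
  qed
qed

text \<open>On the exceptional set \<open>N\<close> of times, \<open>w\<close> may be any family of functions: \<open>N \<times> UNIV\<close> is a null set and
  Lebesgue measurability ignores it.\<close>

lemma spacetime_norm_bound:
  fixes w :: "real \<Rightarrow> real^2 \<Rightarrow> real"
  assumes S: "S \<in> sets borel" and S': "S \<in> sets lebesgue" and g: "g \<in> borel_measurable borel"
    and N: "N \<in> null_sets lborel" and w: "\<And>t x. t \<notin> N \<Longrightarrow> w t x = g (t, x)"
    and w2: "\<And>t. t > 0 \<Longrightarrow> w t \<in> L2_space S" and c: "c \<ge> 0"
    and le: "(\<integral>\<^sup>+t. ennreal ((indicator {0<..} t * norm (emb S (w t)))\<^sup>2) \<partial>lborel) \<le> ennreal (c\<^sup>2)"
  shows "L2_enorm ({0<..<T} \<times> S) (\<lambda>(t, x). w t x) \<le> ennreal c"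
proof -
  let ?P = "{0<..<T} \<times> S"
  have lp: "lborel \<Otimes>\<^sub>M lborel = (lborel :: (real \<times> (real^2)) measure)"
    by (rule lborel_prod)
  have Pb: "?P \<in> sets borel"
    using S by (intro borel_Times) auto
  have N2: "N \<times> UNIV \<in> null_sets (lborel :: (real \<times> (real^2)) measure)"
  proof -
    have "emeasure (lborel \<Otimes>\<^sub>M lborel) (N \<times> (UNIV :: (real^2) set)) = emeasure lborel N * emeasure lborel (UNIV :: (real^2) set)"
      using N by (intro lborel.emeasure_pair_measure_Times) auto
    also have "\<dots> = 0" using N by (simp add: null_sets_def)
    finally have "emeasure (lborel :: (real \<times> (real^2)) measure) (N \<times> UNIV) = 0" by (simp only: lp)
    moreover have "N \<times> (UNIV :: (real^2) set) \<in> sets (lborel \<Otimes>\<^sub>M lborel)"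
      using N by (intro pair_measureI) auto
    ultimately show ?thesis by (simp only: lp null_setsI)
  qed
  have wm: "(\<lambda>(t, x). w t x) \<in> borel_measurable lebesgue"
    using w by (intro borel_measurable_lebesgue_modification[OF g N2]) auto
  have AEN: "AE p in lebesgue. p \<notin> N \<times> (UNIV :: (real^2) set)"
    using AE_completion[OF AE_not_in[OF N2]] .
  define F where "F p = ennreal ((g p)\<^sup>2) * indicator ?P p" for p
  have F: "F \<in> borel_measurable borel"
    unfolding F_def using g Pb by (intro borel_measurable_times_ennreal borel_measurable_indicator) auto
  have "(\<integral>\<^sup>+p. ennreal ((case p of (t, x) \<Rightarrow> w t x)\<^sup>2) \<partial>lebesgue_on ?P) = (\<integral>\<^sup>+p. ennreal ((case p of (t, x) \<Rightarrow> w t x)\<^sup>2) * indicator ?P p \<partial>lebesgue)"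
    using Pb by (intro nn_integral_restrict_space) auto
  also have "\<dots> = (\<integral>\<^sup>+p. F p \<partial>lebesgue)"
  proof (rule nn_integral_cong_AE, rule eventually_mono[OF AEN])
    fix p :: "real \<times> (real^2)" assume "p \<notin> N \<times> UNIV"
    then have "w (fst p) (snd p) = g p" using w[of "fst p" "snd p"] by (simp add: mem_Times_iff)
    then show "ennreal ((case p of (t, x) \<Rightarrow> w t x)\<^sup>2) * indicator ?P p = F p"
      by (simp add: F_def case_prod_beta)
  qed
  also have "\<dots> = (\<integral>\<^sup>+p. F p \<partial>lborel)"
    using F by (intro nn_integral_completion)
  also have "\<dots> = (\<integral>\<^sup>+t. \<integral>\<^sup>+x. F (t, x) \<partial>lborel \<partial>lborel)"
    unfolding lp[symmetric] using F by (intro lborel.nn_integral_fst[symmetric]) (simp add: lp)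
  also have "\<dots> \<le> (\<integral>\<^sup>+t. ennreal ((indicator {0<..} t * norm (emb S (w t)))\<^sup>2) \<partial>lborel)"
  proof (rule nn_integral_mono_AE)
    have "AE t in lborel. t \<notin> N" by (rule AE_not_in[OF N])
    then show "AE t in lborel. (\<integral>\<^sup>+x. F (t, x) \<partial>lborel) \<le> ennreal ((indicator {0<..} t * norm (emb S (w t)))\<^sup>2)"
    proof eventually_elim
      case (elim t)
      show ?case
      proof (cases "t > 0")
        case True
        have gt: "(\<lambda>x. g (t, x)) \<in> borel_measurable borel"
          by (rule measurable_compose[OF _ g]) (intro borel_measurable_continuous_onI continuous_intros)
        have "(\<integral>\<^sup>+x. F (t, x) \<partial>lborel) \<le> (\<integral>\<^sup>+x. ennreal ((g (t, x))\<^sup>2) * indicator S x \<partial>lborel)"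
          by (intro nn_integral_mono) (auto simp: F_def indicator_def)
        also have "\<dots> = (\<integral>\<^sup>+x. ennreal ((g (t, x))\<^sup>2) * indicator S x \<partial>lebesgue)"
          using gt S by (intro nn_integral_completion[symmetric] borel_measurable_times_ennreal borel_measurable_indicator)
        also have "\<dots> = (\<integral>\<^sup>+x. ennreal ((g (t, x))\<^sup>2) \<partial>lebesgue_on S)"
          using S' by (intro nn_integral_restrict_space[symmetric]) simp
        also have "\<dots> = (\<integral>\<^sup>+x. ennreal ((w t x)\<^sup>2) \<partial>lebesgue_on S)"
          by (simp add: w[OF elim])
        also have "\<dots> = ennreal ((norm (emb S (w t)))\<^sup>2)"
          by (simp add: nn_integral_sq_eq_L2_norm[OF w2[OF True]] norm_emb[OF S' w2[OF True]])
        finally show ?thesis using True by simp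
      next
        case False
        then have "(\<integral>\<^sup>+x. F (t, x) \<partial>lborel) = 0" by (simp add: F_def)
        then show ?thesis by simp
      qed
    qed
  qed
  also note le
  finally have "(\<integral>\<^sup>+p. ennreal ((case p of (t, x) \<Rightarrow> w t x)\<^sup>2) \<partial>lebesgue_on ?P) \<le> ennreal (c\<^sup>2)" .
  from sq_integrable_finite_integral[OF measurable_restrict_space1[OF wm] this c]
  show ?thesis by (simp add: L2_enorm_def ennreal_leI)
qed

theorem theorem3p1:
  fixes \<gamma> L :: real and bc :: boundary_cond
  assumes "\<gamma> \<ge> 0" and "L > 0"
  shows "\<exists>DATA :: real \<Rightarrow> real \<Rightarrow> real \<Rightarrow> real.
    \<forall>u0 u. u0 \<in> H1_space bc L \<and> gradient_flow_solution \<gamma> bc L u0 u \<longrightarrow>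
      (\<exists>u\<^sub>t :: real \<Rightarrow> real^2 \<Rightarrow> real.
        (\<forall>t>0. has_right_L2_deriv (square L) u (u\<^sub>t t) t) \<and>
        (\<gamma> > 0 \<longrightarrow> (\<forall>t>0. u t \<in> H2_space bc L)) \<and>
        (\<forall>\<delta> T. 0 < \<delta> \<and> \<delta> < T \<longrightarrow>
          L2_enorm ({0<..<T} \<times> square L) (\<lambda>(t, x). u\<^sub>t t x)
          + (SUP t\<in>{\<delta>..T}. L2_enorm (square L) (u\<^sub>t t)
               + (if \<gamma> = 0 then 0
                  else L2_enorm (square L) (\<lambda>x. \<gamma> *\<^sub>R weak_hessian bc L (u t) x)))
          \<le> ennreal (DATA \<delta> T (H1_norm bc L u0))))"
proof -
  note \<gamma> = assms(1) and L = assms(2)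
  let ?S = "square L"
  note S = square_measurable[of L]
  have Sb: "?S \<in> sets borel" using open_square by (rule borel_open)
  define E0 where "E0 N = \<gamma> / 2 * N\<^sup>2 + 2 * sqrt (measure lebesgue ?S) * N" for N
  \<comment> \<open>\<open>E0\<close> bounds the initial energy. In the second summand of \<open>DATA\<close>, one part accounts for the
      speed at time \<open>t \<ge> \<delta>\<close> and \<open>16\<close> parts for the Hessian, by \<open>H2_regularity\<close>.\<close>
  define DATA :: "real \<Rightarrow> real \<Rightarrow> real \<Rightarrow> real" where "DATA \<delta> T N = sqrt (E0 N) + 17 * sqrt (E0 N / \<delta>)" for \<delta> T N
  have "\<exists>u\<^sub>t :: real \<Rightarrow> real^2 \<Rightarrow> real.
        (\<forall>t>0. has_right_L2_deriv (square L) u (u\<^sub>t t) t) \<and>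
        (\<gamma> > 0 \<longrightarrow> (\<forall>t>0. u t \<in> H2_space bc L)) \<and>
        (\<forall>\<delta> T. 0 < \<delta> \<and> \<delta> < T \<longrightarrow>
          L2_enorm ({0<..<T} \<times> square L) (\<lambda>(t, x). u\<^sub>t t x)
          + (SUP t\<in>{\<delta>..T}. L2_enorm (square L) (u\<^sub>t t)
               + (if \<gamma> = 0 then 0
                  else L2_enorm (square L) (\<lambda>x. \<gamma> *\<^sub>R weak_hessian bc L (u t) x)))
          \<le> ennreal (DATA \<delta> T (H1_norm bc L u0)))"
    if u0: "u0 \<in> H1_space bc L" and sol: "gradient_flow_solution \<gamma> bc L u0 u" for u0 u
  proof -
    define E where "E = E0 (H1_norm bc L u0)"
    have "\<forall>t. \<exists>v. t > 0 \<longrightarrow> has_right_L2_deriv ?S u v t \<and> (\<lambda>x. - v x) \<in> subdifferential ?S (energy \<gamma> bc L) (u t)"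
      using sol unfolding gradient_flow_solution_def by blast
    from choice[OF this] obtain v where
      v: "\<And>t. t > 0 \<Longrightarrow> has_right_L2_deriv ?S u (v t) t"
        "\<And>t. t > 0 \<Longrightarrow> (\<lambda>x. - v t x) \<in> subdifferential ?S (energy \<gamma> bc L) (u t)"
      by blast
    define \<phi> where "\<phi> = (\<lambda>t. real_of_ereal (energy \<gamma> bc L (if t = 0 then u0 else u t)))"
    interpret subgradient_flow "\<lambda>t. emb ?S (u t)" "\<lambda>t. emb ?S (v t)" \<phi>
      unfolding \<phi>_def by (rule solution_is_subgradient_flow[OF L \<gamma> u0 sol v])
    have nonneg: "\<phi> t \<ge> 0" for t
      unfolding \<phi>_def by (intro real_of_ereal_pos energy_nonneg)
    have \<phi>0: "\<phi> 0 \<le> E"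
      using energy_le_H1[OF \<gamma> u0] energy_nonneg[of \<gamma> bc L u0]
      by (cases "energy \<gamma> bc L u0") (auto simp: \<phi>_def E_def E0_def)
    have E: "E \<ge> 0" using \<phi>0 nonneg[of 0] by simp
    have v2: "v t \<in> L2_space ?S" if "t > 0" for t
      using v(1)[OF that] by (simp add: has_right_L2_deriv_def)
    have "\<forall>t. \<exists>b. t > 0 \<longrightarrow> b \<in> borel_measurable borel \<and> b \<in> L2_space ?S \<and> (AE x in lebesgue_on ?S. b x = v t x)"
      using borel_representative[OF S v2] by blast
    from choice[OF this] obtain b where b: "\<And>t. t > 0 \<Longrightarrow> b t \<in> borel_measurable borel"
      "\<And>t. t > 0 \<Longrightarrow> b t \<in> L2_space ?S" "\<And>t. t > 0 \<Longrightarrow> AE x in lebesgue_on ?S. b t x = v t x"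
      by blast
    have emb_b: "emb ?S (b t) = emb ?S (v t)" if "t > 0" for t
      by (rule emb_eqI[OF S b(2) v2 b(3)]) (rule that)+
    have "\<exists>g \<in> borel_measurable borel. AE t in lborel. t > 0 \<longrightarrow> (AE x in lebesgue_on ?S. g (t, x) = b t x)"
    proof (rule joint_representative[OF square_lmeasurable Sb b(1,2)])
      show "((\<lambda>h. emb ?S (b (t + h))) \<longlongrightarrow> emb ?S (b t)) (at_right 0)" if t: "t > 0" for t
      proof -
        have "\<forall>\<^sub>F h in at_right 0. emb ?S (v (t + h)) = emb ?S (b (t + h))"
          using eventually_at_right_less[of "0::real"] by eventually_elim (use t in \<open>simp add: emb_b\<close>)
        from Lim_transform_eventually[OF V_right_continuous[OF t] this] show ?thesis
          by (simp add: emb_b[OF t])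
      qed
      show "\<exists>C. \<forall>t\<ge>a. norm (emb ?S (b t)) \<le> C" if a: "a > 0" for a
        using speed_decreasing[OF a] a by (intro exI[of _ "norm (emb ?S (v a))"]) (auto simp: emb_b)
    qed
    then obtain g where g: "g \<in> borel_measurable borel"
      "AE t in lborel. t > 0 \<longrightarrow> (AE x in lebesgue_on ?S. g (t, x) = b t x)" by blast
    obtain N where N: "\<And>t. t \<in> space lborel - N \<Longrightarrow> t > 0 \<longrightarrow> (AE x in lebesgue_on ?S. g (t, x) = b t x)" "N \<in> null_sets lborel"
      using AE_E3[OF g(2)] by blast
    \<comment> \<open>At the exceptional times the joint representative is replaced by the given derivative, so that
        \<open>w t\<close> represents the right derivative at every positive time.\<close>
    define w where "w t x = (if t \<in> N then v t x else g (t, x))" for t x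
    have w_AE: "AE x in lebesgue_on ?S. w t x = v t x" if t: "t > 0" for t
    proof (cases "t \<in> N")
      case True
      then show ?thesis by (simp add: w_def)
    next
      case False
      then have "AE x in lebesgue_on ?S. g (t, x) = b t x" using N(1)[of t] t by simp
      with b(3)[OF t] show ?thesis
        by eventually_elim (simp add: w_def False)
    qed
    have w2: "w t \<in> L2_space ?S" if t: "t > 0" for t
    proof (cases "t \<in> N")
      case True
      then have "w t = v t" by (auto simp: w_def)
      then show ?thesis using v2[OF t] by simp
    next
      case False
      then have eq: "w t = (\<lambda>x. g (t, x))" by (auto simp: w_def)
      have "(\<lambda>x. g (t, x)) \<in> borel_measurable borel"
        by (rule measurable_compose[OF _ g(1)]) (intro borel_measurable_continuous_onI continuous_intros)
      then have "w t \<in> borel_measurable (lebesgue_on ?S)"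
        unfolding eq by (intro measurable_restrict_space1 measurable_completion) simp
      from L2_space_cong_AE[OF v2[OF t] this w_AE[OF t]] show ?thesis .
    qed
    have emb_w: "emb ?S (w t) = emb ?S (v t)" if "t > 0" for t
      by (rule emb_eqI[OF S w2 v2 w_AE]) (rule that)+
    have deriv: "has_right_L2_deriv ?S u (w t) t" if t: "t > 0" for t
    proof -
      have "((\<lambda>h. L2_norm ?S (\<lambda>x. (u (t + h) x - u t x) / h - v t x)) \<longlongrightarrow> 0) (at_right 0)"
        using v(1)[OF t] by (simp add: has_right_L2_deriv_def)
      then have "((\<lambda>h. L2_norm ?S (\<lambda>x. (u (t + h) x - u t x) / h - w t x)) \<longlongrightarrow> 0) (at_right 0)"
      proof (rule Lim_transform_eventually)
        show "\<forall>\<^sub>F h in at_right 0. L2_norm ?S (\<lambda>x. (u (t + h) x - u t x) / h - v t x) = L2_norm ?S (\<lambda>x. (u (t + h) x - u t x) / h - w t x)"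
          using eventually_at_right_less[of "0::real"]
        proof eventually_elim
          case (elim h)
          have u2: "u s \<in> L2_space ?S" if "s \<ge> 0" for s
            using sol that unfolding gradient_flow_solution_def by blast
          have q: "(\<lambda>x. (u (t + h) x - u t x) / h) \<in> L2_space ?S"
            using L2_space_scale[OF L2_space_diff[OF u2 u2], of "t + h" t "1 / h"] t elim by simp
          show ?case
            by (simp add: L2_norm_diff_emb[OF S q v2[OF t]] L2_norm_diff_emb[OF S q w2[OF t]] emb_w[OF t])
        qed
      qed
      then show ?thesis using w2[OF t] by (simp add: has_right_L2_deriv_def)
    qed
    have spacetime: "L2_enorm ({0<..<T} \<times> ?S) (\<lambda>(t, x). w t x) \<le> ennreal (sqrt E)" for T
    proof (rule spacetime_norm_bound[OF Sb S g(1) N(2) _ w2])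
      show "w t x = g (t, x)" if "t \<notin> N" for t x using that by (simp add: w_def)
      have "(\<integral>\<^sup>+t. ennreal ((indicator {0<..} t * norm (emb ?S (w t)))\<^sup>2) \<partial>lborel) = (\<integral>\<^sup>+t. ennreal ((indicator {0<..} t * norm (emb ?S (v t)))\<^sup>2) \<partial>lborel)"
        by (intro nn_integral_cong) (auto simp: emb_w indicator_def)
      also have "\<dots> \<le> ennreal (\<phi> 0)" by (rule speed_integral[OF nonneg])
      also have "\<dots> \<le> ennreal ((sqrt E)\<^sup>2)" using \<phi>0 E by (simp add: ennreal_leI)
      finally show "(\<integral>\<^sup>+t. ennreal ((indicator {0<..} t * norm (emb ?S (w t)))\<^sup>2) \<partial>lborel) \<le> ennreal ((sqrt E)\<^sup>2)" .
    qed (use E in simp_all)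
    have pointwise: "L2_enorm ?S (w t) + (if \<gamma> = 0 then 0 else L2_enorm ?S (\<lambda>x. \<gamma> *\<^sub>R weak_hessian bc L (u t) x))
        \<le> ennreal (17 * sqrt (E / \<delta>))" if \<delta>: "0 < \<delta>" "\<delta> \<le> t" for \<delta> t
    proof -
      have t: "t > 0" using \<delta> by simp
      let ?n = "norm (emb ?S (v t))"
      have "?n \<le> sqrt (\<phi> 0 / t)" by (rule speed_bound[OF nonneg t])
      also have "\<dots> \<le> sqrt (E / \<delta>)"
        using \<phi>0 nonneg[of 0] \<delta> by (intro real_sqrt_le_mono frac_le) auto
      finally have n: "?n \<le> sqrt (E / \<delta>)" .
      have 1: "L2_enorm ?S (w t) = ennreal ?n"
        using w2[OF t] norm_emb[OF S w2[OF t]] by (simp add: L2_enorm_def emb_w[OF t])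
      have 2: "(if \<gamma> = 0 then 0 else L2_enorm ?S (\<lambda>x. \<gamma> *\<^sub>R weak_hessian bc L (u t) x)) \<le> ennreal (16 * ?n)"
      proof (cases "\<gamma> = 0")
        case False
        then have g0: "\<gamma> > 0" using \<gamma> by simp
        have "L2_norm ?S (\<lambda>x. - v t x) = ?n"
          by (simp add: norm_emb[OF S v2[OF t]] L2_norm_def)
        then show ?thesis
          using False H2_regularity(2,3)[OF L g0 v(2)[OF t]] by (simp add: L2_enorm_def ennreal_leI)
      qed simp
      have "ennreal ?n + ennreal (16 * ?n) = ennreal (17 * ?n)"
        by (subst ennreal_plus[symmetric]) auto
      also have "\<dots> \<le> ennreal (17 * sqrt (E / \<delta>))" using n by (intro ennreal_leI) simp
      finally show ?thesis
        using 2 unfolding 1 by (meson add_left_mono order_trans)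
    qed
    show ?thesis
    proof (intro exI[of _ w] conjI allI impI)
      show "has_right_L2_deriv ?S u (w t) t" if "t > 0" for t by (rule deriv[OF that])
      show "u t \<in> H2_space bc L" if "\<gamma> > 0" "t > 0" for t
        by (rule H2_regularity(1)[OF L that(1) v(2)[OF that(2)]])
      fix \<delta> T :: real assume \<delta>: "0 < \<delta> \<and> \<delta> < T"
      have "L2_enorm ({0<..<T} \<times> ?S) (\<lambda>(t, x). w t x) + (SUP t\<in>{\<delta>..T}. L2_enorm ?S (w t) + (if \<gamma> = 0 then 0 else L2_enorm ?S (\<lambda>x. \<gamma> *\<^sub>R weak_hessian bc L (u t) x)))
        \<le> ennreal (sqrt E) + ennreal (17 * sqrt (E / \<delta>))"
        using \<delta> by (intro add_mono spacetime SUP_least pointwise) auto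
      also have "\<dots> = ennreal (DATA \<delta> T (H1_norm bc L u0))"
        using E \<delta> by (simp add: DATA_def E_def[symmetric] flip: ennreal_plus)
      finally show "L2_enorm ({0<..<T} \<times> ?S) (\<lambda>(t, x). w t x) + (SUP t\<in>{\<delta>..T}. L2_enorm ?S (w t) + (if \<gamma> = 0 then 0 else L2_enorm ?S (\<lambda>x. \<gamma> *\<^sub>R weak_hessian bc L (u t) x)))
        \<le> ennreal (DATA \<delta> T (H1_norm bc L u0))" .
    qed
  qed
  then show ?thesis by blast
qed

end
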